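(* Let $m,n\ge2$ and let $N$ be a smooth connected $n$-dimensional manifold without boundary. All pairs of maps $f_1,f_2\colon S^m\to N$ are loose if at least one of the following conditions holds: (i) $m<n$; or (ii) $N$ is not compact; or (iii) the fundamental group $\pi_1(N)$ is not finite; or (iv) $N$ is the total space of a Serre fibration with a section and with strictly positive dimensions of the fiber and base (e.g. if $N$ is the product of such spaces).
   Context: Manifolds are Hausdorff with countable basis; maps are continuous. A pair of maps $f_1,f_2\colon S^m\to N$ is loose if there exist maps $f_i'$ homotopic to $f_i$, $i=1,2$, with $f_1'(x)\ne f_2'(x)$ for all $x\in S^m$. *)

theory Defs
  imports "HOL-Analysis.Analysis" "HOL-Algebra.Group"
begin

section \<open>Smooth manifolds\<close>

text \<open>
  \<open>C_k_on k f S\<close> is meant for open \<open>S\<close>: continuity of \<open>f\<close> and of all its iterated directional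
  derivatives up to order \<open>k\<close>, each of those of order less than \<open>k\<close> being Frechet differentiable.
\<close>

primrec C_k_on :: "nat \<Rightarrow> ('a::real_normed_vector \<Rightarrow> 'b::real_normed_vector) \<Rightarrow> 'a set \<Rightarrow> bool"
  where
    "C_k_on 0 f S \<longleftrightarrow> continuous_on S f"
  | "C_k_on (Suc k) f S \<longleftrightarrow>
       (\<forall>x\<in>S. f differentiable (at x)) \<and>
       (\<forall>v. C_k_on k (\<lambda>x. frechet_derivative f (at x) v) S)"

definition smooth_on :: "('a::real_normed_vector \<Rightarrow> 'b::real_normed_vector) \<Rightarrow> 'a set \<Rightarrow> bool"
  where "smooth_on f S \<longleftrightarrow> (\<forall>k. C_k_on k f S)"

definition is_chart :: "'a topology \<Rightarrow> 'a set \<times> ('a \<Rightarrow> real^'n) \<Rightarrow> bool"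
  where "is_chart N = (\<lambda>(U, \<phi>). openin N U \<and> open (\<phi> ` U) \<and>
           homeomorphic_map (subtopology N U) (top_of_set (\<phi> ` U)) \<phi>)"

text \<open>The images of charts are open in the whole of $\mathbb{R}^n$, so there is no boundary.\<close>

definition smooth_manifold :: "'a topology \<Rightarrow> ('a set \<times> ('a \<Rightarrow> real^'n)) set \<Rightarrow> bool"
  where "smooth_manifold N \<A> \<longleftrightarrow>
           Hausdorff_space N \<and> second_countable N \<and>
           (\<forall>c\<in>\<A>. is_chart N c) \<and>
           topspace N = (\<Union>(U, \<phi>)\<in>\<A>. U) \<and>
           (\<forall>(U, \<phi>)\<in>\<A>. \<forall>(V, \<psi>)\<in>\<A>. smooth_on (\<psi> \<circ> inv_into U \<phi>) (\<phi> ` (U \<inter> V)))"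


section \<open>Loose pairs\<close>

definition loose :: "'a topology \<Rightarrow> 'b topology \<Rightarrow> ('a \<Rightarrow> 'b) \<Rightarrow> ('a \<Rightarrow> 'b) \<Rightarrow> bool"
  where "loose X Y f\<^sub>1 f\<^sub>2 \<longleftrightarrow>
           (\<exists>g\<^sub>1 g\<^sub>2. homotopic_with (\<lambda>_. True) X Y f\<^sub>1 g\<^sub>1 \<and>
                   homotopic_with (\<lambda>_. True) X Y f\<^sub>2 g\<^sub>2 \<and>
                   (\<forall>x\<in>topspace X. g\<^sub>1 x \<noteq> g\<^sub>2 x))"


section \<open>The fundamental group\<close>

definition loop_at :: "'a topology \<Rightarrow> 'a \<Rightarrow> (real \<Rightarrow> 'a) \<Rightarrow> bool"
  where "loop_at N x g \<longleftrightarrow> pathin N g \<and> g 0 = x \<and> g 1 = x"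

definition loop_class :: "'a topology \<Rightarrow> 'a \<Rightarrow> (real \<Rightarrow> 'a) \<Rightarrow> (real \<Rightarrow> 'a) set"
  where "loop_class N x g =
           {h. homotopic_with (\<lambda>r. r 0 = x \<and> r 1 = x) (top_of_set {0..1}) N g h}"

definition loop_concat :: "(real \<Rightarrow> 'a) \<Rightarrow> (real \<Rightarrow> 'a) \<Rightarrow> real \<Rightarrow> 'a"
  where "loop_concat g h = (\<lambda>t. if t \<le> 1/2 then g (2 * t) else h (2 * t - 1))"

definition fundamental_group :: "'a topology \<Rightarrow> 'a \<Rightarrow> (real \<Rightarrow> 'a) set monoid"
  where "fundamental_group N x =
           \<lparr>carrier = loop_class N x ` {g. loop_at N x g},
            mult = (\<lambda>A B. \<Union>g\<in>A. \<Union>h\<in>B. loop_class N x (loop_concat g h)),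
            one = loop_class N x (\<lambda>_. x)\<rparr>"

lemma loop_class_eqI:
  assumes "homotopic_with (\<lambda>r. r 0 = x \<and> r 1 = x) (top_of_set {0..1}) N g h"
  shows "loop_class N x g = loop_class N x h"
  using assms unfolding loop_class_def
  by (auto intro: homotopic_with_trans homotopic_with_symD)

lemma loop_class_self: "loop_at N x g \<Longrightarrow> g \<in> loop_class N x g"
  by (simp add: loop_class_def loop_at_def pathin_def)

lemma continuous_loop_concat:
  assumes H: "continuous_map (prod_topology (top_of_set {0..1::real}) (top_of_set {0..1::real})) N H"
      and K: "continuous_map (prod_topology (top_of_set {0..1::real}) (top_of_set {0..1::real})) N K"
      and eq: "\<And>t. t \<in> {0..1} \<Longrightarrow> H (t, 1) = K (t, 0)"
  shows "continuous_map (prod_topology (top_of_set {0..1::real}) (top_of_set {0..1::real})) N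
           (\<lambda>z. loop_concat (\<lambda>s. H (fst z, s)) (\<lambda>s. K (fst z, s)) (snd z))"
proof -
  let ?P = "top_of_set ({0..1::real} \<times> {0..1::real})"
  have P: "prod_topology (top_of_set {0..1::real}) (top_of_set {0..1::real}) = ?P"
    by simp
  have "continuous_map ?P N (\<lambda>z. if snd z \<le> 1/2 then H (fst z, 2 * snd z)
            else K (fst z, 2 * snd z - 1))"
  proof (rule continuous_map_cases_le)
    show "continuous_map ?P euclideanreal snd" "continuous_map ?P euclideanreal (\<lambda>x. 1/2)"
      by (auto intro!: continuous_intros)
    have "continuous_map (subtopology ?P {x \<in> topspace ?P. snd x \<le> 1/2}) ?P (\<lambda>z. (fst z, 2 * snd z))"
      by (auto simp: subtopology_subtopology intro!: continuous_intros)
    from continuous_map_compose[OF this H[unfolded P]]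
    show "continuous_map (subtopology ?P {x \<in> topspace ?P. snd x \<le> 1/2}) N
             (\<lambda>z. H (fst z, 2 * snd z))" by (simp add: o_def)
    have "continuous_map (subtopology ?P {x \<in> topspace ?P. 1/2 \<le> snd x}) ?P (\<lambda>z. (fst z, 2 * snd z - 1))"
      by (auto simp: subtopology_subtopology intro!: continuous_intros)
    from continuous_map_compose[OF this K[unfolded P]]
    show "continuous_map (subtopology ?P {x \<in> topspace ?P. 1/2 \<le> snd x}) N
             (\<lambda>z. K (fst z, 2 * snd z - 1))" by (simp add: o_def)
  next
    fix z assume "z \<in> topspace ?P" "snd z = 1/2"
    then show "H (fst z, 2 * snd z) = K (fst z, 2 * snd z - 1)"
      unfolding \<open>snd z = 1/2\<close> using eq[of "fst z"] by auto
  qed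
  then show ?thesis by (simp add: P loop_concat_def)
qed

lemma homotopic_loop_concat:
  assumes "homotopic_with (\<lambda>r. r 0 = x \<and> r 1 = x) (top_of_set {0..1}) N g g'"
      and "homotopic_with (\<lambda>r. r 0 = x \<and> r 1 = x) (top_of_set {0..1}) N h h'"
  shows "homotopic_with (\<lambda>r. r 0 = x \<and> r 1 = x) (top_of_set {0..1}) N
           (loop_concat g h) (loop_concat g' h')"
proof -
  obtain H where H: "continuous_map (prod_topology (top_of_set {0..1::real}) (top_of_set {0..1::real})) N H"
      "\<And>s. H (0, s) = g s" "\<And>s. H (1, s) = g' s" "\<And>t. t \<in> {0..1} \<Longrightarrow> H (t, 0) = x \<and> H (t, 1) = x"
    using assms(1) unfolding homotopic_with_def by (elim exE conjE) blast
  obtain K where K: "continuous_map (prod_topology (top_of_set {0..1::real}) (top_of_set {0..1::real})) N K"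
      "\<And>s. K (0, s) = h s" "\<And>s. K (1, s) = h' s" "\<And>t. t \<in> {0..1} \<Longrightarrow> K (t, 0) = x \<and> K (t, 1) = x"
    using assms(2) unfolding homotopic_with_def by (elim exE conjE) blast
  show ?thesis
    unfolding homotopic_with_def
  proof (intro exI conjI allI ballI)
    show "continuous_map (prod_topology (top_of_set {0..1}) (top_of_set {0..1})) N
           (\<lambda>z. loop_concat (\<lambda>s. H (fst z, s)) (\<lambda>s. K (fst z, s)) (snd z))"
      using H K by (intro continuous_loop_concat) auto
  qed (use H K in \<open>auto simp: loop_concat_def\<close>)
qed

lemma homotopic_loop_reparam:
  assumes g: "pathin N g"
      and a: "continuous_on {0..1} a" "a ` {0..1} \<subseteq> {0..1::real}"
      and b: "continuous_on {0..1} b" "b ` {0..1} \<subseteq> {0..1}"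
      and ends: "b 0 = a 0" "b 1 = a 1" "g (a 0) = x" "g (a 1) = x"
  shows "homotopic_with (\<lambda>r. r 0 = x \<and> r 1 = x) (top_of_set {0..1::real}) N (g \<circ> a) (g \<circ> b)"
proof -
  have "homotopic_paths {0..1} a b"
  proof (rule homotopic_paths_linear)
    show "closed_segment (a t) (b t) \<subseteq> {0..1}" if "t \<in> {0..1}" for t
    proof -
      have "a t \<in> {0..1}" "b t \<in> {0..1}" using a(2) b(2) that by blast+
      then show ?thesis by (intro closed_segment_subset) auto
    qed
  qed (use a b ends in \<open>auto simp: path_def pathstart_def pathfinish_def\<close>)
  then show ?thesis
    unfolding homotopic_paths_def
    by (rule homotopic_with_compose_continuous_map_left)
       (use g ends in \<open>auto simp: pathin_def pathstart_def pathfinish_def\<close>)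
qed

lemma loop_at_concat:
  assumes "loop_at N x g" "loop_at N x h"
  shows "loop_at N x (loop_concat g h)"
  using homotopic_loop_concat[of x N g g h h] assms
    homotopic_with_imp_continuous_maps[of _ "top_of_set {0..1}" N "loop_concat g h" "loop_concat g h"]
  by (auto simp: loop_at_def pathin_def loop_concat_def)

lemma mult_fundamental_group:
  assumes "loop_at N x g" "loop_at N x h"
  shows "loop_class N x g \<otimes>\<^bsub>fundamental_group N x\<^esub> loop_class N x h = loop_class N x (loop_concat g h)"
proof -
  have "loop_class N x (loop_concat g' h') = loop_class N x (loop_concat g h)"
    if "g' \<in> loop_class N x g" "h' \<in> loop_class N x h" for g' h'
    using that homotopic_loop_concat[of x N g g' h h']
    by (intro loop_class_eqI[symmetric]) (auto simp: loop_class_def)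
  then have "(\<Union>g'\<in>loop_class N x g. \<Union>h'\<in>loop_class N x h. loop_class N x (loop_concat g' h'))
      = (\<Union>g'\<in>loop_class N x g. \<Union>h'\<in>loop_class N x h. loop_class N x (loop_concat g h))"
    by (intro SUP_cong refl)
  also have "\<dots> = loop_class N x (loop_concat g h)"
    using loop_class_self[OF assms(1)] loop_class_self[OF assms(2)] by blast
  finally show ?thesis by (simp only: fundamental_group_def monoid.simps)
qed

lemma loop_at_const: "x \<in> topspace N \<Longrightarrow> loop_at N x (\<lambda>_. x)"
  by (simp add: loop_at_def pathin_def)

lemma loop_class_reparam:
  assumes "pathin N g"
      and "continuous_on {0..1} a" "a ` {0..1} \<subseteq> {0..1::real}"
      and "continuous_on {0..1} b" "b ` {0..1} \<subseteq> {0..1}"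
      and "b 0 = a 0" "b 1 = a 1" "g (a 0) = x" "g (a 1) = x"
      and "\<And>t. g (a t) = g' t" "\<And>t. g (b t) = h' t"
  shows "loop_class N x g' = loop_class N x h'"
proof -
  have "g' = g \<circ> a" "h' = g \<circ> b" using assms by auto
  then show ?thesis using loop_class_eqI[OF homotopic_loop_reparam[OF assms(1-9)]] by simp
qed

theorem group_fundamental_group:
  assumes x: "x \<in> topspace N"
  shows "group (fundamental_group N x)"
proof (rule groupI)
  let ?G = "fundamental_group N x"
  have carrier: "\<exists>g. loop_at N x g \<and> A = loop_class N x g" if "A \<in> carrier ?G" for A
    using that by (auto simp: fundamental_group_def)
  have carrierI: "loop_class N x g \<in> carrier ?G" if "loop_at N x g" for g
    using that by (auto simp: fundamental_group_def)
  have one: "\<one>\<^bsub>?G\<^esub> = loop_class N x (\<lambda>_. x)" by (simp add: fundamental_group_def)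
  show "\<one>\<^bsub>?G\<^esub> \<in> carrier ?G" using carrierI[OF loop_at_const[OF x]] one by simp
  show "A \<otimes>\<^bsub>?G\<^esub> B \<in> carrier ?G" if "A \<in> carrier ?G" "B \<in> carrier ?G" for A B
  proof -
    obtain f g where "loop_at N x f" "A = loop_class N x f" "loop_at N x g" "B = loop_class N x g"
      using carrier[OF \<open>A \<in> carrier ?G\<close>] carrier[OF \<open>B \<in> carrier ?G\<close>] by blast
    then show ?thesis by (simp add: mult_fundamental_group carrierI loop_at_concat)
  qed
  show "A \<otimes>\<^bsub>?G\<^esub> B \<otimes>\<^bsub>?G\<^esub> C = A \<otimes>\<^bsub>?G\<^esub> (B \<otimes>\<^bsub>?G\<^esub> C)"
    if ABC: "A \<in> carrier ?G" "B \<in> carrier ?G" "C \<in> carrier ?G" for A B C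
  proof -
    obtain f g h where f: "loop_at N x f" "A = loop_class N x f" and g: "loop_at N x g" "B = loop_class N x g"
      and h: "loop_at N x h" "C = loop_class N x h" using carrier[OF ABC(1)] carrier[OF ABC(2)] carrier[OF ABC(3)] by blast
    let ?l = "loop_concat f (loop_concat g h)"
    define a where "a t = min (2 * t) (min (t + 1/4) ((t + 1) / 2))" for t :: real
    have eq: "?l (a t) = loop_concat (loop_concat f g) h t" for t
    proof -
      consider "t \<le> 1/4" | "1/4 < t" "t \<le> 1/2" | "1/2 < t" by linarith
      then show ?thesis
      proof cases
        case 1
        then have "a t = 2 * t" by (simp add: a_def)
        then show ?thesis using 1 by (simp add: loop_concat_def)
      next
        case 2
        then have "a t = t + 1/4" by (simp add: a_def)
        then show ?thesis using 2 by (simp add: loop_concat_def algebra_simps)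
      next
        case 3
        then have a: "a t = (t + 1) / 2" by (simp add: a_def)
        show ?thesis unfolding a using 3 by (simp add: loop_concat_def field_simps)
      qed
    qed
    have "loop_class N x (loop_concat (loop_concat f g) h) = loop_class N x ?l"
    proof (rule loop_class_reparam[of N ?l a id])
      show "pathin N ?l" using loop_at_concat[OF f(1) loop_at_concat[OF g(1) h(1)]] by (simp add: loop_at_def)
      show "continuous_on {0..1} a" unfolding a_def by (intro continuous_intros) auto
      show "a ` {0..1} \<subseteq> {0..1}" by (auto simp: a_def min_def)
      show "?l (a 0) = x" "?l (a 1) = x" using f h by (auto simp: a_def loop_concat_def loop_at_def)
    qed (use eq in \<open>auto simp: a_def\<close>)
    then show ?thesis using f g h by (simp add: mult_fundamental_group loop_at_concat)
  qed
  show "\<one>\<^bsub>?G\<^esub> \<otimes>\<^bsub>?G\<^esub> A = A" if "A \<in> carrier ?G" for A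
  proof -
    obtain f where f: "loop_at N x f" "A = loop_class N x f" using carrier[OF \<open>A \<in> carrier ?G\<close>] by blast
    have "loop_class N x (loop_concat (\<lambda>_. x) f) = loop_class N x f"
    proof (rule loop_class_reparam[of N f "\<lambda>t. max 0 (2 * t - 1)" id])
      show "continuous_on {0..1} (\<lambda>t::real. max 0 (2 * t - 1))" by (intro continuous_intros)
      show "f (max 0 (2 * t - 1)) = loop_concat (\<lambda>_. x) f t" for t
      proof -
        consider "t = 1/2" | "t < 1/2" | "1/2 < t" by linarith
        then show ?thesis
        proof cases
          case 1
          show ?thesis unfolding 1 using f by (simp add: loop_at_def loop_concat_def)
        qed (use f in \<open>auto simp: loop_at_def loop_concat_def max_def\<close>)
      qed
    qed (use f in \<open>auto simp: loop_at_def\<close>)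
    then show ?thesis using f x by (simp add: one mult_fundamental_group loop_at_const)
  qed
  show "\<exists>B\<in>carrier ?G. B \<otimes>\<^bsub>?G\<^esub> A = \<one>\<^bsub>?G\<^esub>" if "A \<in> carrier ?G" for A
  proof -
    obtain f where f: "loop_at N x f" "A = loop_class N x f" using carrier[OF \<open>A \<in> carrier ?G\<close>] by blast
    let ?r = "f \<circ> (\<lambda>t. 1 - t)"
    have "continuous_map (top_of_set {0..1}) (top_of_set {0..1}) (\<lambda>t::real. 1 - t)"
      by (auto intro!: continuous_intros)
    then have r: "loop_at N x ?r"
      using f(1) continuous_map_compose[of "top_of_set {0..1}" "top_of_set {0..1}" "\<lambda>t::real. 1 - t" N f]
      by (simp add: loop_at_def pathin_def)
    have "loop_class N x (loop_concat ?r f) = loop_class N x (\<lambda>_. x)"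
    proof (rule loop_class_reparam[of N f "\<lambda>t. \<bar>1 - 2 * t\<bar>" "\<lambda>_. 1"])
      show "continuous_on {0..1} (\<lambda>t::real. \<bar>1 - 2 * t\<bar>)" by (intro continuous_intros)
      show "f \<bar>1 - 2 * t\<bar> = loop_concat ?r f t" for t
        by (cases "t \<le> 1/2") (auto simp: loop_concat_def)
    qed (use f in \<open>auto simp: loop_at_def\<close>)
    then show ?thesis unfolding f(2) one
      by (intro bexI[OF _ carrierI[OF r]]) (simp add: mult_fundamental_group f(1) r)
  qed
qed


section \<open>Serre fibrations\<close>

definition unit_cube :: "nat \<Rightarrow> (nat \<Rightarrow> real) topology"
  where "unit_cube k = product_topology (\<lambda>_. top_of_set {0..1}) {..<k}"

definition serre_fibration :: "'a topology \<Rightarrow> 'b topology \<Rightarrow> ('a \<Rightarrow> 'b) \<Rightarrow> bool"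
  where "serre_fibration E B p \<longleftrightarrow>
           continuous_map E B p \<and>
           (\<forall>k g h.
              continuous_map (unit_cube k) E g \<and>
              continuous_map (prod_topology (top_of_set {0..1::real}) (unit_cube k)) B h \<and>
              (\<forall>z\<in>topspace (unit_cube k). h (0, z) = p (g z)) \<longrightarrow>
              (\<exists>H. continuous_map (prod_topology (top_of_set {0..1}) (unit_cube k)) E H \<and>
                   (\<forall>z\<in>topspace (unit_cube k). H (0, z) = g z) \<and>
                   (\<forall>t\<in>{0..1}. \<forall>z\<in>topspace (unit_cube k). p (H (t, z)) = h (t, z))))"

definition fibre :: "'a topology \<Rightarrow> ('a \<Rightarrow> 'b) \<Rightarrow> 'b \<Rightarrow> 'a topology"
  where "fibre E p b = subtopology E {x \<in> topspace E. p x = b}"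

text \<open>
  Base and fibre of a Serre fibration need not be manifolds, so dimension is the small inductive
  dimension \<^const>\<open>dimension_le\<close>. On manifolds, positivity agrees with positivity of the usual dimension;
  the lemma below gives the implication that makes every fibration with positive-dimensional
  manifolds as base and fibre an instance.
\<close>

definition positive_dimensional :: "'a topology \<Rightarrow> bool"
  where "positive_dimensional X \<longleftrightarrow> \<not> X dim_le 0"

lemma positive_dimensional_if_Euclidean_subspace:
  assumes "subtopology X S homeomorphic_space Euclidean_space k" "0 < k"
  shows "positive_dimensional X"
proof -
  let ?E = "Euclidean_space k"
  have "\<not> ?E dim_le 0"
  proof
    assume "?E dim_le 0"
    then have nb: "neighbourhood_base_of (\<lambda>U. closedin ?E U \<and> openin ?E U) ?E"
      by (simp add: dimension_le_0_neighbourhood_base_of_clopen)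
    let ?a = "(\<lambda>_. 0) :: nat \<Rightarrow> real" and ?b = "(\<lambda>i. if i = 0 then 1 else 0) :: nat \<Rightarrow> real"
    have ab: "?a \<in> topspace ?E" "?b \<in> topspace ?E" "?a \<noteq> ?b"
      using assms(2) by (auto simp: topspace_Euclidean_space fun_eq_iff)
    have "openin ?E (topspace ?E - {?b})"
      using Hausdorff_Euclidean_space[of k] ab
      by (simp add: closedin_Hausdorff_singleton openin_diff)
    then obtain U V where "openin ?E U" "closedin ?E V" "openin ?E V" "?a \<in> U" "U \<subseteq> V"
        "V \<subseteq> topspace ?E - {?b}"
      using nb ab unfolding neighbourhood_base_of by (metis Diff_iff singletonD)
    then show False
      using connected_Euclidean_space[of k] ab unfolding connected_space_clopen_in by blast
  qed
  then show ?thesis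
    using assms(1) dimension_le_subtopology homeomorphic_space_dimension_le
    unfolding positive_dimensional_def by blast
qed

end

theory Submission
  imports Defs
begin

text \<open>
  It suffices that every map \<open>S\<^sup>m \<rightarrow> N\<close> is homotopic to a map that misses a point. Indeed, deform
  \<open>f\<^sub>1\<close> to miss \<open>y\<^sub>1\<close> and be constantly \<open>z\<^sub>1\<close> on the lower hemisphere, and \<open>f\<^sub>2\<close> to miss \<open>y\<^sub>2\<close> and be
  constantly \<open>z\<^sub>2\<close> on the upper one. Since \<open>N\<close> minus a point is connected, an injective map homotopic
  to the identity carries \<open>z\<^sub>1\<close> to \<open>y\<^sub>2\<close> and \<open>y\<^sub>1\<close> to \<open>z\<^sub>2\<close>; after composing \<open>f\<^sub>1\<close> with it the two maps
  have no coincidence on either hemisphere.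

  A point is missed: for \<open>m < n\<close> after polynomial approximation in one chart; trivially if \<open>N\<close> is not
  compact; for infinite fundamental group because the lifted image in the universal cover meets only
  finitely many points of an infinite discrete fibre, and these can be pushed off one at a time; for
  a fibration with section because \<open>f\<close> is homotopic to a map into the union of the section and the
  fibre over a single point \<open>b\<close>, which is not all of \<open>N\<close> if \<open>b\<close> is chosen off the given fibre.
\<close>

section \<open>Coordinate balls and pushing points\<close>

text \<open>No coincidence remains because below the equator the first map is constantly
  \<open>y2\<close>, a value the second misses, while above it the second is constantly
  \<open>z2\<close>, the image of the point \<open>y1\<close> missed by the first, and injectivity
  keeps all other points away from \<open>z2\<close>. The same principle, that an injective self-map
  transports a missed point, clears the fibre of the universal cover. Two pushes are composed, the
  second fixing the result of the first; hence complements of points must be connected, and hence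
  the dimension is at least 2. Maps of spheres are handled on the cube with constant boundary
  values: the lifting property speaks of cubes, and segments in direction 0 supply canonical paths
  starting on the boundary. The collapse of the sphere through the cube, homotopic to the identity,
  also makes maps constant on a hemisphere. In the lift to the universal cover a second direction of
  the cube contracts loops, so \<open>m \<ge> 2\<close> is used there.\<close>

abbreviation homot :: "'a topology \<Rightarrow> 'b topology \<Rightarrow> ('a \<Rightarrow> 'b) \<Rightarrow> ('a \<Rightarrow> 'b) \<Rightarrow> bool"
  where "homot \<equiv> homotopic_with (\<lambda>_. True)"

lemma continuous_map_scaleR [continuous_intros]:
  fixes g :: "'a \<Rightarrow> 'b::real_normed_vector"
  shows "\<lbrakk>continuous_map X euclideanreal f; continuous_map X euclidean g\<rbrakk>
         \<Longrightarrow> continuous_map X euclidean (\<lambda>x. f x *\<^sub>R g x)"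
  by (simp add: continuous_map_atin tendsto_scaleR)

text \<open>A chart read backwards: an open embedding of the unit ball. The normalised centre and
  radius let every deformation be confined to the half ball, leaving a collar in which nothing
  changes.\<close>

definition coord_ball :: "'a topology \<Rightarrow> ('e::euclidean_space \<Rightarrow> 'a) \<Rightarrow> bool"
  where "coord_ball X \<psi> \<longleftrightarrow>
           continuous_map (top_of_set (ball 0 1)) X \<psi> \<and> inj_on \<psi> (ball 0 1) \<and>
           (\<forall>V. open V \<longrightarrow> V \<subseteq> ball 0 1 \<longrightarrow> openin X (\<psi> ` V))"

lemma coord_ball_inverse:
  assumes "coord_ball X (\<psi> :: 'e::euclidean_space \<Rightarrow> 'a)"
  shows "continuous_map (subtopology X (\<psi> ` ball 0 1)) (top_of_set (ball 0 1)) (inv_into (ball 0 1) \<psi>)"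
  unfolding continuous_map
proof (intro conjI allI impI)
  have inj: "inj_on \<psi> (ball 0 1)" using assms by (simp add: coord_ball_def)
  show "inv_into (ball 0 1) \<psi> ` topspace (subtopology X (\<psi> ` ball 0 1)) \<subseteq> topspace (top_of_set (ball 0 1))"
    using inj by (auto simp del: mem_ball)
  fix V assume "openin (top_of_set (ball 0 1)) (V :: 'e set)"
  then have V: "open V" "V \<subseteq> ball 0 1" by (auto simp: openin_open)
  then have op: "openin X (\<psi> ` V)" using assms by (simp add: coord_ball_def)
  have "{x \<in> topspace (subtopology X (\<psi> ` ball 0 1)). inv_into (ball 0 1) \<psi> x \<in> V} = \<psi> ` V"
  proof
    show "{x \<in> topspace (subtopology X (\<psi> ` ball 0 1)). inv_into (ball 0 1) \<psi> x \<in> V} \<subseteq> \<psi> ` V"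
    proof clarify
      fix x assume "x \<in> topspace (subtopology X (\<psi> ` ball 0 1))" "inv_into (ball 0 1) \<psi> x \<in> V"
      moreover from this have "\<psi> (inv_into (ball 0 1) \<psi> x) = x"
        by (intro f_inv_into_f) simp
      ultimately show "x \<in> \<psi> ` V" by (metis image_eqI)
    qed
    show "\<psi> ` V \<subseteq> {x \<in> topspace (subtopology X (\<psi> ` ball 0 1)). inv_into (ball 0 1) \<psi> x \<in> V}"
    proof clarify
      fix v assume v: "v \<in> V"
      then have "v \<in> ball 0 1" using V by blast
      then show "\<psi> v \<in> topspace (subtopology X (\<psi> ` ball 0 1)) \<and> inv_into (ball 0 1) \<psi> (\<psi> v) \<in> V"
        using v inv_into_f_f[OF inj] openin_subset[OF op] by (simp del: mem_ball) blast
    qed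
  qed
  then show "openin (subtopology X (\<psi> ` ball 0 1)) {x \<in> topspace (subtopology X (\<psi> ` ball 0 1)). inv_into (ball 0 1) \<psi> x \<in> V}"
    using op image_mono[OF V(2), of \<psi>] unfolding openin_subtopology by (intro exI[of _ "\<psi> ` V"]) auto
qed

lemma coord_ball_openin: "coord_ball X (\<psi> :: 'e::euclidean_space \<Rightarrow> 'a) \<Longrightarrow> openin X (\<psi> ` ball 0 1)"
  by (simp add: coord_ball_def)

text \<open>Compactness passes to the image, and Hausdorffness makes it closed in all of
  \<open>X\<close>. Hence the complement of the half ball is open, as gluing along the collar
  requires.\<close>

lemma coord_ball_closedin_cball:
  assumes "coord_ball X (\<psi> :: 'e::euclidean_space \<Rightarrow> 'a)" "Hausdorff_space X" "r < 1"
  shows "closedin X (\<psi> ` cball 0 r)"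
proof -
  have "compactin (top_of_set (ball 0 1)) (cball (0::'e) r)"
    using assms(3) by (auto simp: compactin_subtopology)
  then show ?thesis
    using assms(1,2) unfolding coord_ball_def
    by (intro compactin_imp_closedin image_compactin[of "top_of_set (ball 0 1)"]) auto
qed

text \<open>Inside the ball the chart expression of \<open>f\<close> and \<open>k\<close> are joined
  by a straight line, which convexity keeps in the ball. Since \<open>k\<close> agrees with that
  expression beyond radius 1/2, the homotopy is stationary there and fits with the constant homotopy
  outside the closed half ball.\<close>

lemma coord_ball_modify:
  fixes \<psi> :: "'e::euclidean_space \<Rightarrow> 'a" and k :: "'c \<Rightarrow> 'e"
  assumes X: "Hausdorff_space X" and \<psi>: "coord_ball X \<psi>" and f: "continuous_map Z X f"
    and k: "continuous_map (subtopology Z {z \<in> topspace Z. f z \<in> \<psi> ` ball 0 1}) euclidean k"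
    and k_in: "\<And>z. z \<in> topspace Z \<Longrightarrow> f z \<in> \<psi> ` ball 0 1 \<Longrightarrow> k z \<in> ball 0 1"
    and k_out: "\<And>z. z \<in> topspace Z \<Longrightarrow> f z \<in> \<psi> ` ball 0 1 \<Longrightarrow> norm (inv_into (ball 0 1) \<psi> (f z)) > 1/2
                 \<Longrightarrow> k z = inv_into (ball 0 1) \<psi> (f z)"
  shows "homot Z X f (\<lambda>z. if f z \<in> \<psi> ` ball 0 1 then \<psi> (k z) else f z)"
proof -
  let ?U = "\<psi> ` ball 0 1" and ?c = "inv_into (ball 0 1) \<psi>" and ?I = "top_of_set {0..1::real}"
  let ?D = "{z \<in> topspace Z. f z \<in> ?U}" and ?C = "{z \<in> topspace Z. f z \<notin> \<psi> ` cball 0 (1/2)}"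
  let ?P = "prod_topology ?I Z"
  define H where "H = (\<lambda>(t, z). if f z \<in> ?U then \<psi> ((1 - t) *\<^sub>R ?c (f z) + t *\<^sub>R k z) else f z)"
  have c_in: "?c y \<in> ball 0 1" "\<psi> (?c y) = y" if "y \<in> ?U" for y
    using inv_into_into[OF that] f_inv_into_f[OF that] by blast+
  have "continuous_map ?P X H"
  \<comment> \<open>Two open pieces: \<open>True\<close> stands for the preimage of the ball,
    \<open>False\<close> for the preimage of the complement of the closed half ball.\<close>
  proof (rule pasting_lemma[where I=UNIV and T="\<lambda>b. {0..1} \<times> (if b then ?D else ?C)"
           and f="\<lambda>b (t,z). if b then \<psi> ((1 - t) *\<^sub>R ?c (f z) + t *\<^sub>R k z) else f z"])
    fix b :: bool
    have "openin Z ?D" using openin_continuous_map_preimage[OF f coord_ball_openin[OF \<psi>]] .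
    moreover have "openin Z {z \<in> topspace Z. f z \<in> topspace X - \<psi> ` cball 0 (1/2)}"
      by (intro openin_continuous_map_preimage[OF f] openin_diff)
         (use coord_ball_closedin_cball[OF \<psi> X, of "1/2"] in auto)
    moreover have "{z \<in> topspace Z. f z \<in> topspace X - \<psi> ` cball 0 (1/2)} = ?C"
      using continuous_map_image_subset_topspace[OF f] by blast
    ultimately have "openin Z (if b then ?D else ?C)" by simp
    then show "openin ?P ({0..1} \<times> (if b then ?D else ?C))"
      by (auto simp: openin_prod_Times_iff)
    show "continuous_map (subtopology ?P ({0..1} \<times> (if b then ?D else ?C))) X
            (\<lambda>(t, z). if b then \<psi> ((1 - t) *\<^sub>R ?c (f z) + t *\<^sub>R k z) else f z)"
    proof (cases b)
      case False
      have "continuous_map (subtopology ?P ({0..1} \<times> ?C)) X (f \<circ> snd)"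
        by (intro continuous_map_from_subtopology continuous_map_compose[OF continuous_map_snd f])
      then show ?thesis using False by (simp add: case_prod_unfold o_def)
    next
      case True
      let ?Q = "prod_topology ?I (subtopology Z ?D)"
      have Q: "subtopology ?P ({0..1} \<times> ?D) = ?Q"
        by (simp add: prod_topology_subtopology subtopology_subtopology)
      have fD: "continuous_map (subtopology Z ?D) (subtopology X ?U) f"
        by (auto simp: continuous_map_in_subtopology intro: continuous_map_from_subtopology f)
      have cf: "continuous_map (subtopology Z ?D) euclidean (\<lambda>z. ?c (f z))"
        using continuous_map_compose[OF fD coord_ball_inverse[OF \<psi>]]
        by (simp add: o_def continuous_map_in_subtopology)
      have fst: "continuous_map ?Q euclideanreal fst"
        using continuous_map_fst continuous_map_in_subtopology by blast
      have "continuous_map ?Q euclidean (\<lambda>x. (1 - fst x) *\<^sub>R ?c (f (snd x)) + fst x *\<^sub>R k (snd x))"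
        using continuous_map_compose[OF continuous_map_snd cf] continuous_map_compose[OF continuous_map_snd k] fst
        by (intro continuous_intros) (auto simp: o_def)
      moreover have in_ball: "(1 - t) *\<^sub>R ?c (f z) + t *\<^sub>R k z \<in> ball 0 1" if "t \<in> {0..1}" "z \<in> ?D" for t z
        using that c_in(1)[of "f z"] k_in[of z] convex_ball[of "0::'e" 1]
        by (intro convexD) (auto simp del: mem_ball)
      ultimately have "continuous_map ?Q (top_of_set (ball 0 1)) (\<lambda>x. (1 - fst x) *\<^sub>R ?c (f (snd x)) + fst x *\<^sub>R k (snd x))"
      proof (intro continuous_map_into_subtopology funcsetI)
        fix x assume "x \<in> topspace ?Q"
        then have "fst x \<in> {0..1}" "snd x \<in> ?D" by auto
        then show "(1 - fst x) *\<^sub>R ?c (f (snd x)) + fst x *\<^sub>R k (snd x) \<in> ball 0 1" by (rule in_ball)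
      qed
      from continuous_map_compose[OF this] \<psi>
      have "continuous_map ?Q X (\<lambda>x. \<psi> ((1 - fst x) *\<^sub>R ?c (f (snd x)) + fst x *\<^sub>R k (snd x)))"
        by (auto simp: coord_ball_def o_def)
      then show ?thesis using True by (simp add: Q case_prod_unfold del: image_cong_simp)
    qed
  next
    fix i j :: bool and x
    have *: "\<psi> ((1 - t) *\<^sub>R ?c (f z) + t *\<^sub>R k z) = f z" if "z \<in> ?D" "z \<in> ?C" for t z
    proof -
      have "norm (?c (f z)) > 1/2"
        using that c_in[of "f z"] by (metis (mono_tags, lifting) image_eqI mem_Collect_eq mem_cball_0 not_le)
      with that have "k z = ?c (f z)" using k_out by blast
      then show ?thesis using c_in(2)[of "f z"] that by (simp add: algebra_simps)
    qed
    assume "x \<in> topspace ?P \<inter> ({0..1} \<times> (if i then ?D else ?C)) \<inter> ({0..1} \<times> (if j then ?D else ?C))"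
    then show "(\<lambda>(t, z). if i then \<psi> ((1 - t) *\<^sub>R ?c (f z) + t *\<^sub>R k z) else f z) x =
         (\<lambda>(t, z). if j then \<psi> ((1 - t) *\<^sub>R ?c (f z) + t *\<^sub>R k z) else f z) x"
      using * by (cases x; cases i; cases j) auto
  next
    fix x assume x: "x \<in> topspace ?P"
    obtain t z where tz: "x = (t, z)" by (cases x)
    have "\<psi> ` cball 0 (1/2) \<subseteq> ?U" by (intro image_mono) auto
    then show "\<exists>j. j \<in> UNIV \<and> x \<in> {0..1} \<times> (if j then ?D else ?C) \<and>
             H x = (\<lambda>(t, z). if j then \<psi> ((1 - t) *\<^sub>R ?c (f z) + t *\<^sub>R k z) else f z) x"
      using x by (intro exI[of _ "f z \<in> ?U"]) (auto simp: tz H_def)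
  qed
  then show ?thesis
    by (intro homotopic_with[THEN iffD2] exI[of _ H]) (auto simp: H_def c_in simp del: mem_ball)
qed

text \<open>Isolates what the pushing arguments need, so that they apply both to \<open>N\<close>
  and to its universal cover. The \<open>itself\<close> argument fixes the model space
  \<open>'e\<close> and thereby the dimension.\<close>

locale manifold_topology =
  fixes X :: "'a topology" and E :: "'e::euclidean_space itself"
  assumes Hausdorff: "Hausdorff_space X"
    and coord_ball_at: "openin X W \<Longrightarrow> x \<in> W \<Longrightarrow> \<exists>\<psi> :: 'e \<Rightarrow> 'a. coord_ball X \<psi> \<and> \<psi> 0 = x \<and> \<psi> ` ball 0 1 \<subseteq> W"
begin

text \<open>Homotopy to the identity lets \<open>\<theta>\<close> be composed with any map without
  leaving its homotopy class; injectivity makes a map that misses \<open>a\<close> miss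
  \<open>b\<close> after the composition; \<open>M\<close> is the region where points may move, so
  that all others are protected.\<close>

definition pushes_to :: "'a set \<Rightarrow> 'a \<Rightarrow> 'a \<Rightarrow> bool"
  where "pushes_to M a b \<longleftrightarrow>
     (\<exists>\<theta>. homot X X id \<theta> \<and> inj_on \<theta> (topspace X) \<and> (\<forall>x\<in>topspace X - M. \<theta> x = x) \<and> \<theta> a = b)"

lemma pushes_to_trans:
  assumes "pushes_to M a b" "pushes_to M b c" and "M \<subseteq> topspace X"
  shows "pushes_to M a c"
proof -
  obtain \<theta> \<eta> where \<theta>: "homot X X id \<theta>" "inj_on \<theta> (topspace X)" "\<forall>x\<in>topspace X - M. \<theta> x = x" "\<theta> a = b"
    and \<eta>: "homot X X id \<eta>" "inj_on \<eta> (topspace X)" "\<forall>x\<in>topspace X - M. \<eta> x = x" "\<eta> b = c"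
    using assms unfolding pushes_to_def by blast
  have c: "continuous_map X X \<theta>" using \<theta>(1) homotopic_with_imp_continuous_maps by blast
  have "homot X X (id \<circ> \<theta>) (\<eta> \<circ> \<theta>)"
    using homotopic_with_compose_continuous_map_right[OF \<eta>(1) c] by auto
  then have "homot X X id (\<eta> \<circ> \<theta>)" using \<theta>(1) homotopic_with_trans by (metis id_comp)
  moreover have "inj_on (\<eta> \<circ> \<theta>) (topspace X)"
    using \<theta>(2) \<eta>(2) continuous_map_image_subset_topspace[OF c] by (auto intro: comp_inj_on inj_on_subset)
  ultimately show ?thesis unfolding pushes_to_def using \<theta> \<eta>
    by (intro exI[of _ "\<eta> \<circ> \<theta>"]) auto
qed

text \<open>A homeomorphism of the ball that moves \<open>u\<close> to \<open>v\<close> and is the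
  identity outside the half ball is transported to \<open>X\<close> and extended by the identity.
  That support condition is exactly what \<open>coord_ball_modify\<close> asks for.\<close>

lemma pushes_to_in_coord_ball:
  fixes \<psi> :: "'e \<Rightarrow> 'a"
  assumes \<psi>: "coord_ball X \<psi>" and sub: "\<psi> ` ball 0 1 \<subseteq> M" and uv: "u \<in> ball 0 (1/2)" "v \<in> ball 0 (1/2)"
  shows "pushes_to M (\<psi> u) (\<psi> v)"
proof -
  let ?B = "ball 0 1 :: 'e set"
  have inj: "inj_on \<psi> ?B" using \<psi> by (simp add: coord_ball_def)
  have inv: "inv_into ?B \<psi> (\<psi> w) = w" if "w \<in> ?B" for w using inj that by simp
  obtain f g where fg: "homeomorphism ?B ?B f g" "f u = v" "{x. \<not> (f x = x \<and> g x = x)} \<subseteq> ball 0 (1/2)"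
  proof (rule homeomorphism_moving_point[of "ball 0 (1/2) :: 'e set" "?B" u v])
    have "affine hull (ball 0 (1/2) :: 'e set) = UNIV" "affine hull ?B = UNIV"
      by (simp_all add: affine_hull_open)
    then show "openin (top_of_set (affine hull (ball 0 (1/2)))) (ball 0 (1/2) :: 'e set)"
      "?B \<subseteq> affine hull (ball 0 (1/2))" by (simp_all add: open_openin[symmetric])
  qed (use uv that in auto)
  define \<theta> where "\<theta> = (\<lambda>x. if id x \<in> \<psi> ` ?B then \<psi> (f (inv_into ?B \<psi> x)) else id x)"
  have f: "f w \<in> ?B" "f w = w \<or> norm w < 1/2" if "w \<in> ?B" for w
    using that fg(1) homeomorphism_image1 apply fastforce
    using fg(3) by fastforce
  have injf: "inj_on f ?B" using fg(1) by (metis homeomorphism_def inj_on_inverseI)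
  have U: "{z \<in> topspace X. id z \<in> \<psi> ` ?B} = \<psi> ` ?B"
    using openin_subset[OF coord_ball_openin[OF \<psi>]] by (simp add: set_eq_iff del: mem_ball) blast
  have "homot X X id \<theta>" unfolding \<theta>_def
  proof (rule coord_ball_modify[OF Hausdorff \<psi>])
    have "continuous_map (top_of_set ?B) euclidean f"
      using fg(1) by (simp add: homeomorphism_def)
    from continuous_map_compose[OF coord_ball_inverse[OF \<psi>] this]
    show "continuous_map (subtopology X {z \<in> topspace X. id z \<in> \<psi> ` ?B}) euclidean (\<lambda>x. f (inv_into ?B \<psi> x))"
      unfolding o_def U .
    show "f (inv_into ?B \<psi> z) = inv_into ?B \<psi> (id z)"
      if "id z \<in> \<psi> ` ?B" "1/2 < norm (inv_into ?B \<psi> (id z))" for z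
      using f(2)[of "inv_into ?B \<psi> z"] that inv_into_into[of z \<psi> ?B] by (simp del: mem_ball)
    show "f (inv_into ?B \<psi> z) \<in> ?B" if "id z \<in> \<psi> ` ?B" for z
      using f(1)[of "inv_into ?B \<psi> z"] that inv_into_into[of z \<psi> ?B] by (simp del: mem_ball)
  qed (rule continuous_map_id)
  moreover have "inj_on \<theta> (topspace X)"
  proof (rule inj_onI)
    fix x y assume xy: "\<theta> x = \<theta> y"
    have in_iff: "\<theta> z \<in> \<psi> ` ?B \<longleftrightarrow> z \<in> \<psi> ` ?B" for z
      using f(1)[OF inv_into_into[of z \<psi> ?B]] by (simp add: \<theta>_def del: mem_ball)
    show "x = y"
    proof (cases "x \<in> \<psi> ` ?B")
      case False
      with xy in_iff have "y \<notin> \<psi> ` ?B" by metis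
      with False xy show ?thesis by (simp add: \<theta>_def del: mem_ball)
    next
      case True
      with xy in_iff have y: "y \<in> \<psi> ` ?B" by metis
      obtain v w where v: "v \<in> ?B" "x = \<psi> v" and w: "w \<in> ?B" "y = \<psi> w" using True y by blast
      have "\<psi> (f v) = \<psi> (f w)" using xy v w by (simp add: \<theta>_def inv del: mem_ball)
      then have "f v = f w" using inj f(1) v(1) w(1) by (metis inj_onD)
      then show ?thesis using injf v w by (metis inj_onD)
    qed
  qed
  moreover have "\<theta> (\<psi> u) = \<psi> v"
    using uv fg(2) by (auto simp: \<theta>_def inv)
  ultimately show ?thesis using sub unfolding pushes_to_def \<theta>_def by (intro exI[of _ \<theta>]) (auto simp: \<theta>_def)
qed

text \<open>The points reachable from \<open>a\<close> form an open set, and so do the unreachable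
  ones, because near any point of \<open>M\<close> all points can be pushed to one another inside
  \<open>M\<close>.\<close>

lemma pushes_to_connected:
  assumes M: "openin X M" "connectedin X M" and ab: "a \<in> M" "b \<in> M"
  shows "pushes_to M a b"
proof -
  have sub: "M \<subseteq> topspace X" using M(1) by (simp add: openin_subset)
  have local: "\<exists>W. openin X W \<and> y \<in> W \<and> W \<subseteq> M \<and> (\<forall>x\<in>W. \<forall>z\<in>W. pushes_to M x z)" if y: "y \<in> M" for y
  proof -
    obtain \<psi> :: "'e \<Rightarrow> 'a" where \<psi>: "coord_ball X \<psi>" "\<psi> 0 = y" "\<psi> ` ball 0 1 \<subseteq> M"
      using coord_ball_at[OF M(1) y] by blast
    have "(ball 0 (1/2) :: 'e set) \<subseteq> ball 0 1" by auto
    then have "openin X (\<psi> ` ball 0 (1/2))" "\<psi> ` ball 0 (1/2) \<subseteq> M"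
      using \<psi> unfolding coord_ball_def by (simp, blast)
    moreover have "y \<in> \<psi> ` ball 0 (1/2)" using \<psi>(2) by force
    moreover have "\<forall>x\<in>\<psi> ` ball 0 (1/2). \<forall>z\<in>\<psi> ` ball 0 (1/2). pushes_to M x z"
      using pushes_to_in_coord_ball[OF \<psi>(1,3)] by blast
    ultimately show ?thesis by (intro exI[of _ "\<psi> ` ball 0 (1/2)"] conjI)
  qed
  define A where "A = {y \<in> M. pushes_to M a y}"
  have saturated: "\<exists>T. openin X T \<and> y \<in> T \<and> T \<subseteq> M \<and> (T \<subseteq> A \<or> T \<inter> A = {})" if y: "y \<in> M" for y
  proof -
    obtain W where W: "openin X W" "y \<in> W" "W \<subseteq> M" "\<forall>x\<in>W. \<forall>z\<in>W. pushes_to M x z"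
      using local[OF y] by (elim exE conjE)
    have "z \<in> A" if "x \<in> W" "z \<in> W" "x \<in> A" for x z
      using that W(3,4) pushes_to_trans[OF _ _ sub, of a x z] by (auto simp: A_def)
    then show ?thesis using W(1-3) by (intro exI[of _ W]) auto
  qed
  have "openin X A"
  proof (subst openin_subopen, intro ballI)
    fix y assume y: "y \<in> A"
    then have "y \<in> M" by (simp add: A_def)
    from saturated[OF this] y show "\<exists>T. openin X T \<and> y \<in> T \<and> T \<subseteq> A" by fast
  qed
  moreover have "openin X (M - A)"
  proof (subst openin_subopen, intro ballI)
    fix y assume y: "y \<in> M - A"
    then have "y \<in> M" by simp
    from saturated[OF this] y show "\<exists>T. openin X T \<and> y \<in> T \<and> T \<subseteq> M - A" by fast
  qed
  moreover have "a \<in> A"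
  proof -
    obtain W where "a \<in> W" "\<forall>x\<in>W. \<forall>z\<in>W. pushes_to M x z"
      using local[OF ab(1)] by (elim exE conjE)
    then show ?thesis using ab(1) by (simp add: A_def)
  qed
  moreover have "A \<subseteq> M" by (auto simp: A_def)
  ultimately have "M - A = {}"
    using M(2) ab(1) unfolding connectedin by blast
  then show ?thesis using ab unfolding A_def by blast
qed

text \<open>Every point has arbitrarily small neighbourhoods that stay connected and nonempty after
  \<open>P\<close> is removed: a ball, or a punctured ball, which is connected in dimension at least
  2. A separation of the complement would therefore extend over \<open>P\<close> to a separation of
  \<open>X\<close>.\<close>

lemma connectedin_minus_sparse:
  assumes conn: "connected_space X" and dim: "2 \<le> DIM('e)" and P: "closedin X P"
    and sparse: "\<And>x. x \<in> topspace X \<Longrightarrow> \<exists>W. openin X W \<and> x \<in> W \<and> W \<inter> P \<subseteq> {x}"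
  shows "connectedin X (topspace X - P)"
proof -
  have local: "\<exists>W. openin X W \<and> x \<in> W \<and> W \<subseteq> W0 \<and> W - P \<noteq> {} \<and> connectedin X (W - P)"
    if W0: "openin X W0" "x \<in> W0" for x W0
  proof -
    obtain W1 where W1: "openin X W1" "x \<in> W1" "W1 \<inter> P \<subseteq> {x}"
      using sparse openin_subset[OF W0(1)] W0(2) by blast
    obtain \<psi> :: "'e \<Rightarrow> 'a" where \<psi>: "coord_ball X \<psi>" "\<psi> 0 = x" "\<psi> ` ball 0 1 \<subseteq> W0 \<inter> W1"
      using coord_ball_at[of "W0 \<inter> W1" x] W0 W1 by blast
    have inj: "inj_on \<psi> (ball 0 1)" using \<psi> by (simp add: coord_ball_def)
    have img: "connectedin X (\<psi> ` S)" if "connected S" "S \<subseteq> ball 0 1" for S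
      using \<psi>(1) that unfolding coord_ball_def
      by (intro connectedin_continuous_map_image[of "top_of_set (ball 0 1)"]) (auto simp: connectedin_subtopology)
    obtain i :: 'e where i: "i \<in> Basis" using nonempty_Basis by blast
    have ne: "\<psi> ((1/2) *\<^sub>R i) \<in> \<psi> ` ball 0 1" "\<psi> ((1/2) *\<^sub>R i) \<noteq> x"
      using i inj \<psi>(2) by (auto dest!: inj_onD[of \<psi> "ball 0 1" "(1/2) *\<^sub>R i" 0])
    have "\<psi> ` ball 0 1 - P = \<psi> ` ball 0 1 \<or> \<psi> ` ball 0 1 - P = \<psi> ` (ball 0 1 - {0})"
    proof (cases "x \<in> P")
      case True
      then have "\<psi> ` ball 0 1 - P = \<psi> ` ball 0 1 - {x}" using W1(3) \<psi>(3) by blast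
      also have "\<dots> = \<psi> ` (ball 0 1 - {0})" using inj \<psi>(2) by (auto simp: inj_on_def)
      finally show ?thesis by blast
    next
      case False
      then show ?thesis using W1(3) \<psi>(3) by blast
    qed
    then have "connectedin X (\<psi> ` ball 0 1 - P)"
      using img[of "ball 0 1"] img[of "ball 0 1 - {0}"] connected_punctured_ball[OF dim, of 0 1] by auto
    moreover have "\<psi> ` ball 0 1 - P \<noteq> {}" using ne W1(3) \<psi>(3) by blast
    moreover have "x \<in> \<psi> ` ball 0 1" using \<psi>(2) by force
    ultimately show ?thesis using coord_ball_openin[OF \<psi>(1)] \<psi>(3) by (intro exI[of _ "\<psi> ` ball 0 1"]) auto
  qed
  show ?thesis
    unfolding connectedin
  proof (intro conjI notI)
    assume "\<exists>E1 E2. openin X E1 \<and> openin X E2 \<and> topspace X - P \<subseteq> E1 \<union> E2 \<and>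
       E1 \<inter> E2 \<inter> (topspace X - P) = {} \<and> E1 \<inter> (topspace X - P) \<noteq> {} \<and> E2 \<inter> (topspace X - P) \<noteq> {}"
    then obtain E1 E2 where E: "openin X E1" "openin X E2" "topspace X - P \<subseteq> E1 \<union> E2"
       "E1 \<inter> E2 \<inter> (topspace X - P) = {}" "E1 \<inter> (topspace X - P) \<noteq> {}" "E2 \<inter> (topspace X - P) \<noteq> {}" by blast
    \<comment> \<open>\<open>A F\<close> enlarges \<open>F\<close> by those points of
      \<open>P\<close> that have a neighbourhood which, apart from \<open>P\<close>, lies in
      \<open>F\<close>.\<close>
    define A where "A F = \<Union>{W. openin X W \<and> W - P \<subseteq> F}" for F
    have opA: "openin X (A F)" for F unfolding A_def by (intro openin_Union) auto
    have 1: "topspace X \<subseteq> A E1 \<union> A E2"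
    proof
      fix x assume x: "x \<in> topspace X"
      obtain W where W: "openin X W" "x \<in> W" "W - P \<noteq> {}" "connectedin X (W - P)"
        using local[OF openin_topspace x] by blast
      then have sub: "W - P \<subseteq> topspace X - P" using openin_subset by fastforce
      then have "W - P \<subseteq> E1 \<union> E2" "E1 \<inter> E2 \<inter> (W - P) = {}" using E(3,4) by blast+
      then have "E1 \<inter> (W - P) = {} \<or> E2 \<inter> (W - P) = {}"
        using W(4) E(1,2) unfolding connectedin by blast
      then have "W - P \<subseteq> E1 \<or> W - P \<subseteq> E2" using sub E(3) by blast
      then show "x \<in> A E1 \<union> A E2" using W unfolding A_def by blast
    qed
    \<comment> \<open>A common point would have a neighbourhood inside both; what remains of it
      without \<open>P\<close> is nonempty and would lie in both halves.\<close>
    have 2: "A E1 \<inter> A E2 = {}"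
    proof (rule ccontr)
      assume "A E1 \<inter> A E2 \<noteq> {}"
      then obtain x W1 W2 where x: "openin X W1" "W1 - P \<subseteq> E1" "openin X W2" "W2 - P \<subseteq> E2" "x \<in> W1 \<inter> W2"
        unfolding A_def by blast
      then have "openin X (W1 \<inter> W2)" by blast
      then obtain W where "W \<subseteq> W1 \<inter> W2" "W - P \<noteq> {}" using local[of "W1 \<inter> W2" x] x(5) by blast
      then show False using x E(4) openin_subset[OF x(1)] by blast
    qed
    have "E1 \<subseteq> A E1" "E2 \<subseteq> A E2" unfolding A_def using E(1,2) by blast+
    then have 3: "A E1 \<noteq> {}" "A E2 \<noteq> {}" using E(5,6) by blast+
    show False using conn unfolding connected_space_def
      by (elim notE) (intro exI[of _ "A E1"] exI[of _ "A E2"] conjI opA 1 2 3)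
  qed auto
qed

end


section \<open>The universal cover\<close>

abbreviation I01 :: "real topology" where "I01 \<equiv> top_of_set {0..1}"

lemma pathin_in_topspace: "pathin N p \<Longrightarrow> t \<in> {0..1} \<Longrightarrow> p t \<in> topspace N"
  using continuous_map_image_subset_topspace[of I01 N p] unfolding pathin_def by auto

definition path_homotopic :: "'a topology \<Rightarrow> (real \<Rightarrow> 'a) \<Rightarrow> (real \<Rightarrow> 'a) \<Rightarrow> bool"
  where "path_homotopic N p q \<longleftrightarrow> homotopic_with (\<lambda>r. r 0 = p 0 \<and> r 1 = p 1) I01 N p q"

lemma path_homotopic_ends: "path_homotopic N p q \<Longrightarrow> q 0 = p 0 \<and> q 1 = p 1"
  unfolding path_homotopic_def using homotopic_with_imp_property by blast

lemma path_homotopic_sym: "path_homotopic N p q \<Longrightarrow> path_homotopic N q p"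
  using path_homotopic_ends[of N p q] unfolding path_homotopic_def by (simp add: homotopic_with_symD)

lemma path_homotopic_trans: "path_homotopic N p q \<Longrightarrow> path_homotopic N q r \<Longrightarrow> path_homotopic N p r"
  using path_homotopic_ends[of N p q] unfolding path_homotopic_def by (auto intro: homotopic_with_trans)

text \<open>The charts of the cover and the contraction in a coordinate ball both append a second
  half to a path; this lets a stationary second half be removed again. The reparametrisations
  \<open>t\<close> and \<open>min (2 * t) 1\<close> are interpolated linearly.\<close>

lemma path_homotopic_concat_const:
  assumes p: "pathin N p"
  shows "path_homotopic N p (loop_concat p (\<lambda>_. p 1))"
proof -
  let ?h = "\<lambda>(s, t). p ((1 - s) * t + s * min (2 * t) 1)"
  have "continuous_map (prod_topology I01 I01) I01 (\<lambda>x. (1 - fst x) * snd x + fst x * min (2 * snd x) 1)"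
  proof (rule continuous_map_into_subtopology)
    have "continuous_map (prod_topology I01 I01) euclideanreal fst" "continuous_map (prod_topology I01 I01) euclideanreal snd"
      using continuous_map_fst continuous_map_snd continuous_map_in_subtopology by blast+
    then show "continuous_map (prod_topology I01 I01) euclideanreal (\<lambda>x. (1 - fst x) * snd x + fst x * min (2 * snd x) 1)"
      by (intro continuous_intros) auto
    have "(1 - s) * t + s * min (2 * t) 1 \<in> {0..1}" if "s \<in> {0..1}" "t \<in> {0..1}" for s t :: real
    proof -
      have "(1 - s) *\<^sub>R t + s *\<^sub>R min (2 * t) 1 \<in> {0..1}"
        using that by (intro convexD) auto
      then show ?thesis by simp
    qed
    then show "(\<lambda>x. (1 - fst x) * snd x + fst x * min (2 * snd x) 1) \<in> topspace (prod_topology I01 I01) \<rightarrow> {0..1}"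
      by (auto simp: Pi_iff)
  qed
  from continuous_map_compose[OF this p[unfolded pathin_def]]
  have "continuous_map (prod_topology I01 I01) N ?h" by (simp add: o_def case_prod_unfold)
  moreover have "p (min (2 * t) 1) = loop_concat p (\<lambda>_. p 1) t" for t
    by (auto simp: loop_concat_def min_def intro!: arg_cong[where f=p])
  ultimately show ?thesis
    unfolding path_homotopic_def homotopic_with_def by (intro exI[of _ ?h]) auto
qed

text \<open>The sheets of the universal cover over \<open>U\<close> are described by homotopies whose end point moves
  within \<open>U\<close>; this replaces appending paths in \<open>U\<close> and makes openness of sheets immediate.\<close>

definition end_homotopic :: "'a topology \<Rightarrow> 'a set \<Rightarrow> (real \<Rightarrow> 'a) \<Rightarrow> (real \<Rightarrow> 'a) \<Rightarrow> bool"
  where "end_homotopic N U p q \<longleftrightarrow> homotopic_with (\<lambda>r. r 0 = p 0 \<and> r 1 \<in> U) I01 N p q"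

lemma end_homotopic_ends: "end_homotopic N U p q \<Longrightarrow> q 0 = p 0 \<and> q 1 \<in> U \<and> p 1 \<in> U"
  unfolding end_homotopic_def using homotopic_with_imp_property by blast

lemma end_homotopic_sym: "end_homotopic N U p q \<Longrightarrow> end_homotopic N U q p"
  using end_homotopic_ends[of N U p q] unfolding end_homotopic_def by (simp add: homotopic_with_symD)

lemma end_homotopic_trans: "end_homotopic N U p q \<Longrightarrow> end_homotopic N U q r \<Longrightarrow> end_homotopic N U p r"
  using end_homotopic_ends[of N U p q] unfolding end_homotopic_def by (auto intro: homotopic_with_trans)

lemma end_homotopic_mono: "end_homotopic N U p q \<Longrightarrow> U \<subseteq> V \<Longrightarrow> end_homotopic N V p q"
  unfolding end_homotopic_def by (erule homotopic_with_mono) auto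

lemma path_imp_end_homotopic: "path_homotopic N p q \<Longrightarrow> p 1 \<in> U \<Longrightarrow> end_homotopic N U p q"
  unfolding end_homotopic_def path_homotopic_def by (erule homotopic_with_mono) auto

text \<open>Over a coordinate ball the path traced by the moving end point is contracted back to its
  start by a straight line in the chart.\<close>

lemma end_homotopic_imp_path_homotopic:
  fixes \<psi> :: "'e::euclidean_space \<Rightarrow> 'a"
  assumes \<psi>: "coord_ball N \<psi>" and h: "end_homotopic N (\<psi> ` ball 0 1) p q" and pq: "p 1 = q 1"
  shows "path_homotopic N p q"
proof -
  let ?U = "\<psi> ` ball 0 1" and ?c = "inv_into (ball 0 1) \<psi>" and ?Q = "prod_topology I01 I01"
  obtain H where H: "continuous_map ?Q N H" "\<And>t. H (0, t) = p t" "\<And>t. H (1, t) = q t"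
      "\<And>s. s \<in> {0..1} \<Longrightarrow> H (s, 0) = p 0 \<and> H (s, 1) \<in> ?U"
    using h unfolding end_homotopic_def homotopic_with_def by (elim exE conjE) blast
  have c_in: "?c y \<in> ball 0 1" "\<psi> (?c y) = y" if "y \<in> ?U" for y
    using inv_into_into[OF that] f_inv_into_f[OF that] by blast+
  \<comment> \<open>\<open>w s\<close> is the chart coordinate of the moving end point at time
    \<open>s\<close>; \<open>K\<close> leads it straight back to its initial position
    \<open>w 0\<close>.\<close>
  define w where "w s = ?c (H (s, 1))" for s
  define K where "K = (\<lambda>(s, t). \<psi> ((1 - t) *\<^sub>R w s + t *\<^sub>R w 0))"
  have w_in: "w s \<in> ball 0 1" if "s \<in> {0..1}" for s
    using H(4)[OF that] c_in unfolding w_def by blast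
  have fst: "continuous_map ?Q euclideanreal fst" and snd: "continuous_map ?Q euclideanreal snd"
    using continuous_map_fst continuous_map_snd continuous_map_in_subtopology by blast+
  have "continuous_map I01 ?Q (\<lambda>s. (s, 1))" by (auto simp: continuous_map_pairwise o_def intro!: continuous_intros)
  from continuous_map_compose[OF this H(1)]
  have "continuous_map I01 (subtopology N ?U) (\<lambda>s. H (s, 1))"
    using H(4) by (auto simp: continuous_map_in_subtopology o_def)
  from continuous_map_compose[OF this coord_ball_inverse[OF \<psi>]]
  have "continuous_map I01 euclidean w" by (simp add: continuous_map_in_subtopology o_def w_def[abs_def])
  from continuous_map_compose[OF continuous_map_fst this]
  have w: "continuous_map ?Q euclidean (\<lambda>x. w (fst x))" by (simp only: o_def)
  have "continuous_map ?Q (top_of_set (ball 0 1)) (\<lambda>x. (1 - snd x) *\<^sub>R w (fst x) + snd x *\<^sub>R w 0)"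
  proof (intro continuous_map_into_subtopology funcsetI)
    show "continuous_map ?Q euclidean (\<lambda>x. (1 - snd x) *\<^sub>R w (fst x) + snd x *\<^sub>R w 0)"
      using w snd by (intro continuous_intros) auto
    fix x assume "x \<in> topspace ?Q"
    then have "fst x \<in> {0..1}" "snd x \<in> {0..1}" by auto
    then show "(1 - snd x) *\<^sub>R w (fst x) + snd x *\<^sub>R w 0 \<in> ball 0 1"
      using w_in[of "fst x"] w_in[of 0] by (intro convexD[OF convex_ball]) auto
  qed
  moreover have "continuous_map (top_of_set (ball 0 1)) N \<psi>" using \<psi> by (simp add: coord_ball_def)
  ultimately have "continuous_map ?Q N (\<psi> \<circ> (\<lambda>x. (1 - snd x) *\<^sub>R w (fst x) + snd x *\<^sub>R w 0))"
    by (rule continuous_map_compose)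
  then have K: "continuous_map ?Q N K" by (simp only: K_def case_prod_unfold o_def)
  let ?G = "\<lambda>z. loop_concat (\<lambda>s. H (fst z, s)) (\<lambda>s. K (fst z, s)) (snd z)"
  have "K (s, 0) = H (s, 1)" if "s \<in> {0..1}" for s
    using H(4)[OF that] c_in(2) by (simp add: K_def w_def)
  then have G: "continuous_map ?Q N ?G"
    by (intro continuous_loop_concat H(1) K) auto
  have K1: "K (s, 1) = p 1" for s using c_in(2)[of "p 1"] H(4)[of 0] by (simp add: K_def w_def H(2))
  \<comment> \<open>At both ends of the homotopy the appended segment is stationary; for
    \<open>s = 1\<close> this uses \<open>p 1 = q 1\<close>, which gives
    \<open>w 1 = w 0\<close>.\<close>
  have K01: "K (0, t) = p 1" "K (1, t) = p 1" for t
    using c_in(2)[of "p 1"] H(4)[of 0] pq by (simp_all add: K_def w_def H(2,3) flip: scaleR_left_distrib)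
  have "path_homotopic N (loop_concat p (\<lambda>_. p 1)) (loop_concat q (\<lambda>_. q 1))"
    unfolding path_homotopic_def homotopic_with_def
    using G H(2-4) K1 K01 pq by (intro exI[of _ ?G]) (auto simp: loop_concat_def)
  moreover have "pathin N p" "pathin N q"
    using h homotopic_with_imp_continuous_maps unfolding end_homotopic_def pathin_def by blast+
  ultimately show ?thesis
    using path_homotopic_concat_const[of N] path_homotopic_trans path_homotopic_sym by meson
qed

lemma convex_imp_locally_path_connected_space:
  fixes S :: "'e::real_normed_vector set"
  assumes "convex S"
  shows "locally_path_connected_space (top_of_set S)"
  unfolding locally_path_connected_space
proof clarify
  fix V x assume "openin (top_of_set S) V" and x: "x \<in> V"
  then obtain T where T: "open T" "V = S \<inter> T" by (auto simp: openin_open)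
  then obtain e where e: "e > 0" "ball x e \<subseteq> T" using x by (meson IntE open_contains_ball)
  have "convex (S \<inter> ball x e)" using assms by (simp add: convex_Int)
  then have "path_connectedin (top_of_set S) (S \<inter> ball x e)"
    by (simp add: path_connectedin_subtopology convex_imp_path_connected)
  then show "\<exists>U. openin (top_of_set S) U \<and> path_connectedin (top_of_set S) U \<and> x \<in> U \<and> U \<subseteq> V"
    using e x T by (intro exI[of _ "S \<inter> ball x e"]) auto
qed

text \<open>Following the family along a path \<open>\<omega>\<close> in the parameter space is
  itself a homotopy with free end. It supplies the sheet membership needed for continuity of maps
  into the cover and for its charts.\<close>

lemma end_homotopic_of_family:
  assumes K: "continuous_map (prod_topology I01 Z) N K" and K0: "\<And>z. z \<in> topspace Z \<Longrightarrow> K (0, z) = x"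
    and \<omega>: "pathin Z \<omega>" and U: "\<And>s. s \<in> {0..1} \<Longrightarrow> K (1, \<omega> s) \<in> U"
  shows "end_homotopic N U (\<lambda>t. K (t, \<omega> 0)) (\<lambda>t. K (t, \<omega> 1))"
proof -
  let ?H = "\<lambda>(s, t). K (t, \<omega> s)"
  have "continuous_map (prod_topology I01 I01) Z (\<omega> \<circ> fst)"
    by (intro continuous_map_compose[OF continuous_map_fst]) (use \<omega> in \<open>simp add: pathin_def\<close>)
  then have "continuous_map (prod_topology I01 I01) (prod_topology I01 Z) (\<lambda>x. (snd x, \<omega> (fst x)))"
    using continuous_map_snd[of I01 I01] by (simp add: continuous_map_pairwise o_def)
  from continuous_map_compose[OF this K]
  have "continuous_map (prod_topology I01 I01) N ?H" by (simp add: o_def case_prod_unfold)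
  moreover have "\<omega> s \<in> topspace Z" if "s \<in> {0..1}" for s
    using that continuous_map_image_subset_topspace[of I01 Z \<omega>] \<omega> by (auto simp: pathin_def)
  then have "K (0, \<omega> s) = x" if "s \<in> {0..1}" for s
    using that K0 by simp
  ultimately show ?thesis
    unfolding end_homotopic_def homotopic_with_def using U by (intro exI[of _ ?H]) auto
qed

section \<open>Topology on homotopy classes of paths\<close>

definition path_class :: "'a topology \<Rightarrow> (real \<Rightarrow> 'a) \<Rightarrow> (real \<Rightarrow> 'a) set"
  where "path_class N p = {q. path_homotopic N p q}"

definition path_classes_from :: "'a topology \<Rightarrow> 'a \<Rightarrow> (real \<Rightarrow> 'a) set set"
  where "path_classes_from N x = path_class N ` {p. pathin N p \<and> p 0 = x}"

definition sheet :: "'a topology \<Rightarrow> (real \<Rightarrow> 'a) \<Rightarrow> 'a set \<Rightarrow> (real \<Rightarrow> 'a) set set"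
  where "sheet N p U = path_class N ` {q. end_homotopic N U p q}"

text \<open>The topology generated by the sheets over open sets, written as an openness predicate
  that quantifies over representatives of classes.\<close>

definition universal_cover :: "'a topology \<Rightarrow> 'a \<Rightarrow> (real \<Rightarrow> 'a) set topology"
  where "universal_cover N x = topology (\<lambda>V. V \<subseteq> path_classes_from N x \<and>
           (\<forall>p. pathin N p \<and> p 0 = x \<and> path_class N p \<in> V \<longrightarrow>
              (\<exists>U. openin N U \<and> p 1 \<in> U \<and> sheet N p U \<subseteq> V)))"

text \<open>The covering projection. All paths of a class share their end point, so the choice of
  representative does not matter.\<close>

definition path_end :: "(real \<Rightarrow> 'a) set \<Rightarrow> 'a"
  where "path_end c = (SOME p. p \<in> c) 1"

lemma path_homotopic_refl: "pathin N p \<Longrightarrow> path_homotopic N p p"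
  by (simp add: path_homotopic_def pathin_def)

lemma end_homotopic_refl: "pathin N p \<Longrightarrow> p 1 \<in> U \<Longrightarrow> end_homotopic N U p p"
  by (simp add: end_homotopic_def pathin_def)

lemma end_homotopic_pathin: "end_homotopic N U p q \<Longrightarrow> pathin N p \<and> pathin N q"
  unfolding end_homotopic_def pathin_def by (rule homotopic_with_imp_continuous_maps)

lemma path_class_eq: "path_homotopic N p q \<Longrightarrow> path_class N p = path_class N q"
  unfolding path_class_def using path_homotopic_trans path_homotopic_sym by blast

lemma path_class_eqD: "path_class N p = path_class N q \<Longrightarrow> pathin N q \<Longrightarrow> path_homotopic N p q"
  unfolding path_class_def using path_homotopic_refl by blast

lemma path_end_class: "pathin N p \<Longrightarrow> path_end (path_class N p) = p 1"
  using path_homotopic_ends[OF someI[of "path_homotopic N p" p, OF path_homotopic_refl]]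
  by (simp add: path_end_def path_class_def)

lemma sheetE:
  assumes "c \<in> sheet N p U"
  obtains q where "c = path_class N q" "end_homotopic N U p q"
  using assms by (auto simp: sheet_def)

lemma sheetI: "end_homotopic N U p q \<Longrightarrow> path_class N q \<in> sheet N p U"
  by (auto simp: sheet_def)

lemma end_homotopic_of_class_in_sheet:
  assumes "path_class N q \<in> sheet N p U" "pathin N q"
  shows "end_homotopic N U p q"
proof -
  obtain q' where q': "path_class N q = path_class N q'" "end_homotopic N U p q'"
    using assms(1) by (rule sheetE)
  then have "path_homotopic N q' q" using path_class_eqD[of N q' q] assms(2) by simp
  then have "end_homotopic N U q' q" using path_imp_end_homotopic end_homotopic_ends[OF q'(2)] by blast
  then show ?thesis using q'(2) end_homotopic_trans by blast
qed

lemma sheet_mono: "U \<subseteq> V \<Longrightarrow> sheet N p U \<subseteq> sheet N p V"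
  unfolding sheet_def using end_homotopic_mono by blast

lemma sheet_cong: "end_homotopic N U p q \<Longrightarrow> sheet N p U = sheet N q U"
  unfolding sheet_def using end_homotopic_trans end_homotopic_sym by blast

lemma openin_universal_cover:
  "openin (universal_cover N x) V \<longleftrightarrow> V \<subseteq> path_classes_from N x \<and>
     (\<forall>p. pathin N p \<and> p 0 = x \<and> path_class N p \<in> V \<longrightarrow> (\<exists>U. openin N U \<and> p 1 \<in> U \<and> sheet N p U \<subseteq> V))"
proof -
  let ?op = "\<lambda>V. V \<subseteq> path_classes_from N x \<and>
     (\<forall>p. pathin N p \<and> p 0 = x \<and> path_class N p \<in> V \<longrightarrow> (\<exists>U. openin N U \<and> p 1 \<in> U \<and> sheet N p U \<subseteq> V))"
  have "istopology ?op"
    unfolding istopology_def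
  proof (rule conjI; intro allI impI)
    fix V W assume V: "?op V" and W: "?op W"
    show "?op (V \<inter> W)"
    proof (intro conjI allI impI)
      fix p assume p: "pathin N p \<and> p 0 = x \<and> path_class N p \<in> V \<inter> W"
      obtain U where U: "openin N U" "p 1 \<in> U" "sheet N p U \<subseteq> V" using V p by blast
      obtain U' where U': "openin N U'" "p 1 \<in> U'" "sheet N p U' \<subseteq> W" using W p by blast
      show "\<exists>U. openin N U \<and> p 1 \<in> U \<and> sheet N p U \<subseteq> V \<inter> W"
        using U U' sheet_mono[of "U \<inter> U'" U N p] sheet_mono[of "U \<inter> U'" U' N p]
        by (intro exI[of _ "U \<inter> U'"]) auto
    qed (rule le_infI1[OF conjunct1[OF V]])
  next
    fix \<V> assume \<V>: "\<forall>V\<in>\<V>. ?op V"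
    show "?op (\<Union>\<V>)"
    proof (intro conjI allI impI)
      fix p assume p: "pathin N p \<and> p 0 = x \<and> path_class N p \<in> \<Union>\<V>"
      then obtain V where V: "V \<in> \<V>" "path_class N p \<in> V" by blast
      moreover have "?op V" using \<V> V(1) by (rule bspec)
      then have "pathin N p \<and> p 0 = x \<and> path_class N p \<in> V \<longrightarrow> (\<exists>U. openin N U \<and> p 1 \<in> U \<and> sheet N p U \<subseteq> V)"
        by (elim conjE allE[of _ p])
      ultimately obtain U where "openin N U" "p 1 \<in> U" "sheet N p U \<subseteq> V" using p by blast
      then show "\<exists>U. openin N U \<and> p 1 \<in> U \<and> sheet N p U \<subseteq> \<Union>\<V>" using V by blast
    qed (rule Union_least, drule \<V>[THEN bspec], erule conjunct1)
  qed
  then show ?thesis unfolding universal_cover_def by (simp add: topology_inverse')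
qed

lemma sheet_subset: "p 0 = x \<Longrightarrow> sheet N p U \<subseteq> path_classes_from N x"
  unfolding path_classes_from_def
  by (auto elim!: sheetE intro!: imageI dest: end_homotopic_pathin end_homotopic_ends)

lemma topspace_universal_cover: "topspace (universal_cover N x) = path_classes_from N x"
proof
  show "topspace (universal_cover N x) \<subseteq> path_classes_from N x"
    using openin_topspace[of "universal_cover N x"] unfolding openin_universal_cover by (rule conjunct1)
  have "openin (universal_cover N x) (path_classes_from N x)"
    unfolding openin_universal_cover
  proof (intro conjI allI impI order_refl)
    fix p assume p: "pathin N p \<and> p 0 = x \<and> path_class N p \<in> path_classes_from N x"
    then have "p 1 \<in> topspace N" using pathin_in_topspace[of N p 1] by simp
    then show "\<exists>U. openin N U \<and> p 1 \<in> U \<and> sheet N p U \<subseteq> path_classes_from N x"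
      using sheet_subset[of p x N] p by (intro exI[of _ "topspace N"]) simp
  qed
  then show "path_classes_from N x \<subseteq> topspace (universal_cover N x)" by (rule openin_subset)
qed

lemma path_class_in_cover: "pathin N p \<Longrightarrow> p 0 = x \<Longrightarrow> path_class N p \<in> topspace (universal_cover N x)"
  by (auto simp: topspace_universal_cover path_classes_from_def)

lemma path_class_in_sheet: "pathin N p \<Longrightarrow> p 1 \<in> U \<Longrightarrow> path_class N p \<in> sheet N p U"
  by (intro sheetI end_homotopic_refl)

text \<open>By symmetry and transitivity a sheet is the sheet of each of its own classes over the
  same \<open>U\<close>, so \<open>U\<close> itself witnesses openness everywhere.\<close>

lemma openin_sheet:
  assumes "openin N U" "p 0 = x"
  shows "openin (universal_cover N x) (sheet N p U)"
  unfolding openin_universal_cover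
proof (intro conjI allI impI)
  fix q assume q: "pathin N q \<and> q 0 = x \<and> path_class N q \<in> sheet N p U"
  then have "end_homotopic N U p q" using end_homotopic_of_class_in_sheet by blast
  then show "\<exists>W. openin N W \<and> q 1 \<in> W \<and> sheet N q W \<subseteq> sheet N p U"
    using sheet_cong[of N U p q] end_homotopic_ends[of N U p q] assms(1) by (intro exI[of _ U]) simp
qed (rule sheet_subset[of p x N U, OF assms(2)])

lemma cover_pointE:
  assumes "c \<in> topspace (universal_cover N x)"
  obtains p where "pathin N p" "p 0 = x" "c = path_class N p"
  using assms unfolding topspace_universal_cover path_classes_from_def by blast

lemma continuous_map_path_end: "continuous_map (universal_cover N x) N path_end"
  unfolding continuous_map
proof (intro conjI allI impI)
  show "path_end ` topspace (universal_cover N x) \<subseteq> topspace N"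
  proof clarify
    fix c assume "c \<in> topspace (universal_cover N x)"
    then obtain p where "pathin N p" "c = path_class N p" by (rule cover_pointE)
    then show "path_end c \<in> topspace N"
      using pathin_in_topspace[of N p 1] by (simp add: path_end_class)
  qed
  fix U assume U: "openin N U"
  let ?V = "{c \<in> topspace (universal_cover N x). path_end c \<in> U}"
  show "openin (universal_cover N x) ?V"
  proof (subst openin_subopen, intro ballI)
    fix c assume c: "c \<in> ?V"
    then have "c \<in> topspace (universal_cover N x)" by simp
    then obtain p where p: "pathin N p" "p 0 = x" "c = path_class N p" by (rule cover_pointE)
    have "path_end d \<in> U" if d: "d \<in> sheet N p U" for d
    proof -
      obtain q where "d = path_class N q" "end_homotopic N U p q" using d by (rule sheetE)
      then show ?thesis using end_homotopic_ends[of N U p q] end_homotopic_pathin[of N U p q] by (simp add: path_end_class)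
    qed
    moreover have "openin (universal_cover N x) (sheet N p U)" by (rule openin_sheet[of N U p x, OF U p(2)])
    moreover from this have "sheet N p U \<subseteq> topspace (universal_cover N x)" by (rule openin_subset)
    ultimately have "openin (universal_cover N x) (sheet N p U)" "sheet N p U \<subseteq> ?V" by auto
    moreover have "c \<in> sheet N p U" unfolding p(3)
      by (rule path_class_in_sheet[OF p(1)]) (use c p(3) path_end_class[OF p(1)] in simp)
    ultimately show "\<exists>T. openin (universal_cover N x) T \<and> c \<in> T \<and> T \<subseteq> ?V"
      by (intro exI[of _ "sheet N p U"] conjI)
  qed
qed

text \<open>The way maps into the cover are made. If the end point stays in \<open>U\<close> near
  \<open>z\<close>, a path from \<open>z\<close> to a nearby \<open>z'\<close> inside that
  neighbourhood deforms one path of the family into the other with its end in \<open>U\<close>, so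
  both classes lie on one sheet. Local path connectedness provides such a path.\<close>

lemma continuous_map_path_class_family:
  assumes Z: "locally_path_connected_space Z"
    and K: "continuous_map (prod_topology I01 Z) N K" and K0: "\<And>z. z \<in> topspace Z \<Longrightarrow> K (0, z) = x"
  shows "continuous_map Z (universal_cover N x) (\<lambda>z. path_class N (\<lambda>t. K (t, z)))"
proof -
  let ?g = "\<lambda>z. path_class N (\<lambda>t. K (t, z))"
  have pK: "pathin N (\<lambda>t. K (t, z))" if "z \<in> topspace Z" for z
  proof -
    have "continuous_map I01 (prod_topology I01 Z) (\<lambda>t. (t, z))"
      using that by (simp add: continuous_map_pairwise o_def)
    from continuous_map_compose[OF this K] show ?thesis by (simp add: pathin_def o_def)
  qed
  have K1: "continuous_map Z N (\<lambda>z. K (1, z))"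
    using continuous_map_o_Pair[OF K, of 1] by (simp add: o_def)
  show ?thesis
    unfolding continuous_map
  proof (intro conjI allI impI)
    show "?g ` topspace Z \<subseteq> topspace (universal_cover N x)"
    proof clarify
      fix z assume "z \<in> topspace Z"
      then show "?g z \<in> topspace (universal_cover N x)" by (intro path_class_in_cover pK K0)
    qed
    fix V assume V: "openin (universal_cover N x) V"
    show "openin Z {z \<in> topspace Z. ?g z \<in> V}"
    proof (subst openin_subopen, intro ballI)
      fix z assume "z \<in> {z \<in> topspace Z. ?g z \<in> V}"
      then have z: "z \<in> topspace Z" "?g z \<in> V" by auto
      have "pathin N (\<lambda>t. K (t, z)) \<and> K (0, z) = x \<and> ?g z \<in> V" using pK[OF z(1)] K0[OF z(1)] z(2) by simp
      then obtain U where U: "openin N U" "K (1, z) \<in> U" "sheet N (\<lambda>t. K (t, z)) U \<subseteq> V"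
        using V[unfolded openin_universal_cover, THEN conjunct2, rule_format, of "\<lambda>t. K (t, z)"] by blast
      have "openin Z {z \<in> topspace Z. K (1, z) \<in> U}"
        using openin_continuous_map_preimage[OF K1 U(1)] .
      then obtain W where W: "openin Z W" "path_connectedin Z W" "z \<in> W" "W \<subseteq> {z \<in> topspace Z. K (1, z) \<in> U}"
        using Z U(2) z(1) unfolding locally_path_connected_space by blast
      have "?g z' \<in> V" if "z' \<in> W" for z'
      proof -
        have "\<exists>\<omega>. pathin Z \<omega> \<and> \<omega> \<in> {0..1} \<rightarrow> W \<and> \<omega> 0 = z \<and> \<omega> 1 = z'"
          using W(2,3) \<open>z' \<in> W\<close> unfolding path_connectedin by simp
        then obtain \<omega> where \<omega>: "pathin Z \<omega>" "\<omega> ` {0..1} \<subseteq> W" "\<omega> 0 = z" "\<omega> 1 = z'"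
          by (elim exE conjE) (simp add: image_subset_iff_funcset)
        have inU: "K (1, \<omega> s) \<in> U" if "s \<in> {0..1}" for s
        proof -
          have "\<omega> s \<in> W" using \<omega>(2) that by blast
          then show ?thesis using W(4) by blast
        qed
        have "end_homotopic N U (\<lambda>t. K (t, \<omega> 0)) (\<lambda>t. K (t, \<omega> 1))"
          by (rule end_homotopic_of_family[OF K _ \<omega>(1)]) (use K0 inU in auto)
        then have "?g z' \<in> sheet N (\<lambda>t. K (t, z)) U" unfolding \<omega>(3,4) by (rule sheetI)
        then show ?thesis using U(3) by (rule subsetD[rotated])
      qed
      moreover have "W \<subseteq> topspace Z" using W(1) by (rule openin_subset)
      ultimately have "W \<subseteq> {z \<in> topspace Z. ?g z \<in> V}" by fast
      then show "\<exists>T. openin Z T \<and> z \<in> T \<and> T \<subseteq> {z \<in> topspace Z. ?g z \<in> V}"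
        using W(1,3) by (intro exI[of _ W] conjI)
    qed
  qed
qed

text \<open>Two classes on a sheet are represented by paths that are end homotopic over the ball;
  when these end at the same point, contracting the trace of the end point makes them path
  homotopic. The straight-line contraction stands in for simple connectivity of the ball.\<close>

lemma path_end_inj_on_sheet:
  fixes \<psi> :: "'e::euclidean_space \<Rightarrow> 'a"
  assumes \<psi>: "coord_ball N \<psi>" and cd: "c \<in> sheet N p (\<psi> ` ball 0 1)" "d \<in> sheet N p (\<psi> ` ball 0 1)"
    and eq: "path_end c = path_end d"
  shows "c = d"
proof -
  obtain q where q: "c = path_class N q" "end_homotopic N (\<psi> ` ball 0 1) p q"
    using cd(1) by (rule sheetE)
  obtain r where r: "d = path_class N r" "end_homotopic N (\<psi> ` ball 0 1) p r"
    using cd(2) by (rule sheetE)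
  have "q 1 = r 1" using eq q r path_end_class end_homotopic_pathin by metis
  moreover have "end_homotopic N (\<psi> ` ball 0 1) q r"
    using q(2) r(2) end_homotopic_sym end_homotopic_trans by blast
  ultimately show ?thesis
    using end_homotopic_imp_path_homotopic[OF \<psi>] path_class_eq q(1) r(1) by metis
qed

section \<open>The universal cover is again a manifold\<close>

context manifold_topology begin

text \<open>The chart around the class of \<open>p\<close> sends \<open>v\<close> to the class of
  \<open>p\<close> followed by the radial path in the chart from \<open>p 1\<close> to
  \<open>\<psi> v\<close>. At the centre the radial path is a rest, so the class of \<open>p\<close>
  itself is obtained.\<close>

lemma coord_ball_universal_cover:
  assumes V: "openin (universal_cover X x) V" "c \<in> V"
  shows "\<exists>\<psi> :: 'e \<Rightarrow> (real \<Rightarrow> 'a) set. coord_ball (universal_cover X x) \<psi> \<and> \<psi> 0 = c \<and> \<psi> ` ball 0 1 \<subseteq> V"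
proof -
  let ?B = "ball 0 1 :: 'e set"
  have "c \<in> topspace (universal_cover X x)" using V openin_subset by blast
  then obtain p where p: "pathin X p" "p 0 = x" "c = path_class X p" by (rule cover_pointE)
  obtain U where U: "openin X U" "p 1 \<in> U" "sheet X p U \<subseteq> V"
    using V p unfolding openin_universal_cover by blast
  obtain \<psi> :: "'e \<Rightarrow> 'a" where \<psi>: "coord_ball X \<psi>" "\<psi> 0 = p 1" "\<psi> ` ?B \<subseteq> U"
    using coord_ball_at[OF U(1,2)] by blast
  have inj: "inj_on \<psi> ?B" and cont: "continuous_map (top_of_set ?B) X \<psi>"
    using \<psi>(1) by (auto simp: coord_ball_def)
  let ?Q = "prod_topology I01 (top_of_set ?B)"
  define K where "K = (\<lambda>(t, v). if t \<le> 1/2 then p (2 * t) else \<psi> ((2 * t - 1) *\<^sub>R v))"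
  have "continuous_map ?Q X (\<lambda>z. if fst z \<le> 1/2 then p (2 * fst z) else \<psi> ((2 * fst z - 1) *\<^sub>R snd z))"
  proof (rule continuous_map_cases_le)
    show fst: "continuous_map ?Q euclideanreal fst"
      using continuous_map_fst continuous_map_in_subtopology by blast
    have snd: "continuous_map ?Q euclidean snd"
      using continuous_map_snd continuous_map_in_subtopology by blast
    have "continuous_map (subtopology ?Q {z \<in> topspace ?Q. fst z \<le> 1/2}) I01 (\<lambda>z. 2 * fst z)"
      by (intro continuous_map_into_subtopology continuous_map_from_subtopology continuous_intros fst) auto
    from continuous_map_compose[OF this p(1)[unfolded pathin_def]]
    show "continuous_map (subtopology ?Q {z \<in> topspace ?Q. fst z \<le> 1/2}) X (\<lambda>z. p (2 * fst z))"
      by (simp add: o_def)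
    have "continuous_map (subtopology ?Q {z \<in> topspace ?Q. 1/2 \<le> fst z}) (top_of_set ?B)
            (\<lambda>z. (2 * fst z - 1) *\<^sub>R snd z)"
    proof (intro continuous_map_into_subtopology)
      show "continuous_map (subtopology ?Q {z \<in> topspace ?Q. 1/2 \<le> fst z}) euclidean
            (\<lambda>z. (2 * fst z - 1) *\<^sub>R snd z)"
        by (intro continuous_map_from_subtopology continuous_intros fst snd) auto
      have "norm ((2 * t - 1) *\<^sub>R v) < 1" if "1/2 \<le> t" "t \<le> 1" "norm v < 1" for t :: real and v :: 'e
        using that mult_left_le_one_le[of "norm v" "2 * t - 1"] by simp
      then show "(\<lambda>z. (2 * fst z - 1) *\<^sub>R snd z) \<in> topspace (subtopology ?Q {z \<in> topspace ?Q. 1/2 \<le> fst z}) \<rightarrow> ?B"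
        by auto
    qed
    from continuous_map_compose[OF this cont]
    show "continuous_map (subtopology ?Q {z \<in> topspace ?Q. 1/2 \<le> fst z}) X (\<lambda>z. \<psi> ((2 * fst z - 1) *\<^sub>R snd z))"
      by (simp add: o_def)
  next
    show "p (2 * fst z) = \<psi> ((2 * fst z - 1) *\<^sub>R snd z)" if "fst z = 1/2" for z :: "real \<times> 'e"
      using \<psi>(2) by (simp add: that)
  qed simp
  then have K: "continuous_map ?Q X K" by (simp add: K_def case_prod_unfold)
  have K0: "K (0, v) = x" and K1: "K (1, v) = \<psi> v" for v using p(2) by (auto simp: K_def)
  define \<phi> where "\<phi> v = path_class X (\<lambda>t. K (t, v))" for v
  have cont\<phi>: "continuous_map (top_of_set ?B) (universal_cover X x) \<phi>"
    unfolding \<phi>_def by (intro continuous_map_path_class_family[OF _ K] convex_imp_locally_path_connected_space) (auto simp: K0)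
  have pK: "pathin X (\<lambda>t. K (t, v))" if "v \<in> ?B" for v
  proof -
    have "continuous_map I01 ?Q (\<lambda>t. (t, v))" using that by (simp add: continuous_map_pairwise o_def continuous_map_id[unfolded id_def] del: continuous_map_subtopology_eu prod_topology_subtopology_eu)
    from continuous_map_compose[OF this K] show ?thesis by (simp add: pathin_def o_def)
  qed
  have end\<phi>: "path_end (\<phi> v) = \<psi> v" if "v \<in> ?B" for v
    using path_end_class[OF pK[OF that]] by (simp add: \<phi>_def K1)
  \<comment> \<open>Along the segment from \<open>v\<close> to \<open>w\<close> the end points stay
    in the image of \<open>S\<close>, so convexity gives the end homotopy. Both the whole ball and
    small balls around \<open>v\<close> are used for \<open>S\<close>.\<close>
  have near: "end_homotopic X (\<psi> ` S) (\<lambda>t. K (t, v)) (\<lambda>t. K (t, w))"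
    if "convex S" "S \<subseteq> ?B" "v \<in> S" "w \<in> S" for S v w
  proof -
    have seg: "(1 - s) *\<^sub>R v + s *\<^sub>R w \<in> S" if "s \<in> {0..1}" for s
      using that \<open>v \<in> S\<close> \<open>w \<in> S\<close> by (intro convexD[OF \<open>convex S\<close>]) auto
    have "continuous_map I01 euclidean (\<lambda>s. (1 - s) *\<^sub>R v + s *\<^sub>R w)" by (auto intro!: continuous_intros)
    then have "pathin (top_of_set ?B) (\<lambda>s. (1 - s) *\<^sub>R v + s *\<^sub>R w)"
      unfolding pathin_def using seg \<open>S \<subseteq> ?B\<close> by (intro continuous_map_into_subtopology) auto
    from end_homotopic_of_family[OF K _ this, of x "\<psi> ` S"] show ?thesis
      using seg by (simp add: K0 K1)
  qed
  have \<phi>0: "\<phi> 0 = c"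
  proof -
    have "(\<lambda>t. K (t, 0)) = loop_concat p (\<lambda>_. p 1)" by (auto simp: K_def loop_concat_def \<psi>(2))
    then show ?thesis unfolding \<phi>_def p(3) using path_class_eq[OF path_homotopic_concat_const[OF p(1)]] by simp
  qed
  have sheet: "\<phi> w \<in> sheet X (\<lambda>t. K (t, v)) (\<psi> ` S)" if "convex S" "S \<subseteq> ?B" "v \<in> S" "w \<in> S" for S v w
    unfolding \<phi>_def by (rule sheetI[OF near[OF that]])
  have "sheet X (\<lambda>t. K (t, 0)) (\<psi> ` ?B) = sheet X p (\<psi> ` ?B)"
  proof -
    have "path_homotopic X p (\<lambda>t. K (t, 0))"
      using \<phi>0 p(3) pK[of 0] path_class_eqD[of X p "\<lambda>t. K (t, 0)"] by (simp add: \<phi>_def)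
    then have "end_homotopic X (\<psi> ` ?B) p (\<lambda>t. K (t, 0))"
      using \<psi>(2) by (intro path_imp_end_homotopic) (auto intro!: image_eqI[of _ _ 0])
    then show ?thesis using sheet_cong by blast
  qed
  then have "\<phi> ` ?B \<subseteq> sheet X p (\<psi> ` ?B)" using sheet[of ?B 0] by auto
  then have sub: "\<phi> ` ?B \<subseteq> V" using sheet_mono[OF \<psi>(3)] U(3) by blast
  \<comment> \<open>Around a point with coordinate \<open>v\<close> a sheet over a small ball fits
    into the image of \<open>W\<close>: each of its classes ends at some \<open>\<psi> w\<close>
    and, by injectivity on the sheet over the whole ball, is the chart value at
    \<open>w\<close>.\<close>
  have open\<phi>: "openin (universal_cover X x) (\<phi> ` W)" if W: "open W" "W \<subseteq> ?B" for W
  proof (subst openin_subopen, intro ballI)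
    fix d assume "d \<in> \<phi> ` W"
    then obtain v where v: "v \<in> W" "d = \<phi> v" by blast
    obtain e where e: "e > 0" "ball v e \<subseteq> W" using W(1) v(1) open_contains_ball by blast
    let ?S = "sheet X (\<lambda>t. K (t, v)) (\<psi> ` ball v e)"
    have eB: "ball v e \<subseteq> ?B" using e W by blast
    then have "openin X (\<psi> ` ball v e)" using \<psi>(1) by (simp add: coord_ball_def)
    then have "openin (universal_cover X x) ?S" using K0 by (intro openin_sheet) auto
    moreover have "d \<in> ?S" unfolding v(2) using e eB by (intro sheet) auto
    moreover have "?S \<subseteq> \<phi> ` W"
    proof
      fix a assume a: "a \<in> ?S"
      then obtain q where q: "a = path_class X q" "end_homotopic X (\<psi> ` ball v e) (\<lambda>t. K (t, v)) q"
        by (rule sheetE)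
      then obtain w where w: "w \<in> ball v e" "q 1 = \<psi> w" using end_homotopic_ends by blast
      have "a = \<phi> w"
      proof (rule path_end_inj_on_sheet[OF \<psi>(1)])
        show "a \<in> sheet X (\<lambda>t. K (t, v)) (\<psi> ` ?B)" using a sheet_mono[OF image_mono[OF eB]] by blast
        show "\<phi> w \<in> sheet X (\<lambda>t. K (t, v)) (\<psi> ` ?B)" using w(1) v(1) eB W by (intro sheet) auto
        have "path_end a = \<psi> w" using path_end_class[of X q] end_homotopic_pathin[OF q(2)] w(2) q(1) by simp
        then show "path_end a = path_end (\<phi> w)" using end\<phi> w(1) eB by auto
      qed
      then show "a \<in> \<phi> ` W" using w(1) e by blast
    qed
    ultimately show "\<exists>T. openin (universal_cover X x) T \<and> d \<in> T \<and> T \<subseteq> \<phi> ` W" by blast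
  qed
  have "inj_on \<phi> ?B" using inj end\<phi> by (metis inj_onD inj_onI)
  then have "coord_ball (universal_cover X x) \<phi>" unfolding coord_ball_def using cont\<phi> open\<phi> by blast
  then show ?thesis using \<phi>0 sub by blast
qed

text \<open>Distinct end points are separated in \<open>X\<close>. Classes with the same end point
  lie on sheets over one coordinate ball; if these sheets met they would coincide, and injectivity
  of the end point on a sheet would identify the classes.\<close>

lemma Hausdorff_universal_cover: "Hausdorff_space (universal_cover X x)"
  unfolding Hausdorff_space_def
proof (intro allI impI, elim conjE)
  fix c d assume c: "c \<in> topspace (universal_cover X x)" and d: "d \<in> topspace (universal_cover X x)" and ne: "c \<noteq> d"
  obtain p where p: "pathin X p" "p 0 = x" "c = path_class X p" using c by (rule cover_pointE)
  obtain q where q: "pathin X q" "q 0 = x" "d = path_class X q" using d by (rule cover_pointE)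
  note cont = continuous_map_path_end[of X x]
  show "\<exists>U V. openin (universal_cover X x) U \<and> openin (universal_cover X x) V \<and> c \<in> U \<and> d \<in> V \<and> disjnt U V"
  proof (cases "path_end c = path_end d")
    case False
    moreover have "path_end c \<in> topspace X" "path_end d \<in> topspace X"
      using continuous_map_image_subset_topspace[OF cont] c d by blast+
    ultimately obtain U V where UV: "openin X U" "openin X V" "path_end c \<in> U" "path_end d \<in> V" "disjnt U V"
      using Hausdorff unfolding Hausdorff_space_def by metis
    show ?thesis
      using openin_continuous_map_preimage[OF cont UV(1)] openin_continuous_map_preimage[OF cont UV(2)] UV(3-5) c d
      by (intro exI[of _ "{c \<in> topspace (universal_cover X x). path_end c \<in> U}"]
               exI[of _ "{c \<in> topspace (universal_cover X x). path_end c \<in> V}"]) (auto simp: disjnt_iff)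
  next
    case True
    then have pq: "p 1 = q 1" using p q by (simp add: path_end_class)
    have "p 1 \<in> topspace X" using pathin_in_topspace[OF p(1)] by simp
    then obtain \<psi> :: "'e \<Rightarrow> 'a" where \<psi>: "coord_ball X \<psi>" "\<psi> 0 = p 1"
      using coord_ball_at[OF openin_topspace] by blast
    let ?U = "\<psi> ` ball 0 1"
    have "p 1 \<in> ?U" "q 1 \<in> ?U" using \<psi>(2) pq by (metis centre_in_ball image_eqI zero_less_one)+
    then have in_sheet: "c \<in> sheet X p ?U" "d \<in> sheet X q ?U"
      unfolding p(3) q(3) using path_class_in_sheet[OF p(1)] path_class_in_sheet[OF q(1)] by blast+
    have "disjnt (sheet X p ?U) (sheet X q ?U)"
    proof (rule ccontr)
      assume "\<not> disjnt (sheet X p ?U) (sheet X q ?U)"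
      then obtain a where a: "a \<in> sheet X p ?U" "a \<in> sheet X q ?U" by (auto simp: disjnt_iff)
      obtain r where r: "a = path_class X r" "end_homotopic X ?U q r" using a(2) by (rule sheetE)
      have "end_homotopic X ?U p r"
        using end_homotopic_of_class_in_sheet[of X r p ?U] end_homotopic_pathin[OF r(2)] a(1) r(1) by simp
      then have "sheet X p ?U = sheet X q ?U" using sheet_cong[of X ?U _ r] r(2) by simp
      then show False using path_end_inj_on_sheet[OF \<psi>(1)] in_sheet True ne by metis
    qed
    moreover have "openin (universal_cover X x) (sheet X p ?U)" "openin (universal_cover X x) (sheet X q ?U)"
      by (rule openin_sheet[of X ?U p x, OF coord_ball_openin[OF \<psi>(1)] p(2)])
         (rule openin_sheet[of X ?U q x, OF coord_ball_openin[OF \<psi>(1)] q(2)])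
    ultimately show ?thesis using in_sheet by blast
  qed
qed

lemma manifold_universal_cover: "manifold_topology TYPE('e) (universal_cover X x)"
  using Hausdorff_universal_cover coord_ball_universal_cover by unfold_locales

end

text \<open>Truncation gives a path from the constant class to the class of \<open>p\<close>: at
  time \<open>s\<close> take the initial part of \<open>p\<close> up to \<open>s\<close>,
  reparametrised.\<close>

lemma connected_universal_cover:
  "connected_space (universal_cover N x)"
proof -
  have "path_component_of (universal_cover N x) (path_class N (\<lambda>_. x)) c" if c: "c \<in> topspace (universal_cover N x)" for c
  proof -
    obtain p where p: "pathin N p" "p 0 = x" "c = path_class N p" using c by (rule cover_pointE)
    have "continuous_map (prod_topology I01 I01) I01 (\<lambda>z. fst z * snd z)"
    proof (intro continuous_map_into_subtopology)
      have "continuous_map (prod_topology I01 I01) euclideanreal fst" "continuous_map (prod_topology I01 I01) euclideanreal snd"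
        using continuous_map_fst continuous_map_snd continuous_map_in_subtopology by blast+
      then show "continuous_map (prod_topology I01 I01) euclideanreal (\<lambda>z. fst z * snd z)"
        by (intro continuous_intros) auto
      show "(\<lambda>z. fst z * snd z) \<in> topspace (prod_topology I01 I01) \<rightarrow> {0..1::real}"
        by (auto intro: mult_le_one)
    qed
    from continuous_map_compose[OF this p(1)[unfolded pathin_def]]
    have "continuous_map (prod_topology I01 I01) N (\<lambda>z. p (fst z * snd z))" by (simp only: o_def)
    from continuous_map_path_class_family[OF convex_imp_locally_path_connected_space this, of x]
    have "pathin (universal_cover N x) (\<lambda>s. path_class N (\<lambda>t. p (t * s)))"
      using p(2) by (simp add: pathin_def)
    then show ?thesis unfolding path_component_of_def
      by (intro exI[of _ "\<lambda>s. path_class N (\<lambda>t. p (t * s))"] conjI) (simp_all add: p(2,3))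
  qed
  then have "path_component_of (universal_cover N x) c d"
    if "c \<in> topspace (universal_cover N x)" "d \<in> topspace (universal_cover N x)" for c d
    using that by (metis path_component_of_sym path_component_of_trans)
  then have "path_connected_space (universal_cover N x)"
    unfolding path_connected_space_iff_path_component by blast
  then show ?thesis by (rule path_connected_imp_connected_space)
qed


section \<open>Spheres and cubes\<close>

lemma topspace_nsphere: "topspace (nsphere m) = {x. (\<forall>i>m. x i = 0) \<and> (\<Sum>i\<le>m. (x i)\<^sup>2) = 1}"
  unfolding nsphere by (auto simp: Suc_le_eq)

lemma continuous_map_nsphere_iff:
  "continuous_map X (nsphere m) f \<longleftrightarrow>
     (\<forall>i. continuous_map X euclideanreal (\<lambda>x. f x i)) \<and> f \<in> topspace X \<rightarrow> topspace (nsphere m)"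
  unfolding topspace_nsphere unfolding nsphere continuous_map_in_subtopology continuous_map_componentwise_UNIV
  by (auto simp: Suc_le_eq)

text \<open>The straight-line homotopy can be normalised unless it meets the origin. Comparing the
  norms of the two unit vectors, that could happen only at time 1/2, and then the points are
  antipodal.\<close>

lemma not_antipodal_imp_homotopic:
  assumes f: "continuous_map X (nsphere m) f" and g: "continuous_map X (nsphere m) g"
    and na: "\<And>x. x \<in> topspace X \<Longrightarrow> \<exists>i\<le>m. g x i \<noteq> - f x i"
  shows "homot X (nsphere m) f g"
proof -
  let ?P = "prod_topology I01 X"
  define s where "s = (\<lambda>z i. (1 - fst z) * f (snd z) i + fst z * g (snd z) i)"
  define r where "r = (\<lambda>z. sqrt (\<Sum>i\<le>m. (s z i)\<^sup>2))"
  have fs: "f x \<in> topspace (nsphere m)" "g x \<in> topspace (nsphere m)" if "x \<in> topspace X" for x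
    using that f g unfolding continuous_map_nsphere_iff by blast+
  have nonzero: "r z \<noteq> 0" if z: "z \<in> topspace ?P" for z
  proof
    obtain t x where tx: "z = (t, x)" "t \<in> {0..1}" "x \<in> topspace X" using z by auto
    assume "r z = 0"
    then have "\<forall>i\<in>{..m}. (s z i)\<^sup>2 = 0" unfolding r_def by (subst (asm) real_sqrt_eq_0_iff) (simp add: sum_nonneg_eq_0_iff)
    then have eq: "(1 - t) * f x i = - (t * g x i)" if "i \<le> m" for i
      using that by (simp add: s_def tx eq_neg_iff_add_eq_0)
    have "(1 - t)\<^sup>2 * (\<Sum>i\<le>m. (f x i)\<^sup>2) = t\<^sup>2 * (\<Sum>i\<le>m. (g x i)\<^sup>2)"
      unfolding sum_distrib_left using eq by (intro sum.cong refl) (simp flip: power_mult_distrib)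
    then have "(1 - t)\<^sup>2 = t\<^sup>2" using fs[OF tx(3)] by (simp add: topspace_nsphere)
    then have t: "t = 1/2" using tx(2) by (simp add: power2_eq_iff)
    have "g x i = - f x i" if "i \<le> m" for i using eq[OF that] unfolding t by simp
    then show False using na[OF tx(3)] by blast
  qed
  have fst: "continuous_map ?P euclideanreal fst"
    using continuous_map_fst continuous_map_in_subtopology by blast
  have cf: "continuous_map ?P euclideanreal (\<lambda>z. f (snd z) i)" and cg: "continuous_map ?P euclideanreal (\<lambda>z. g (snd z) i)" for i
    using continuous_map_compose[OF continuous_map_snd, of X euclideanreal "\<lambda>x. f x i"]
          continuous_map_compose[OF continuous_map_snd, of X euclideanreal "\<lambda>x. g x i"] f g
    by (auto simp: continuous_map_nsphere_iff o_def)
  have cs: "continuous_map ?P euclideanreal (\<lambda>z. s z i)" for i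
    unfolding s_def by (intro continuous_intros fst cf cg) auto
  have "continuous_map ?P euclideanreal (\<lambda>z. s z i / r z)" for i
    using nonzero unfolding r_def by (intro continuous_intros cs) auto
  moreover have "(\<lambda>i. s z i / r z) \<in> topspace (nsphere m)" if z: "z \<in> topspace ?P" for z
  proof -
    have "s z i = 0" if "i > m" for i using z fs that by (auto simp: s_def topspace_nsphere)
    moreover have "(r z)\<^sup>2 = (\<Sum>i\<le>m. (s z i)\<^sup>2)" unfolding r_def by (simp add: sum_nonneg)
    moreover have "(\<Sum>i\<le>m. (s z i)\<^sup>2) \<noteq> 0" using nonzero[OF z] unfolding r_def by simp
    ultimately show ?thesis
      by (simp add: topspace_nsphere power_divide flip: sum_divide_distrib)
  qed
  ultimately have cont: "continuous_map ?P (nsphere m) (\<lambda>z i. s z i / r z)"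
    unfolding continuous_map_nsphere_iff by blast
  show ?thesis
  proof (rule homotopic_with[THEN iffD2]; (intro exI[of _ "\<lambda>z i. s z i / r z"] conjI cont ballI)?)
    show "(\<lambda>i. s (0, x) i / r (0, x)) = f x" "(\<lambda>i. s (1, x) i / r (1, x)) = g x" if "x \<in> topspace X" for x
      using fs[OF that] by (auto simp: s_def r_def topspace_nsphere)
  qed auto
qed

section \<open>Passing between the sphere and the cube\<close>

definition cube_boundary :: "nat \<Rightarrow> (nat \<Rightarrow> real) set"
  where "cube_boundary k = {z \<in> topspace (unit_cube k). \<exists>i<k. z i = 0 \<or> z i = 1}"

lemma topspace_unit_cube: "topspace (unit_cube k) = {..<k} \<rightarrow>\<^sub>E {0..1}"
  by (simp add: unit_cube_def)

lemma continuous_map_unit_cube_iff: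
  "continuous_map X (unit_cube k) f \<longleftrightarrow>
     (\<forall>i<k. continuous_map X euclideanreal (\<lambda>x. f x i)) \<and> f \<in> topspace X \<rightarrow> topspace (unit_cube k)"
  unfolding unit_cube_def continuous_map_componentwise continuous_map_in_subtopology
  by (auto simp: PiE_iff Pi_iff image_subset_iff)

lemma continuous_map_unit_cube_coord: "i < k \<Longrightarrow> continuous_map (unit_cube k) euclideanreal (\<lambda>z. z i)"
  using continuous_map_unit_cube_iff[of "unit_cube k" k id] by auto

text \<open>The last coordinate is dropped, the others are magnified by \<open>m\<close> about the
  centre and clipped. The factor is large enough that not only the equator but the whole band
  \<open>\<bar>x m\<bar> \<le> 1/2\<close> lands on the boundary.\<close>

definition to_cube :: "nat \<Rightarrow> (nat \<Rightarrow> real) \<Rightarrow> nat \<Rightarrow> real"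
  where "to_cube m x = (\<lambda>i\<in>{..<m}. max 0 (min 1 (1/2 + real m * x i)))"

lemma continuous_map_to_cube: "continuous_map (nsphere m) (unit_cube m) (to_cube m)"
  unfolding continuous_map_unit_cube_iff
proof (intro conjI allI impI)
  show "continuous_map (nsphere m) euclideanreal (\<lambda>x. to_cube m x i)" if "i < m" for i
    using that by (simp add: to_cube_def) (intro continuous_intros continuous_map_nsphere_projection; simp)
qed (auto simp: to_cube_def topspace_unit_cube)

text \<open>If all of the first \<open>m\<close> coordinates had absolute value below
  \<open>1 / (2 * m)\<close>, their squares would add up to at most \<open>1 / (4 * m)\<close>,
  whereas on this band the sum is at least 3/4. So some coordinate reaches a face.\<close>

lemma to_cube_in_boundary:
  assumes x: "x \<in> topspace (nsphere m)" and le: "\<bar>x m\<bar> \<le> 1/2"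
  shows "to_cube m x \<in> cube_boundary m"
proof -
  have "\<exists>i<m. 1/2 \<le> real m * \<bar>x i\<bar>"
  proof (rule ccontr)
    assume "\<not> ?thesis"
    then have small: "real m * \<bar>x i\<bar> < 1/2" if "i < m" for i using that by auto
    have "(x m)\<^sup>2 \<le> (1/2)\<^sup>2" using le by (metis abs_le_square_iff abs_of_nonneg zero_le_divide_1_iff zero_le_numeral)
    moreover have "{..m} = insert m {..<m}" by auto
    then have "(\<Sum>i<m. (x i)\<^sup>2) = 1 - (x m)\<^sup>2" using x by (simp add: topspace_nsphere)
    ultimately have "3/4 \<le> (\<Sum>i<m. (x i)\<^sup>2)" by (simp add: power2_eq_square)
    then have ge: "(real m)\<^sup>2 * (3/4) \<le> (\<Sum>i<m. (real m * x i)\<^sup>2)"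
      using mult_left_mono[of _ _ "(real m)\<^sup>2"] by (simp only: power_mult_distrib zero_le_power2 flip: sum_distrib_left)
    have "(real m * x i)\<^sup>2 \<le> 1/4" if "i < m" for i
      using small[OF that] abs_le_square_iff[of "real m * x i" "1/2"] by (simp add: abs_mult power2_eq_square)
    then have "(\<Sum>i<m. (real m * x i)\<^sup>2) \<le> (\<Sum>i<m. 1/4)" by (intro sum_mono) auto
    then have "real m * real m * 3 \<le> real m" using ge by (simp add: power2_eq_square)
    moreover have "m \<noteq> 0" using \<open>3/4 \<le> (\<Sum>i<m. (x i)\<^sup>2)\<close> by (intro notI) simp
    then have "real m * 1 \<le> real m * real m" by (intro mult_left_mono) auto
    ultimately show False using \<open>m \<noteq> 0\<close> by simp
  qed
  then obtain i where i: "i < m" "1/2 \<le> real m * \<bar>x i\<bar>" by blast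
  then have "to_cube m x i = 0 \<or> to_cube m x i = 1"
    by (cases "x i \<ge> 0") (auto simp: to_cube_def max_def min_def)
  moreover have "to_cube m x \<in> topspace (unit_cube m)" by (auto simp: to_cube_def topspace_unit_cube)
  ultimately show ?thesis using i(1) unfolding cube_boundary_def by blast
qed

text \<open>Inverse stereographic projection of $w = 2z - 1$, rescaled by a function \<open>\<beta>\<close> that vanishes exactly on
  the boundary of the cube; the boundary therefore goes to the south pole.\<close>

definition cube_bump :: "nat \<Rightarrow> (nat \<Rightarrow> real) \<Rightarrow> real"
  where "cube_bump m z = (\<Prod>i<m. 4 * z i * (1 - z i))"

definition cube_norm2 :: "nat \<Rightarrow> (nat \<Rightarrow> real) \<Rightarrow> real"
  where "cube_norm2 m z = (\<Sum>i<m. (2 * z i - 1)\<^sup>2)"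

definition cube_to_sphere :: "nat \<Rightarrow> (nat \<Rightarrow> real) \<Rightarrow> nat \<Rightarrow> real"
  where "cube_to_sphere m z i =
     (if i < m then 2 * cube_bump m z * (2 * z i - 1)
      else if i = m then (cube_bump m z)\<^sup>2 - cube_norm2 m z else 0)
     / ((cube_bump m z)\<^sup>2 + cube_norm2 m z)"

definition south_pole :: "nat \<Rightarrow> nat \<Rightarrow> real"
  where "south_pole m = (\<lambda>i. if i = m then -1 else 0)"

lemma cube_bump_nonneg: "z \<in> topspace (unit_cube m) \<Longrightarrow> 0 \<le> cube_bump m z"
  unfolding cube_bump_def topspace_unit_cube by (intro prod_nonneg) (auto simp: PiE_iff)

lemma cube_norm2_eq_0: "cube_norm2 m z = 0 \<longleftrightarrow> (\<forall>i<m. z i = 1/2)"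
  unfolding cube_norm2_def by (subst sum_nonneg_eq_0_iff) (auto simp: field_simps)

lemma cube_norm2_nonneg: "0 \<le> cube_norm2 m z"
  unfolding cube_norm2_def by (intro sum_nonneg) auto

text \<open>\<open>cube_norm2\<close> vanishes only at the centre, and there every factor
  \<open>4 * z i * (1 - z i)\<close> of the bump equals 1, which is what the 4 normalises.\<close>

lemma cube_denominator_pos: "0 < (cube_bump m z)\<^sup>2 + cube_norm2 m z"
proof (cases "cube_norm2 m z = 0")
  case True
  then have half: "z i = 1/2" if "i < m" for i using that by (simp only: cube_norm2_eq_0)
  have "cube_bump m z = (\<Prod>i<m. 1)" unfolding cube_bump_def by (intro prod.cong refl) (simp add: half)
  then show ?thesis using True by simp
next
  case False
  then show ?thesis using cube_norm2_nonneg[of m z] by (simp add: add_nonneg_pos)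
qed

lemma continuous_map_cube_to_sphere: "continuous_map (unit_cube m) (nsphere m) (cube_to_sphere m)"
  unfolding continuous_map_nsphere_iff
proof (intro conjI allI funcsetI)
  have b: "continuous_map (unit_cube m) euclideanreal (cube_bump m)"
    unfolding cube_bump_def by (intro continuous_intros continuous_map_unit_cube_coord) auto
  have n: "continuous_map (unit_cube m) euclideanreal (cube_norm2 m)"
    unfolding cube_norm2_def by (intro continuous_intros continuous_map_unit_cube_coord) auto
  show "continuous_map (unit_cube m) euclideanreal (\<lambda>z. cube_to_sphere m z i)" for i
  proof -
    have "continuous_map (unit_cube m) euclideanreal
       (\<lambda>z. if i < m then 2 * cube_bump m z * (2 * z i - 1) else if i = m then (cube_bump m z)\<^sup>2 - cube_norm2 m z else 0)"
    proof (cases "i < m")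
      case True
      then show ?thesis by simp (intro continuous_intros b continuous_map_unit_cube_coord; simp)
    next
      case False
      then show ?thesis by (cases "i = m") (simp_all, intro continuous_intros b n)
    qed
    moreover have "continuous_map (unit_cube m) euclideanreal (\<lambda>z. (cube_bump m z)\<^sup>2 + cube_norm2 m z)"
      by (intro continuous_intros b n)
    ultimately show ?thesis unfolding cube_to_sphere_def
      using cube_denominator_pos[of m] by (intro continuous_map_real_divide) (assumption+, metis less_irrefl)
  qed
  fix z
  let ?b = "cube_bump m z" and ?n = "cube_norm2 m z"
  have "(\<Sum>i\<le>m. (cube_to_sphere m z i)\<^sup>2) = (\<Sum>i<m. (cube_to_sphere m z i)\<^sup>2) + (cube_to_sphere m z m)\<^sup>2"
    by (simp add: lessThan_Suc_atMost[symmetric])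
  also have "(\<Sum>i<m. (cube_to_sphere m z i)\<^sup>2) = (\<Sum>i<m. 4 * ?b\<^sup>2 / (?b\<^sup>2 + ?n)\<^sup>2 * (2 * z i - 1)\<^sup>2)"
    by (intro sum.cong refl) (simp add: cube_to_sphere_def power_divide power_mult_distrib)
  also have "\<dots> = 4 * ?b\<^sup>2 * ?n / (?b\<^sup>2 + ?n)\<^sup>2" unfolding sum_distrib_left[symmetric] by (simp add: cube_norm2_def)
  also have "\<dots> + (cube_to_sphere m z m)\<^sup>2 = (4 * ?b\<^sup>2 * ?n + (?b\<^sup>2 - ?n)\<^sup>2) / (?b\<^sup>2 + ?n)\<^sup>2"
    by (simp add: cube_to_sphere_def power_divide add_divide_distrib)
  also have "4 * ?b\<^sup>2 * ?n + (?b\<^sup>2 - ?n)\<^sup>2 = (?b\<^sup>2 + ?n)\<^sup>2" by (simp add: power2_eq_square algebra_simps)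
  finally show "cube_to_sphere m z \<in> topspace (nsphere m)"
    using cube_denominator_pos[of m z] by (auto simp: topspace_nsphere cube_to_sphere_def)
qed

lemma cube_to_sphere_boundary:
  assumes "z \<in> cube_boundary m"
  shows "cube_to_sphere m z = south_pole m"
proof -
  have b: "cube_bump m z = 0" using assms unfolding cube_boundary_def cube_bump_def by (auto simp: prod_zero_iff)
  then have "cube_norm2 m z \<noteq> 0" using cube_denominator_pos[of m z] by simp
  then show ?thesis using b by (auto simp: cube_to_sphere_def south_pole_def fun_eq_iff)
qed

lemma south_pole_in_nsphere: "south_pole m \<in> topspace (nsphere m)"
  by (simp add: topspace_nsphere south_pole_def if_distrib[of "\<lambda>x. x\<^sup>2"] cong: if_cong)

text \<open>Meant for a map of the cube that sends the boundary to \<open>y\<close>. Since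
  \<open>to_cube\<close> sends the equator to the boundary, the two branches then agree
  there.\<close>

definition cap :: "nat \<Rightarrow> ((nat \<Rightarrow> real) \<Rightarrow> 'a) \<Rightarrow> 'a \<Rightarrow> (nat \<Rightarrow> real) \<Rightarrow> 'a"
  where "cap m \<Phi> y x = (if 0 \<le> x m then \<Phi> (to_cube m x) else y)"

lemma continuous_map_cap:
  assumes \<Phi>: "continuous_map (unit_cube m) Y \<Phi>" and bd: "\<And>z. z \<in> cube_boundary m \<Longrightarrow> \<Phi> z = y" and y: "y \<in> topspace Y"
  shows "continuous_map (nsphere m) Y (cap m \<Phi> y)"
  unfolding cap_def
proof (rule continuous_map_cases_le)
  have "continuous_map (nsphere m) Y (\<Phi> \<circ> to_cube m)" by (rule continuous_map_compose[OF continuous_map_to_cube \<Phi>])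
  then show "continuous_map (subtopology (nsphere m) {x \<in> topspace (nsphere m). 0 \<le> x m}) Y (\<lambda>x. \<Phi> (to_cube m x))"
    by (simp add: o_def continuous_map_from_subtopology)
  show "\<Phi> (to_cube m x) = y" if "x \<in> topspace (nsphere m)" "0 = x m" for x
    using bd to_cube_in_boundary[OF that(1)] that(2) by simp
qed (use y continuous_map_nsphere_projection in auto)

lemma cap_lower: "x \<in> topspace (nsphere m) \<Longrightarrow> x m \<le> 0 \<Longrightarrow> (\<And>z. z \<in> cube_boundary m \<Longrightarrow> \<Phi> z = y) \<Longrightarrow> cap m \<Phi> y x = y"
  using to_cube_in_boundary[of x m] by (cases "x m = 0") (auto simp: cap_def)

text \<open>The collapse \<open>?E\<close> of the sphere through the cube, taking the lower
  hemisphere to the south pole, never sends a point to its antipode, hence is homotopic to the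
  identity; \<open>f\<close> is then composed with it.\<close>

lemma homotopic_cap:
  assumes f: "continuous_map (nsphere m) Y f"
  shows "homot (nsphere m) Y f (cap m (f \<circ> cube_to_sphere m) (f (south_pole m)))"
proof -
  let ?E = "cap m (cube_to_sphere m) (south_pole m)"
  have E: "continuous_map (nsphere m) (nsphere m) ?E"
    by (intro continuous_map_cap continuous_map_cube_to_sphere cube_to_sphere_boundary south_pole_in_nsphere)
  have "homot (nsphere m) (nsphere m) id ?E"
  proof (rule not_antipodal_imp_homotopic[OF _ E])
    fix x assume x: "x \<in> topspace (nsphere m)"
    show "\<exists>i\<le>m. ?E x i \<noteq> - id x i"
    proof (rule ccontr)
      assume "\<not> ?thesis"
      then have anti: "?E x i = - x i" if "i \<le> m" for i using that by auto
      show False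
      proof (cases "0 \<le> x m")
        case False
        then have "x m = 1" using anti[of m] by (simp add: cap_def south_pole_def)
        then show False using False by simp
      next
        case True
        let ?z = "to_cube m x"
        let ?d = "(cube_bump m ?z)\<^sup>2 + cube_norm2 m ?z"
        have zc: "?z \<in> topspace (unit_cube m)" using continuous_map_to_cube x by (auto simp: continuous_map_unit_cube_iff)
        \<comment> \<open>Each of the first \<open>m\<close> coordinates of \<open>?E x\<close>
          vanishes or has the same sign as that of \<open>x\<close>, so antipodality forces
          \<open>x i = 0\<close>. Then \<open>to_cube m x\<close> is the centre, which goes to the
          north pole, and this is not the antipode of a point with
          \<open>x m \<ge> 0\<close>.\<close>
        have zero: "x i = 0" if i: "i < m" for i
        proof -
          have "0 \<le> (2 * ?z i - 1) * x i"
          proof (cases "0 \<le> x i")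
            case True
            then have "1/2 \<le> ?z i" using i by (auto simp: to_cube_def)
            then show ?thesis using True by simp
          next
            case False
            then have "real m * x i \<le> 0" by (simp add: mult_nonneg_nonpos)
            then have "?z i \<le> 1/2" using i by (auto simp: to_cube_def max_def min_def)
            then show ?thesis using False by (intro mult_nonpos_nonpos) auto
          qed
          then have "0 \<le> 2 * cube_bump m ?z / ?d * ((2 * ?z i - 1) * x i)"
            using cube_bump_nonneg[OF zc] cube_denominator_pos[of m ?z] by simp
          also have "\<dots> = ?E x i * x i" using i True by (simp add: cap_def cube_to_sphere_def)
          also have "\<dots> = - (x i)\<^sup>2" using anti[of i] i by (simp add: power2_eq_square)
          finally show ?thesis by simp
        qed
        then have "?z i = 1/2" if "i < m" for i using that by (simp add: to_cube_def)
        then have "cube_norm2 m ?z = 0" by (simp add: cube_norm2_eq_0)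
        then have "?E x m = 1" using True cube_denominator_pos[of m ?z] by (simp add: cap_def cube_to_sphere_def)
        then show False using anti[of m] True by simp
      qed
    qed
  qed auto
  then have "homot (nsphere m) Y (f \<circ> id) (f \<circ> ?E)"
    using f by (rule homotopic_with_compose_continuous_map_left) auto
  moreover have "f \<circ> ?E = cap m (f \<circ> cube_to_sphere m) (f (south_pole m))" by (auto simp: cap_def fun_eq_iff)
  ultimately show ?thesis by simp
qed


section \<open>Serre fibrations with a section\<close>

lemma upd_in_unit_cube:
  "z \<in> topspace (unit_cube k) \<Longrightarrow> 0 < k \<Longrightarrow> e \<in> {0..1} \<Longrightarrow> z(0 := e) \<in> topspace (unit_cube k)"
  by (auto simp: topspace_unit_cube PiE_iff extensional_def)

lemma continuous_map_upd_unit_cube: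
  assumes c: "continuous_map X (unit_cube k) c" and e: "continuous_map X euclideanreal e" and k: "0 < k"
    and e01: "\<And>x. x \<in> topspace X \<Longrightarrow> e x \<in> {0..1}"
  shows "continuous_map X (unit_cube k) (\<lambda>x. (c x)(0 := e x))"
  unfolding continuous_map_unit_cube_iff
proof (intro conjI allI impI funcsetI)
  fix i assume "i < k"
  then show "continuous_map X euclideanreal (\<lambda>x. ((c x)(0 := e x)) i)"
    using c e by (cases "i = 0") (auto simp: continuous_map_unit_cube_iff)
next
  fix x assume "x \<in> topspace X"
  then show "(c x)(0 := e x) \<in> topspace (unit_cube k)"
    using c e01 by (intro upd_in_unit_cube k) (auto simp: continuous_map_unit_cube_iff)
qed

text \<open>The lifting property is applied to \<open>f\<close> traversed backwards in direction 0 followed by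
  \<open>s \<circ> p \<circ> f\<close>, that is, to prescribed values on two sides of the square spanned by
  direction 0 and the homotopy parameter. The square is swept out diagonally.\<close>

lemma serre_fibration_push_down:
  fixes f :: "(nat \<Rightarrow> real) \<Rightarrow> 'a"
  assumes fib: "serre_fibration N B p" and s: "continuous_map B N s"
    and ps: "\<And>b. b \<in> topspace B \<Longrightarrow> p (s b) = b"
    and f: "continuous_map (unit_cube k) N f" and k: "0 < k"
    and top: "\<And>z. z \<in> topspace (unit_cube k) \<Longrightarrow> z 0 = 1 \<Longrightarrow> f z = s (p (f z))"
  obtains G where "continuous_map (prod_topology I01 (unit_cube k)) N G"
    and "\<And>z. z \<in> topspace (unit_cube k) \<Longrightarrow> G (0, z) = f z"
    and "\<And>t z. t \<in> {0..1} \<Longrightarrow> z \<in> topspace (unit_cube k) \<Longrightarrow> p (G (t, z)) = p (f (z(0 := z 0 * (1 - t))))"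
    and "\<And>t z. t \<in> {0..1} \<Longrightarrow> z \<in> topspace (unit_cube k) \<Longrightarrow> z 0 = 1 \<Longrightarrow> G (t, z) \<in> s ` topspace B"
proof -
  let ?C = "unit_cube k" and ?P = "prod_topology I01 (unit_cube k)"
  have p: "continuous_map N B p" using fib by (simp add: serre_fibration_def)
  have z0: "z 0 \<in> {0..1}" if "z \<in> topspace ?C" for z
    using that k PiE_mem[of z "{..<k}" "\<lambda>_. {0..1}" 0] by (simp add: topspace_unit_cube)
  have fB: "p (f z) \<in> topspace B" if "z \<in> topspace ?C" for z
    using that continuous_map_image_subset_topspace[OF f] continuous_map_image_subset_topspace[OF p] by blast
  \<comment> \<open>Along the coordinate \<open>z 0\<close> the function \<open>l\<close> runs
    through two sides of a square with coordinates \<open>a\<close> and \<open>b\<close>: on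
    \<open>a = 0\<close> it is the section over the projected \<open>f\<close>, on
    \<open>b = 0\<close> it is \<open>f\<close> backwards. The corner is at
    \<open>z 0 = 1/2\<close>, where \<open>top\<close> makes both agree.\<close>
  define l where "l z = (if 1 \<le> 2 * z 0 then f (z(0 := 2 - 2 * z 0)) else s (p (f (z(0 := 2 * z 0)))))" for z
  \<comment> \<open>From the point with parameter \<open>z 0\<close> on the two sides, both
    coordinates grow by \<open>u\<close> along a diagonal, clipped at 1. The base map depends on
    \<open>(1 - a) * (1 - b)\<close>, which restricts to the right values on both sides.\<close>
  define a where "a u z = min 1 (max (2 * z 0 - 1) 0 + u)" for u :: real and z :: "nat \<Rightarrow> real"
  define b where "b u z = min 1 (max (1 - 2 * z 0) 0 + u)" for u :: real and z :: "nat \<Rightarrow> real"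
  define h where "h = (\<lambda>(u, z). p (f (z(0 := (1 - a u z) * (1 - b u z)))))"
  have l: "continuous_map ?C N l" unfolding l_def
  proof (rule continuous_map_cases_le)
    show "continuous_map ?C euclideanreal (\<lambda>z. 1)" "continuous_map ?C euclideanreal (\<lambda>z. 2 * z 0)"
      using k by (auto intro!: continuous_intros continuous_map_unit_cube_coord)
    have "continuous_map (subtopology ?C {z \<in> topspace ?C. 1 \<le> 2 * z 0}) ?C (\<lambda>z. z(0 := 2 - 2 * z 0))"
      using k z0 by (intro continuous_map_upd_unit_cube continuous_map_from_subtopology continuous_intros
            continuous_map_unit_cube_coord continuous_map_id[unfolded id_def]) auto
    from continuous_map_compose[OF this f]
    show "continuous_map (subtopology ?C {z \<in> topspace ?C. 1 \<le> 2 * z 0}) N (\<lambda>z. f (z(0 := 2 - 2 * z 0)))"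
      by (simp add: o_def)
    have "continuous_map (subtopology ?C {z \<in> topspace ?C. 2 * z 0 \<le> 1}) ?C (\<lambda>z. z(0 := 2 * z 0))"
      using k z0 by (intro continuous_map_upd_unit_cube continuous_map_from_subtopology continuous_intros
            continuous_map_unit_cube_coord continuous_map_id[unfolded id_def]) auto
    from continuous_map_compose[OF continuous_map_compose[OF this f] continuous_map_compose[OF p s]]
    show "continuous_map (subtopology ?C {z \<in> topspace ?C. 2 * z 0 \<le> 1}) N (\<lambda>z. s (p (f (z(0 := 2 * z 0)))))"
      by (simp add: o_def)
  next
    fix z assume z: "z \<in> topspace ?C" "1 = 2 * z 0"
    have "z(0 := 1) \<in> topspace ?C" using z k by (intro upd_in_unit_cube) auto
    then show "f (z(0 := 2 - 2 * z 0)) = s (p (f (z(0 := 2 * z 0))))" using top[of "z(0 := 1)"] z(2)[symmetric] by simp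
  qed
  have fst: "continuous_map ?P euclideanreal fst" and snd: "continuous_map ?P ?C snd"
    using continuous_map_fst continuous_map_in_subtopology continuous_map_snd by blast+
  have snd0: "continuous_map ?P euclideanreal (\<lambda>x. snd x 0)"
    using continuous_map_compose[OF snd continuous_map_unit_cube_coord[OF k]] by (simp add: o_def)
  have in01: "x * y \<in> {0..1}" if "x \<in> {0..1}" "y \<in> {0..1}" for x y :: real
    using that by (auto intro: mult_le_one)
  have ab: "1 - a u z \<in> {0..1}" "1 - b u z \<in> {0..1}" if "u \<in> {0..1}" for u z
    using that by (auto simp: a_def b_def)
  have h: "continuous_map ?P B h"
  proof -
    have "continuous_map ?P euclideanreal (\<lambda>x. (1 - a (fst x) (snd x)) * (1 - b (fst x) (snd x)))"
      unfolding a_def b_def by (intro continuous_intros fst snd0) auto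
    then have "continuous_map ?P ?C (\<lambda>x. (snd x)(0 := (1 - a (fst x) (snd x)) * (1 - b (fst x) (snd x))))"
      by (intro continuous_map_upd_unit_cube snd k in01 ab) auto
    from continuous_map_compose[OF continuous_map_compose[OF this f] p]
    show ?thesis by (simp add: h_def o_def case_prod_unfold)
  qed
  have start: "h (0, z) = p (l z)" if z: "z \<in> topspace ?C" for z
  proof (cases "1 \<le> 2 * z 0")
    case True
    then have "a 0 z = 2 * z 0 - 1" "b 0 z = 0" using z0[OF z] by (auto simp: a_def b_def)
    then show ?thesis using True by (simp add: h_def l_def)
  next
    case False
    then have "a 0 z = 0" "b 0 z = 1 - 2 * z 0" using z0[OF z] by (auto simp: a_def b_def)
    moreover have "z(0 := 2 * z 0) \<in> topspace ?C" using False z0[OF z] by (intro upd_in_unit_cube k z) auto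
    ultimately show ?thesis using False by (simp add: h_def l_def ps fB)
  qed
  have "\<exists>L. continuous_map ?P N L \<and> (\<forall>z\<in>topspace ?C. L (0, z) = l z) \<and>
      (\<forall>u\<in>{0..1}. \<forall>z\<in>topspace ?C. p (L (u, z)) = h (u, z))"
    by (rule fib[unfolded serre_fibration_def, THEN conjunct2, THEN spec, THEN spec, THEN spec, THEN mp])
       (intro conjI l h ballI start)
  then obtain L where L: "continuous_map ?P N L" "\<And>z. z \<in> topspace ?C \<Longrightarrow> L (0, z) = l z"
      "\<And>u z. u \<in> {0..1} \<Longrightarrow> z \<in> topspace ?C \<Longrightarrow> p (L (u, z)) = h (u, z)"
    by (elim exE conjE) simp
  \<comment> \<open>The point \<open>(1 - z 0, t)\<close> of the square is reached from the two
    sides after time \<open>min (1 - z 0) t\<close>. Its diagonal starts at the parameter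
    \<open>w\<close> with \<open>2 * w - 1 = a - b\<close>, that is
    \<open>w = (2 - z 0 - t) / 2\<close>.\<close>
  define c where "c t z = z(0 := (2 - z 0 - t) / 2)" for t and z :: "nat \<Rightarrow> real"
  define G where "G = (\<lambda>(t, z). L (min (1 - z 0) t, c t z))"
  have c: "c t z \<in> topspace ?C" if "t \<in> {0..1}" "z \<in> topspace ?C" for t z
    unfolding c_def using that z0[OF that(2)] by (intro upd_in_unit_cube k) auto
  show ?thesis
  proof
    have "continuous_map ?P euclideanreal (\<lambda>x. (2 - snd x 0 - fst x) / 2)"
      by (intro continuous_intros fst snd0) auto
    then have "continuous_map ?P ?C (\<lambda>x. c (fst x) (snd x))" unfolding c_def
    proof (intro continuous_map_upd_unit_cube snd k)
      fix x assume "x \<in> topspace ?P"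
      then show "(2 - snd x 0 - fst x) / 2 \<in> {0..1}" using z0[of "snd x"] by auto
    qed
    moreover have "continuous_map ?P I01 (\<lambda>x. min (1 - snd x 0) (fst x))"
    proof (rule continuous_map_into_subtopology)
      show "continuous_map ?P euclideanreal (\<lambda>x. min (1 - snd x 0) (fst x))"
        by (intro continuous_intros fst snd0) auto
    qed (use z0 in auto)
    ultimately have "continuous_map ?P ?P (\<lambda>x. (min (1 - snd x 0) (fst x), c (fst x) (snd x)))"
      by (rule continuous_map_pairedI[rotated])
    from continuous_map_compose[OF this L(1)]
    show "continuous_map ?P N G" by (simp add: G_def o_def case_prod_unfold)
    show "G (0, z) = f z" if z: "z \<in> topspace ?C" for z
    proof -
      have "2 - (4 - 2 * z 0) / 2 = z 0" by (simp add: diff_divide_distrib)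
      then have "l (c 0 z) = f z" using z0[OF z] by (simp add: l_def c_def)
      then show ?thesis using c[of 0 z] z0[OF z] z by (simp add: G_def L(2))
    qed
    show "p (G (t, z)) = p (f (z(0 := z 0 * (1 - t))))" if tz: "t \<in> {0..1}" "z \<in> topspace ?C" for t z
    proof -
      have "min (1 - z 0) t \<in> {0..1}" using tz z0[OF tz(2)] by auto
      then have "p (G (t, z)) = h (min (1 - z 0) t, c t z)" using c[OF tz] L(3) by (simp add: G_def)
      moreover have w: "2 * c t z 0 = 2 - z 0 - t" by (simp add: c_def field_simps)
      have "a (min (1 - z 0) t) (c t z) = 1 - z 0" "b (min (1 - z 0) t) (c t z) = t"
        using tz(1) z0[OF tz(2)] by (auto simp: a_def b_def w min_def max_def)
      ultimately show ?thesis by (simp add: h_def c_def)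
    qed
    show "G (t, z) \<in> s ` topspace B" if tz: "t \<in> {0..1}" "z \<in> topspace ?C" "z 0 = 1" for t z
    proof -
      have "G (t, z) = l (c t z)" using tz c[OF tz(1,2)] by (simp add: G_def L(2) min_def)
      also have "\<dots> = s (p (f (z(0 := 1 - t))))"
      \<comment> \<open>At the corner \<open>l\<close> takes its \<open>f\<close> branch, so
        \<open>top\<close> is needed to see a value of the section.\<close>
      proof (cases "t = 0")
        case True
        moreover have "z(0 := 1) = z" using tz(3) by auto
        ultimately show ?thesis using top[OF tz(2,3)] tz(3) by (simp add: l_def c_def)
      next
        case False
        then show ?thesis using tz by (simp add: l_def c_def diff_divide_distrib)
      qed
      finally show ?thesis using fB[OF upd_in_unit_cube[OF tz(2) k, of "1 - t"]] tz(1) by simp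
    qed
  qed
qed

text \<open>The deformed map takes values only in the fibre over \<open>b\<close> and on the
  section, and \<open>y\<close> lies on neither. As \<open>f\<close> sends the south pole, hence the
  boundary of the cube, to \<open>s b\<close>, contracting direction 0 to its lower face ends over
  \<open>b\<close>.\<close>

lemma fibration_homotopic_avoiding:
  assumes fib: "serre_fibration N B p" and ret: "retraction_maps N B p s"
    and f: "continuous_map (nsphere m) N f" and m: "0 < m"
    and b: "b \<in> topspace B" "f (south_pole m) = s b" and y: "p y \<noteq> b" "s (p y) \<noteq> y"
  shows "\<exists>g. homot (nsphere m) N f g \<and> y \<notin> g ` topspace (nsphere m)"
proof -
  let ?C = "unit_cube m" and ?S = "nsphere m" and ?P = "prod_topology I01 (nsphere m)"
  have s: "continuous_map B N s" and ps: "\<And>b. b \<in> topspace B \<Longrightarrow> p (s b) = b"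
    using ret by (auto simp: retraction_maps_def)
  let ?f = "f \<circ> cube_to_sphere m"
  have fc: "continuous_map ?C N ?f" by (rule continuous_map_compose[OF continuous_map_cube_to_sphere f])
  have bd: "?f z = s b" if "z \<in> cube_boundary m" for z
    using that b(2) by (simp add: cube_to_sphere_boundary)
  have face: "z(0 := 0) \<in> cube_boundary m" if "z \<in> topspace ?C" for z
    using upd_in_unit_cube[OF that m, of 0] m unfolding cube_boundary_def by (auto intro!: exI[of _ 0])
  have top: "?f z = s (p (?f z))" if "z \<in> topspace ?C" "z 0 = 1" for z
  proof -
    have "z \<in> cube_boundary m" using that m unfolding cube_boundary_def by auto
    then show ?thesis using bd ps[OF b(1)] by simp
  qed
  obtain G where G: "continuous_map (prod_topology I01 ?C) N G" "\<And>z. z \<in> topspace ?C \<Longrightarrow> G (0, z) = ?f z"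
    and pG: "\<And>t z. t \<in> {0..1} \<Longrightarrow> z \<in> topspace ?C \<Longrightarrow> p (G (t, z)) = p (?f (z(0 := z 0 * (1 - t))))"
    and sG: "\<And>t z. t \<in> {0..1} \<Longrightarrow> z \<in> topspace ?C \<Longrightarrow> z 0 = 1 \<Longrightarrow> G (t, z) \<in> s ` topspace B"
    using serre_fibration_push_down[OF fib s ps fc m top] by metis
  have cube: "to_cube m x \<in> topspace ?C" if "x \<in> topspace ?S" for x
    using continuous_map_to_cube that continuous_map_image_subset_topspace by blast
  \<comment> \<open>The time of the push is scaled down near the equator: it is 0 there, so that the
    homotopy joins the constant lower hemisphere, and reaches 1 at height 1/2. Where it is below 1
    on the upper hemisphere, \<open>to_cube\<close> takes values in the boundary.\<close>
  define \<tau> where "\<tau> x = min 1 (2 * max 0 (x m))" for x :: "nat \<Rightarrow> real"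
  have \<tau>01: "\<tau> x \<in> {0..1}" for x by (auto simp: \<tau>_def)
  define \<Gamma> where "\<Gamma> = (\<lambda>z. if 0 \<le> snd z m then G (fst z * \<tau> (snd z), to_cube m (snd z)) else s b)"
  have \<Gamma>: "continuous_map ?P N \<Gamma>"
    unfolding \<Gamma>_def
  proof (rule continuous_map_cases_le)
    have fst: "continuous_map ?P euclideanreal fst"
      using continuous_map_fst continuous_map_in_subtopology by blast
    show snd: "continuous_map ?P euclideanreal (\<lambda>z. snd z m)"
      using continuous_map_compose[OF continuous_map_snd continuous_map_nsphere_projection] by (simp add: o_def)
    have "continuous_map ?P I01 (\<lambda>z. fst z * \<tau> (snd z))"
    proof (rule continuous_map_into_subtopology)
      show "continuous_map ?P euclideanreal (\<lambda>z. fst z * \<tau> (snd z))"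
        unfolding \<tau>_def by (intro continuous_intros fst snd) auto
      show "(\<lambda>z. fst z * \<tau> (snd z)) \<in> topspace ?P \<rightarrow> {0..1}"
        using \<tau>01 by (auto intro!: mult_le_one mult_nonneg_nonneg)
    qed
    moreover have "continuous_map ?P ?C (\<lambda>z. to_cube m (snd z))"
      using continuous_map_compose[OF continuous_map_snd continuous_map_to_cube] by (simp add: o_def)
    ultimately have "continuous_map ?P (prod_topology I01 ?C) (\<lambda>z. (fst z * \<tau> (snd z), to_cube m (snd z)))"
      by (rule continuous_map_pairedI)
    from continuous_map_compose[OF this G(1)]
    show "continuous_map (subtopology ?P {x \<in> topspace ?P. 0 \<le> snd x m}) N (\<lambda>z. G (fst z * \<tau> (snd z), to_cube m (snd z)))"
      by (simp add: o_def continuous_map_from_subtopology)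
    show "continuous_map (subtopology ?P {x \<in> topspace ?P. snd x m \<le> 0}) N (\<lambda>z. s b)"
      using s b(1) continuous_map_image_subset_topspace by fastforce
    fix z assume z: "z \<in> topspace ?P" "0 = snd z m"
    then have x: "snd z \<in> topspace ?S" by auto
    have "\<tau> (snd z) = 0" using z(2) by (simp add: \<tau>_def)
    then show "G (fst z * \<tau> (snd z), to_cube m (snd z)) = s b"
      using G(2)[OF cube[OF x]] bd[OF to_cube_in_boundary[OF x]] z(2) by simp
  qed simp
  have \<Gamma>0: "\<Gamma> (0, x) = cap m ?f (f (south_pole m)) x" if "x \<in> topspace ?S" for x
    using G(2)[OF cube[OF that]] b(2) by (simp add: \<Gamma>_def cap_def)
  have "homot ?S N (cap m ?f (f (south_pole m))) (\<lambda>x. \<Gamma> (1, x))"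
    using \<Gamma> \<Gamma>0 by (intro homotopic_with[THEN iffD2] exI[of _ \<Gamma>]) auto
  then have "homot ?S N f (\<lambda>x. \<Gamma> (1, x))" by (rule homotopic_with_trans[OF homotopic_cap[OF f]])
  moreover have "\<Gamma> (1, x) \<noteq> y" if x: "x \<in> topspace ?S" for x
  proof (cases "0 \<le> x m")
    case False
    then show ?thesis using y(1) ps[OF b(1)] by (auto simp: \<Gamma>_def)
  next
    case True
    let ?z = "to_cube m x" and ?t = "\<tau> x"
    have z: "?z \<in> topspace ?C" using cube[OF x] .
    then have z0: "?z 0 \<in> {0..1}" using m by (auto simp: topspace_unit_cube PiE_iff)
    have \<Gamma>1: "\<Gamma> (1, x) = G (?t, ?z)" using True by (simp add: \<Gamma>_def)
    have fibre: "G (?t, ?z) \<noteq> y" if "?z(0 := ?z 0 * (1 - ?t)) \<in> cube_boundary m"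
      using bd[OF that] pG[OF \<tau>01 z] ps[OF b(1)] y(1) by auto
    have 1: "?z 0 * (1 - ?t) \<in> {0..1}" using z0 \<tau>01[of x] by (auto intro!: mult_le_one)
    \<comment> \<open>Full time ends over \<open>b\<close>; on the face \<open>z 0 = 1\<close> the
      push stays in the section; at partial time another boundary coordinate, or
      \<open>z 0 = 0\<close>, persists and keeps the value over \<open>b\<close>.\<close>
    consider "?t = 1" | "?z 0 = 1" | "?t \<noteq> 1" "?z 0 \<noteq> 1" by blast
    then show ?thesis
    proof cases
      case 1
      then show ?thesis using fibre face[OF z] \<Gamma>1 by simp
    next
      case 2
      then obtain c where "c \<in> topspace B" "G (?t, ?z) = s c" using sG[OF \<tau>01 z] by blast
      then show ?thesis using \<Gamma>1 ps y(2) by metis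
    next
      case 3
      then have "\<bar>x m\<bar> \<le> 1/2" using True by (auto simp: \<tau>_def)
      then obtain i where i: "i < m" "?z i = 0 \<or> ?z i = 1"
        using to_cube_in_boundary[OF x] unfolding cube_boundary_def by blast
      have "(?z(0 := ?z 0 * (1 - ?t))) i = 0 \<or> (?z(0 := ?z 0 * (1 - ?t))) i = 1"
        using i(2) 3(2) by (cases "i = 0") auto
      then have "?z(0 := ?z 0 * (1 - ?t)) \<in> cube_boundary m"
        using upd_in_unit_cube[OF z m 1] i(1) unfolding cube_boundary_def by blast
      then show ?thesis using fibre \<Gamma>1 by simp
    qed
  qed
  ultimately show ?thesis by blast
qed

lemma positive_dimensional_two_points:
  assumes "positive_dimensional X"
  obtains y where "y \<in> topspace X" "y \<noteq> a"
proof -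
  have "X dim_le 0" if sub: "topspace X \<subseteq> {a}"
    unfolding dimension_le_0_neighbourhood_base_of_clopen neighbourhood_base_of
  proof clarify
    fix W x assume W: "openin X W" "x \<in> W"
    then have "W = topspace X" using sub openin_subset by blast
    then show "\<exists>U V. openin X U \<and> (closedin X V \<and> openin X V) \<and> x \<in> U \<and> U \<subseteq> V \<and> V \<subseteq> W"
      using W by (intro exI[of _ W]) auto
  qed
  then show ?thesis using assms that unfolding positive_dimensional_def by blast
qed


section \<open>Low-dimensional spheres and non-compact targets\<close>

lemma compact_space_nsphere: "compact_space (nsphere m)"
proof -
  let ?T = "{x :: nat \<Rightarrow> real. (\<Sum>i\<le>m. (x i)\<^sup>2) = 1 \<and> (\<forall>i>m. x i = 0)}"
  let ?B = "PiE UNIV (\<lambda>_ :: nat. {-1..1::real})"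
  have "?T = (\<Inter>i\<in>{m<..}. {x. x i = 0}) \<inter> {x. (\<Sum>i\<le>m. (x i)\<^sup>2) = 1}" by auto
  also have "closed \<dots>"
    by (intro closed_Int closed_INT ballI closed_Collect_eq continuous_intros) auto
  finally have T: "closedin (powertop_real UNIV) ?T" by (simp add: euclidean_product_topology)
  have "x \<in> ?B" if x: "x \<in> ?T" for x
  proof -
    have "\<bar>x i\<bar> \<le> 1" for i
    proof (cases "i \<le> m")
      case True
      then have "(x i)\<^sup>2 \<le> (\<Sum>i\<le>m. (x i)\<^sup>2)" by (intro member_le_sum) auto
      then show ?thesis using x by (simp add: abs_square_le_1)
    qed (use x in auto)
    then show ?thesis by (auto simp: abs_le_iff)
  qed
  moreover have "compactin (powertop_real UNIV) ?B" unfolding compactin_PiE by auto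
  ultimately have "compactin (powertop_real UNIV) ?T" using closed_compactin[OF _ _ T] by blast
  then show ?thesis unfolding nsphere by (rule compact_space_subtopology)
qed

lemma noncompact_misses_point:
  assumes f: "continuous_map (nsphere m) N f" and N: "\<not> compact_space N"
  shows "\<exists>y\<in>topspace N. y \<notin> f ` topspace (nsphere m)"
proof (rule ccontr)
  assume "\<not> ?thesis"
  then have "f ` topspace (nsphere m) = topspace N"
    using continuous_map_image_subset_topspace[OF f] by blast
  moreover have "compactin N (f ` topspace (nsphere m))"
    using compact_space_nsphere f image_compactin unfolding compact_space_def by blast
  ultimately show False using N by (simp add: compact_space_def)
qed

text \<open>Inside one chart ball the map is replaced near the centre by a polynomial in ambient
  coordinates. The unit sphere of the model space has measure zero, hence so has its polynomial
  image, and a point near the centre of the chart is left out.\<close>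

lemma low_dimensional_misses_point:
  fixes \<psi> :: "real^'n \<Rightarrow> 'a"
  assumes N: "Hausdorff_space N" and \<psi>: "coord_ball N \<psi>" and f: "continuous_map (nsphere m) N f"
    and m: "m < CARD('n)"
  shows "\<exists>g. homot (nsphere m) N f g \<and> (\<exists>y\<in>topspace N. y \<notin> g ` topspace (nsphere m))"
proof -
  let ?S = "nsphere m" and ?U = "\<psi> ` ball 0 1"
  let ?D = "{z \<in> topspace (nsphere m). f z \<in> \<psi> ` ball 0 1}"
  \<comment> \<open>Here \<open>m < CARD('n)\<close> enters: the \<open>m + 1\<close> coordinates of
    the sphere fit into \<open>real^'n\<close>. Domain and target of the polynomial then have equal
    dimension, so it preserves negligibility.\<close>
  obtain \<iota> :: "nat \<Rightarrow> 'n" where \<iota>: "inj_on \<iota> {..m}"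
    using card_le_inj[of "{..m}" "UNIV :: 'n set"] m by auto
  define j where "j x = (\<Sum>i\<le>m. x i *\<^sub>R axis (\<iota> i) (1::real))" for x
  define \<kappa> where "\<kappa> v i = (if i \<le> m then v $ \<iota> i else 0)" for v :: "real^'n" and i
  have j_nth: "j x $ \<iota> i = x i" if "i \<le> m" for x i
  proof -
    have "j x $ \<iota> i = (\<Sum>k\<le>m. if k = i then x k else 0)"
      unfolding j_def sum_component using that \<iota> by (intro sum.cong refl) (auto simp: axis_def inj_on_eq_iff)
    then show ?thesis using that by simp
  qed
  have \<kappa>j: "\<kappa> (j x) = x" if "x \<in> topspace ?S" for x
    using that j_nth by (auto simp: \<kappa>_def topspace_nsphere fun_eq_iff)
  have norm_j: "j x \<in> sphere 0 1" if "x \<in> topspace ?S" for x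
  proof -
    have "(norm (j x))\<^sup>2 = (\<Sum>i\<le>m. (norm (x i *\<^sub>R axis (\<iota> i) (1::real)))\<^sup>2)"
      unfolding j_def using \<iota>
      by (intro norm_sum_Pythagorean) (auto simp: pairwise_def orthogonal_def inner_axis_axis inj_on_eq_iff)
    also have "\<dots> = 1" using that by (simp add: topspace_nsphere power_mult_distrib)
    finally show ?thesis using power2_eq_1_iff[of "norm (j x)"] norm_ge_zero[of "j x"] by auto
  qed
  have cont_j: "continuous_map ?S euclidean j"
    unfolding j_def by (intro continuous_intros continuous_map_nsphere_projection) auto
  define h where "h z = inv_into (ball 0 1) \<psi> (f z)" for z
  have inj: "inj_on \<psi> (ball 0 1)" using \<psi> by (simp add: coord_ball_def)
  have "continuous_map (subtopology ?S ?D) (subtopology N ?U) f"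
    using f by (auto simp: continuous_map_in_subtopology continuous_map_from_subtopology)
  from continuous_map_compose[OF this coord_ball_inverse[OF \<psi>]]
  have cont_h: "continuous_map (subtopology ?S ?D) euclidean h"
    by (simp add: h_def[abs_def] o_def continuous_map_in_subtopology)
  have h: "h z \<in> ball 0 1" "\<psi> (h z) = f z" if "z \<in> ?D" for z
    using that inv_into_into[of "f z" \<psi> "ball 0 1"] f_inv_into_f[of "f z" \<psi> "ball 0 1"] unfolding h_def by blast+
  define C where "C = {z \<in> topspace ?S. f z \<in> \<psi> ` cball 0 (1/2)}"
  have CD: "C \<subseteq> ?D" unfolding C_def by (auto intro!: imageI)
  have in_C: "z \<in> C" if "z \<in> ?D" "norm (h z) \<le> 1/2" for z
  proof -
    have "f z = \<psi> (h z)" "h z \<in> cball 0 (1/2)" using h(2)[OF that(1)] that(2) by auto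
    then show ?thesis using that(1) unfolding C_def by blast
  qed
  have "closedin ?S C" unfolding C_def
    by (intro closedin_continuous_map_preimage[OF f] coord_ball_closedin_cball \<psi> N) simp
  then have "compactin ?S C" using compact_space_nsphere closedin_compact_space by blast
  then have compC: "compact (j ` C)" using image_compactin[OF _ cont_j] by simp
  have "continuous_map (top_of_set (j ` C)) (subtopology ?S ?D) \<kappa>"
  proof (intro continuous_map_into_subtopology funcsetI)
    have "\<kappa> \<in> j ` C \<rightarrow> topspace ?S" using \<kappa>j C_def by auto
    moreover have "continuous_on (j ` C) (\<lambda>v. \<kappa> v i)" for i
      unfolding \<kappa>_def by (cases "i \<le> m") (auto intro!: continuous_intros)
    ultimately show "continuous_map (top_of_set (j ` C)) ?S \<kappa>" by (simp add: continuous_map_nsphere_iff)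
    fix v assume "v \<in> topspace (top_of_set (j ` C))"
    then show "\<kappa> v \<in> ?D" using \<kappa>j CD by auto
  qed
  from continuous_map_compose[OF this cont_h] have "continuous_on (j ` C) (\<lambda>v. h (\<kappa> v))" by (simp add: o_def)
  \<comment> \<open>An error below 1/8, together with a point \<open>q\<close> of norm below 1/8,
    forces \<open>h z\<close> to have norm below 1/4 wherever \<open>q\<close> is hit.\<close>
  from Stone_Weierstrass_polynomial_function[OF compC this, of "1/8"]
  obtain P where P: "polynomial_function P" "\<And>v. v \<in> j ` C \<Longrightarrow> norm (h (\<kappa> v) - P v) < 1/8" by auto
  have approx: "norm (P (j z) - h z) < 1/8" if "z \<in> ?D" "norm (h z) \<le> 1/2" for z
    using P(2)[of "j z"] in_C[OF that] \<kappa>j[of z] that(1) by (auto simp: norm_minus_commute)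
  \<comment> \<open>The cutoff is 1 for \<open>norm (h z) \<le> 1/4\<close> and 0 from 1/2 on, so
    \<open>k\<close> is the polynomial near the centre and \<open>h\<close> outside the half ball,
    where the approximation says nothing.\<close>
  define lam where "lam z = max 0 (min 1 (2 - 4 * norm (h z)))" for z
  define k where "k z = h z + lam z *\<^sub>R (P (j z) - h z)" for z
  have dist_k: "norm (k z - h z) < 1/8" if "z \<in> ?D" for z
  proof (cases "norm (h z) \<le> 1/2")
    case True
    have "norm (k z - h z) \<le> norm (P (j z) - h z)"
      by (simp add: k_def lam_def mult_left_le_one_le)
    then show ?thesis using approx[OF that True] by simp
  next
    case False
    then show ?thesis by (simp add: k_def lam_def)
  qed
  have k_in: "k z \<in> ball 0 1" if z: "z \<in> ?D" for z
  proof (cases "norm (h z) \<le> 1/2")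
    case True
    then have "norm (k z) < 1"
      using dist_k[OF z] norm_triangle_ineq[of "h z" "k z - h z"] by simp
    then show ?thesis by simp
  next
    case False
    then have "k z = h z" by (simp add: k_def lam_def)
    then show ?thesis using h(1)[OF z] by simp
  qed
  let ?g = "\<lambda>z. if f z \<in> ?U then \<psi> (k z) else f z"
  have hom: "homot ?S N f ?g"
  proof (rule coord_ball_modify[OF N \<psi> f])
    have "continuous_map euclidean euclidean P" using P(1) continuous_on_polymonial_function by auto
    from continuous_map_compose[OF cont_j this]
    have "continuous_map (subtopology ?S ?D) euclidean (\<lambda>z. P (j z))"
      by (simp add: o_def continuous_map_from_subtopology)
    then show "continuous_map (subtopology ?S ?D) euclidean k"
      unfolding k_def lam_def by (intro continuous_intros cont_h) auto
    fix z assume "z \<in> topspace ?S" "f z \<in> ?U"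
    then have z: "z \<in> ?D" by blast
    show "k z = inv_into (ball 0 1) \<psi> (f z)" if "1/2 < norm (inv_into (ball 0 1) \<psi> (f z))"
      using that by (simp add: k_def lam_def h_def)
    show "k z \<in> ball 0 1" by (rule k_in[OF z])
  qed
  have "negligible (P ` sphere 0 1)"
    by (intro negligible_differentiable_image_negligible negligible_sphere differentiable_on_polynomial_function P(1)) simp
  moreover have "\<not> negligible (ball (0::real^'n) (1/8))" by (intro open_not_negligible) auto
  ultimately have "\<not> ball 0 (1/8) \<subseteq> P ` sphere 0 1" using negligible_subset by blast
  then obtain q where q: "q \<in> ball 0 (1/8)" "q \<notin> P ` sphere 0 1" by blast
  then have q1: "q \<in> ball 0 1" by simp
  have "?g z \<noteq> \<psi> q" if z: "z \<in> topspace ?S" for z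
  proof
    assume eq: "?g z = \<psi> q"
    have D: "z \<in> ?D"
    proof (rule ccontr)
      assume "z \<notin> ?D"
      then have "f z \<notin> ?U" using z by blast
      with eq have "\<psi> q \<notin> ?U" by metis
      with q1 show False by blast
    qed
    have "f z \<in> ?U" using D by blast
    then have "\<psi> (k z) = \<psi> q" using eq by (simp del: mem_ball)
    then have kq: "k z = q" by (rule inj_onD[OF inj _ k_in[OF D] q1])
    then have "norm (h z) < 1/4"
      using dist_k[OF D] q(1) norm_triangle_ineq4[of q "k z - h z"] by auto
    then have "lam z = 1" by (simp add: lam_def)
    then have "q = P (j z)" using kq by (simp add: k_def)
    then show False using q(2) norm_j[OF z] by blast
  qed
  moreover have "\<psi> q \<in> topspace N" using q1 openin_subset[OF coord_ball_openin[OF \<psi>]] by blast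
  ultimately show ?thesis using hom
    by (intro exI[of _ ?g] conjI bexI[of _ "\<psi> q"] notI) (assumption | erule imageE, metis)+
qed


section \<open>Infinite fundamental group\<close>

context manifold_topology begin

text \<open>Induction on the number of points of \<open>P\<close> in the image, finite by
  compactness. A point \<open>z\<close> outside both the image and \<open>P\<close> is pushed onto a
  hit point \<open>p\<close> while the other points of \<open>P\<close> stay fixed; injectivity then
  frees \<open>p\<close> and creates no new hit.\<close>

lemma push_image_off_sparse:
  assumes conn: "connected_space X" and dim: "2 \<le> DIM('e)" and Z: "compact_space Z"
    and P: "P \<subseteq> topspace X" "infinite P"
    and sparse: "\<And>x. x \<in> topspace X \<Longrightarrow> \<exists>W. openin X W \<and> x \<in> W \<and> W \<inter> P \<subseteq> {x}"
    and F: "continuous_map Z X F"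
  shows "\<exists>F'. homot Z X F F' \<and> F' ` topspace Z \<inter> P = {}"
proof -
  have closed: "closedin X Q" if "Q \<subseteq> P" for Q
  proof -
    have "\<exists>T. openin X T \<and> x \<in> T \<and> T \<subseteq> topspace X - Q" if x: "x \<in> topspace X - Q" for x
    proof -
      obtain W where "openin X W" "x \<in> W" "W \<inter> P \<subseteq> {x}" using sparse x by blast
      then show ?thesis using x \<open>Q \<subseteq> P\<close> openin_subset[of X W] by (intro exI[of _ W]) blast
    qed
    then have "openin X (topspace X - Q)" by (subst openin_subopen) blast
    then show ?thesis using that P(1) by (auto simp: closedin_def)
  qed
  have compact_image: "compactin X (G ` topspace Z)" if "continuous_map Z X G" for G
    using Z that unfolding compact_space_def by (rule image_compactin)
  have finite_Int: "finite (K \<inter> P)" if K: "compactin X K" for K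
  proof -
    let ?\<U> = "{W. openin X W \<and> finite (W \<inter> P)}"
    have "K \<subseteq> \<Union>?\<U>"
    proof
      fix x assume "x \<in> K"
      then have "x \<in> topspace X" using compactin_subset_topspace[OF K] by blast
      then obtain W where W: "openin X W" "x \<in> W" "W \<inter> P \<subseteq> {x}" using sparse by blast
      then have "finite (W \<inter> P)" by (meson finite.emptyI finite_insert finite_subset)
      then show "x \<in> \<Union>?\<U>" using W by blast
    qed
    then obtain \<F> where \<F>: "finite \<F>" "\<F> \<subseteq> ?\<U>" "K \<subseteq> \<Union>\<F>"
      using K unfolding compactin_def by (metis (no_types, lifting) mem_Collect_eq)
    have "K \<inter> P \<subseteq> (\<Union>W\<in>\<F>. W \<inter> P)" using \<F>(3) by blast
    moreover have "finite (\<Union>W\<in>\<F>. W \<inter> P)" using \<F>(1,2) by blast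
    ultimately show ?thesis by (rule finite_subset)
  qed
  show ?thesis
    using F
  proof (induction "card (F ` topspace Z \<inter> P)" arbitrary: F rule: less_induct)
    case less
    let ?K = "F ` topspace Z"
    note K = compact_image[OF less.prems]
    show ?case
    proof (cases "?K \<inter> P = {}")
      case True
      then show ?thesis using less.prems by (intro exI[of _ F]) simp
    next
      case False
      then obtain p where p: "p \<in> ?K" "p \<in> P" by blast
      \<comment> \<open>Infinitude of \<open>P\<close> provides a point of \<open>P\<close> that is
        not hit. It cannot itself be moved, as \<open>P - {p}\<close> is to stay fixed, so a
        neighbour \<open>z\<close> off the image is used instead.\<close>
      have "\<not> P \<subseteq> ?K" using finite_Int[OF K] P(2) by (metis inf.absorb_iff2)
      then obtain p' where p': "p' \<in> P" "p' \<notin> ?K" by blast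
      obtain W where W: "openin X W" "p' \<in> W" "W \<inter> P \<subseteq> {p'}" using sparse P(1) p'(1) by blast
      have "openin X (W - ?K)" using W(1) compactin_imp_closedin[OF Hausdorff K] by (rule openin_diff)
      then obtain \<psi> :: "'e \<Rightarrow> 'a" where \<psi>: "coord_ball X \<psi>" "\<psi> 0 = p'" "\<psi> ` ball 0 1 \<subseteq> W - ?K"
        using coord_ball_at[of "W - ?K" p'] W(2) p'(2) by blast
      obtain i :: 'e where i: "i \<in> Basis" using nonempty_Basis by blast
      define z where "z = \<psi> ((1/2) *\<^sub>R i)"
      have hb: "(1/2) *\<^sub>R i \<in> ball 0 1" "(0::'e) \<in> ball 0 1" using i by simp_all
      have "(1/2) *\<^sub>R i \<noteq> 0" using i by auto
      then have "z \<noteq> p'" using inj_onD[of \<psi> "ball 0 1", OF _ _ hb] \<psi>(1,2) unfolding z_def coord_ball_def by metis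
      moreover have zW: "z \<in> W" "z \<notin> ?K" using hb(1) \<psi>(3) unfolding z_def by blast+
      ultimately have zP: "z \<notin> P" using W(3) by blast
      define M where "M = topspace X - (P - {p})"
      have cl: "closedin X (P - {p})" by (intro closed) blast
      have "openin X M" unfolding M_def using cl by (intro openin_diff) auto
      moreover have "connectedin X M" unfolding M_def
      proof (rule connectedin_minus_sparse[OF conn dim cl])
        fix x assume "x \<in> topspace X"
        then obtain W where "openin X W" "x \<in> W" "W \<inter> P \<subseteq> {x}" using sparse by blast
        then show "\<exists>W. openin X W \<and> x \<in> W \<and> W \<inter> (P - {p}) \<subseteq> {x}" by blast
      qed
      moreover have "z \<in> M" "p \<in> M" using zW(1) zP openin_subset[OF W(1)] p(2) P(1) unfolding M_def by blast+
      ultimately have "pushes_to M z p" by (intro pushes_to_connected)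
      then obtain \<theta> where \<theta>: "homot X X id \<theta>" "inj_on \<theta> (topspace X)" "\<forall>x\<in>topspace X - M. \<theta> x = x" "\<theta> z = p"
        unfolding pushes_to_def by blast
      have hom: "homot Z X F (\<theta> \<circ> F)"
        using homotopic_with_compose_continuous_map_right[OF \<theta>(1) less.prems] by simp
      \<comment> \<open>A point of \<open>P\<close> still hit is not \<open>p\<close>, because only
        \<open>z\<close> goes to \<open>p\<close>; being fixed, it was already hit before.\<close>
      have "(\<theta> \<circ> F) ` topspace Z \<inter> P \<subseteq> (?K \<inter> P) - {p}"
      proof
        fix y assume "y \<in> (\<theta> \<circ> F) ` topspace Z \<inter> P"
        then obtain \<xi> where \<xi>: "\<xi> \<in> topspace Z" "y = \<theta> (F \<xi>)" and yP: "y \<in> P" by auto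
        have F\<xi>: "F \<xi> \<in> topspace X" using \<xi>(1) continuous_map_image_subset_topspace[OF less.prems] by blast
        have zX: "z \<in> topspace X" using zW(1) openin_subset[OF W(1)] by blast
        have "y \<noteq> p"
        proof
          assume "y = p"
          then have "F \<xi> = z" using \<xi>(2) \<theta>(2,4) F\<xi> zX by (metis inj_onD)
          then show False using zW(2) \<xi>(1) by blast
        qed
        then have "y \<in> topspace X - M" using yP P(1) unfolding M_def by blast
        then have "\<theta> y = y" and yX: "y \<in> topspace X" using \<theta>(3) by auto
        then have "F \<xi> = y" using \<xi>(2) \<theta>(2) F\<xi> by (metis inj_onD)
        then show "y \<in> (?K \<inter> P) - {p}" using \<xi>(1) yP \<open>y \<noteq> p\<close> by blast
      qed
      moreover have "(?K \<inter> P) - {p} \<subset> ?K \<inter> P" using p by blast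
      ultimately have "(\<theta> \<circ> F) ` topspace Z \<inter> P \<subset> ?K \<inter> P" by (rule subset_psubset_trans)
      then have "card ((\<theta> \<circ> F) ` topspace Z \<inter> P) < card (?K \<inter> P)"
        using finite_Int[OF K] by (rule psubset_card_mono[rotated])
      moreover have "continuous_map Z X (\<theta> \<circ> F)" using hom homotopic_with_imp_continuous_maps by blast
      ultimately obtain F' where "homot Z X (\<theta> \<circ> F) F'" "F' ` topspace Z \<inter> P = {}" using less.hyps by blast
      then show ?thesis using homotopic_with_trans[OF hom] by blast
    qed
  qed
qed

end

section \<open>Lifting maps of spheres to the universal cover\<close>

lemma locally_path_connected_unit_cube: "locally_path_connected_space (unit_cube m)"
proof -
  have "locally_path_connected_space I01" "path_connected_space I01"
    by (simp_all add: convex_imp_locally_path_connected_space convex_imp_path_connected)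
  then show ?thesis unfolding unit_cube_def locally_path_connected_space_product_topology by simp
qed

text \<open>Lifting the cube along the segments in direction 0, which start on the boundary.\<close>

lemma lift_to_universal_cover:
  assumes f: "continuous_map (nsphere m) N f" and m: "2 \<le> m" and x: "f (south_pole m) = x" "x \<in> topspace N"
  shows "\<exists>F. continuous_map (nsphere m) (universal_cover N x) F \<and> homot (nsphere m) N f (path_end \<circ> F)"
proof -
  let ?C = "unit_cube m" and ?f = "f \<circ> cube_to_sphere m" and ?U = "universal_cover N x"
  have m0: "0 < m" and m1: "1 < m" using m by auto
  have fc: "continuous_map ?C N ?f" by (rule continuous_map_compose[OF continuous_map_cube_to_sphere f])
  have bd: "?f z = x" if "z \<in> cube_boundary m" for z
    using that x(1) by (simp add: cube_to_sphere_boundary)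
  have coord: "z i \<in> {0..1}" if "z \<in> topspace ?C" "i < m" for z i
    using that PiE_mem[of z "{..<m}" "\<lambda>_. {0..1}" i] by (simp add: topspace_unit_cube)
  have upd: "z(i := e) \<in> topspace ?C" if "z \<in> topspace ?C" "i < m" "e \<in> {0..1}" for z i e
    using that by (auto simp: topspace_unit_cube PiE_iff extensional_def)
  have in01: "s * t \<in> {0..1}" if "s \<in> {0..1}" "t \<in> {0..1}" for s t :: real using that by (auto intro: mult_le_one)
  \<comment> \<open>The path assigned to \<open>z\<close> starts on the face \<open>z 0 = 0\<close>,
    where the value is \<open>x\<close>, and ends with the value at \<open>z\<close>; so its class
    is a point of the cover over that value.\<close>
  define K where "K = (\<lambda>y. ?f ((snd y)(0 := fst y * snd y 0)))"
  have fst: "continuous_map (prod_topology I01 Y) euclideanreal fst" for Y :: "'z topology"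
    using continuous_map_fst continuous_map_in_subtopology by blast
  have "continuous_map (prod_topology I01 ?C) ?C (\<lambda>y. (snd y)(0 := fst y * snd y 0))"
  proof (intro continuous_map_upd_unit_cube continuous_map_snd m0)
    have "continuous_map (prod_topology I01 ?C) euclideanreal (\<lambda>y. snd y 0)"
      using continuous_map_compose[OF continuous_map_snd continuous_map_unit_cube_coord[OF m0]] by (simp add: o_def)
    then show "continuous_map (prod_topology I01 ?C) euclideanreal (\<lambda>y. fst y * snd y 0)"
      by (intro continuous_intros fst)
    fix y assume "y \<in> topspace (prod_topology I01 ?C)"
    then have "fst y \<in> {0..1}" "snd y \<in> topspace ?C" by auto
    then show "fst y * snd y 0 \<in> {0..1}" using coord[OF _ m0] in01 by blast
  qed
  from continuous_map_compose[OF this fc] have K: "continuous_map (prod_topology I01 ?C) N K"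
    by (simp only: K_def o_def)
  have face0: "z(0 := 0) \<in> cube_boundary m" if "z \<in> topspace ?C" for z
    using upd[OF that m0, of 0] m0 unfolding cube_boundary_def by (auto intro!: exI[of _ 0])
  have K0: "K (0, z) = x" if "z \<in> topspace ?C" for z
    using bd[OF face0[OF that]] by (simp add: K_def)
  have K1: "K (1, z) = ?f z" for z by (simp add: K_def)
  define \<Phi> where "\<Phi> z = path_class N (\<lambda>t. K (t, z))" for z
  have \<Phi>: "continuous_map ?C ?U \<Phi>"
    unfolding \<Phi>_def by (rule continuous_map_path_class_family[OF locally_path_connected_unit_cube K K0])
  define c where "c = path_class N (\<lambda>_. x)"
  have const: "pathin N (\<lambda>_. x)" using x(2) by (simp add: pathin_def)
  \<comment> \<open>A single class \<open>c\<close> on the whole boundary is what allows the lift to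
    be extended over the lower hemisphere.\<close>
  have \<Phi>_bd: "\<Phi> z = c" if z: "z \<in> cube_boundary m" for z
  proof -
    have zC: "z \<in> topspace ?C" using z by (simp add: cube_boundary_def)
    have "path_homotopic N (\<lambda>t. K (t, z)) (\<lambda>_. x)"
    proof (cases "z 0 = 1")
      case False
      \<comment> \<open>Off the face \<open>z 0 = 1\<close> either \<open>z 0 = 0\<close> or some
        other coordinate is 0 or 1, so the whole segment lies in the boundary.\<close>
      have const_K: "K (t, z) = x" if t: "t \<in> {0..1}" for t
      proof -
        obtain i where i: "i < m" "z i = 0 \<or> z i = 1" using z unfolding cube_boundary_def by blast
        have "(z(0 := t * z 0)) i = 0 \<or> (z(0 := t * z 0)) i = 1" using i(2) False by (cases "i = 0") auto
        then have "z(0 := t * z 0) \<in> cube_boundary m"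
          using i(1) upd[OF zC m0 in01[OF t coord[OF zC m0]]] unfolding cube_boundary_def by blast
        then show ?thesis using bd by (simp add: K_def)
      qed
      then show ?thesis unfolding path_homotopic_def
        using const by (subst homotopic_with_sym) (rule homotopic_with_equal; simp add: pathin_def)
    next
      case True
      \<comment> \<open>On the face \<open>z 0 = 1\<close> the segment may cross the interior of the
        cube. The loop is contracted by sliding coordinate 1 to 0, which moves the segment into the
        boundary; this second direction exists because \<open>m \<ge> 2\<close>.\<close>
      let ?z = "\<lambda>s t. z(1 := (1 - s) * z 1, 0 := t)"
      define H where "H = (\<lambda>y. ?f (?z (fst y) (snd y)))"
      have inC: "?z s t \<in> topspace ?C" if "s \<in> {0..1}" "t \<in> {0..1}" for s t
        using that coord[OF zC m1] by (intro upd zC m0 m1 in01) auto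
      have fst: "continuous_map (prod_topology I01 I01) euclideanreal fst" and snd: "continuous_map (prod_topology I01 I01) euclideanreal snd"
        using continuous_map_fst continuous_map_snd continuous_map_in_subtopology by blast+
      have "continuous_map (prod_topology I01 I01) ?C (\<lambda>y. ?z (fst y) (snd y))"
        unfolding continuous_map_unit_cube_iff
      proof (intro conjI allI impI funcsetI)
        fix i
        have "continuous_map (prod_topology I01 I01) euclideanreal (\<lambda>y. if i = 0 then snd y else if i = 1 then (1 - fst y) * z 1 else z i)"
          by (cases "i = 0"; cases "i = 1"; simp only: if_True if_False; intro continuous_intros fst snd) auto
        then show "continuous_map (prod_topology I01 I01) euclideanreal (\<lambda>y. (?z (fst y) (snd y)) i)"
          by (simp only: fun_upd_apply)
        fix y assume "y \<in> topspace (prod_topology I01 I01)"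
        then show "?z (fst y) (snd y) \<in> topspace ?C" by (intro inC) auto
      qed
      from continuous_map_compose[OF this fc] have H: "continuous_map (prod_topology I01 I01) N H"
        by (simp only: H_def o_def)
      have stay: "H (s, t) = x" if st: "s \<in> {0..1}" "t \<in> {0..1}" "s = 1 \<or> t = 0 \<or> t = 1" for s t
      proof -
        have "\<exists>i<m. ?z s t i = 0 \<or> ?z s t i = 1"
          using st(3) m0 m1 by (metis diff_self fun_upd_same fun_upd_other mult_zero_left zero_neq_one)
        then have "?z s t \<in> cube_boundary m" using inC[OF st(1,2)] unfolding cube_boundary_def by blast
        then show ?thesis using bd by (simp add: H_def)
      qed
      have "homotopic_with (\<lambda>r. r 0 = x \<and> r 1 = x) I01 N (\<lambda>t. K (t, z)) (\<lambda>_. x)"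
      proof (rule homotopic_with[THEN iffD2]; (intro exI[of _ H] conjI ballI H)?)
        show "H (0, t) = K (t, z)" for t using True by (simp add: H_def K_def)
      qed (auto simp: stay)
      moreover have "K (0, z) = x" "K (1, z) = x" using K0[OF zC] K1 bd[OF z] by auto
      ultimately show ?thesis unfolding path_homotopic_def by simp
    qed
    then show ?thesis unfolding \<Phi>_def c_def by (rule path_class_eq)
  qed
  let ?F = "cap m \<Phi> c"
  have "continuous_map (nsphere m) ?U ?F"
    using \<Phi> \<Phi>_bd path_class_in_cover[OF const] unfolding c_def by (intro continuous_map_cap) auto
  moreover have "homot (nsphere m) N (cap m ?f (f (south_pole m))) (path_end \<circ> ?F)"
  proof (rule homotopic_with_equal)
    show "continuous_map (nsphere m) N (cap m ?f (f (south_pole m)))"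
      using homotopic_cap[OF f] homotopic_with_imp_continuous_maps by blast
    fix y assume y: "y \<in> topspace (nsphere m)"
    have "path_end (\<Phi> z) = ?f z" if z: "z \<in> topspace ?C" for z
    proof -
      have "continuous_map I01 (prod_topology I01 ?C) (\<lambda>t. (t, z))"
        using z by (simp add: continuous_map_pairwise o_def)
      from continuous_map_compose[OF this K] have "pathin N (\<lambda>t. K (t, z))" by (simp add: pathin_def o_def)
      then show ?thesis by (simp add: \<Phi>_def path_end_class K1)
    qed
    moreover have "to_cube m y \<in> topspace ?C"
      using continuous_map_to_cube y continuous_map_image_subset_topspace by blast
    ultimately show "cap m ?f (f (south_pole m)) y = (path_end \<circ> ?F) y"
      using path_end_class[OF const] x(1) by (simp add: cap_def c_def)
  qed auto
  ultimately show ?thesis using homotopic_with_trans[OF homotopic_cap[OF f]] by blast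
qed

context manifold_topology begin

text \<open>The lift is pushed off the fibre of the cover over \<open>x\<close> and projected back.
  The fibre is infinite because it contains every loop class at \<open>x\<close>, and discrete
  because the end point is injective on sheets over a coordinate ball.\<close>

lemma infinite_fundamental_group_misses_point:
  assumes conn: "connected_space X" and dim: "2 \<le> DIM('e)" and x: "x \<in> topspace X"
    and inf: "infinite (carrier (fundamental_group X x))"
    and f: "continuous_map (nsphere m) X f" and m: "2 \<le> m" and fx: "f (south_pole m) = x"
  shows "\<exists>g. homot (nsphere m) X f g \<and> x \<notin> g ` topspace (nsphere m)"
proof -
  let ?U = "universal_cover X x"
  interpret U: manifold_topology ?U "TYPE('e)" by (rule manifold_universal_cover)
  define P where "P = {c \<in> topspace ?U. path_end c = x}"
  \<comment> \<open>On loops \<open>loop_class\<close> and \<open>path_class\<close> are the same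
    set, so elements of the fundamental group literally are points of the fibre.\<close>
  have "loop_class X x p = path_class X p \<and> pathin X p \<and> p 0 = x \<and> p 1 = x" if "loop_at X x p" for p
    using that by (simp add: loop_class_def path_class_def path_homotopic_def loop_at_def)
  then have "carrier (fundamental_group X x) \<subseteq> P"
    by (auto simp: fundamental_group_def P_def path_class_in_cover path_end_class)
  then have infP: "infinite P" using inf finite_subset by blast
  have "closedin X {x}" using closedin_Hausdorff_singleton[OF Hausdorff x] .
  then have "closedin ?U {c \<in> topspace ?U. path_end c \<in> {x}}"
    by (rule closedin_continuous_map_preimage[OF continuous_map_path_end])
  then have closedP: "closedin ?U P" by (simp add: P_def)
  have sparse: "\<exists>W. openin ?U W \<and> c \<in> W \<and> W \<inter> P \<subseteq> {c}" if c: "c \<in> topspace ?U" for c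
  proof (cases "c \<in> P")
    case False
    then show ?thesis using c closedP by (intro exI[of _ "topspace ?U - P"]) auto
  next
    case True
    obtain p where p: "pathin X p" "p 0 = x" "c = path_class X p" using c by (rule cover_pointE)
    then have p1: "p 1 = x" using True by (simp add: P_def path_end_class)
    obtain \<psi> :: "'e \<Rightarrow> 'a" where \<psi>: "coord_ball X \<psi>" "\<psi> 0 = x" using coord_ball_at[OF openin_topspace x] by blast
    let ?W = "sheet X p (\<psi> ` ball 0 1)"
    have "x \<in> \<psi> ` ball 0 1" using \<psi>(2) by (metis centre_in_ball image_eqI zero_less_one)
    then have cW: "c \<in> ?W" unfolding p(3) using p(1) p1 by (intro path_class_in_sheet) auto
    have "d = c" if "d \<in> ?W \<inter> P" for d
      using path_end_inj_on_sheet[OF \<psi>(1) _ cW, of d] that True by (simp add: P_def)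
    moreover have "openin ?U ?W" by (rule openin_sheet[of X _ p x, OF coord_ball_openin[OF \<psi>(1)] p(2)])
    ultimately show ?thesis using cW by blast
  qed
  obtain F where F: "continuous_map (nsphere m) ?U F" "homot (nsphere m) X f (path_end \<circ> F)"
    using lift_to_universal_cover[OF f m fx x] by blast
  obtain F' where F': "homot (nsphere m) ?U F F'" "F' ` topspace (nsphere m) \<inter> P = {}"
    using U.push_image_off_sparse[OF connected_universal_cover dim compact_space_nsphere _ infP sparse F(1)]
    unfolding P_def by blast
  have "homot (nsphere m) X (path_end \<circ> F) (path_end \<circ> F')"
    using homotopic_with_compose_continuous_map_left[OF F'(1) continuous_map_path_end] by simp
  then have "homot (nsphere m) X f (path_end \<circ> F')" by (rule homotopic_with_trans[OF F(2)])
  moreover have "x \<notin> (path_end \<circ> F') ` topspace (nsphere m)"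
  proof
    assume "x \<in> (path_end \<circ> F') ` topspace (nsphere m)"
    then obtain y where y: "y \<in> topspace (nsphere m)" "path_end (F' y) = x" by auto
    have "continuous_map (nsphere m) ?U F'" using F'(1) homotopic_with_imp_continuous_maps by blast
    then have "F' y \<in> topspace ?U" using y(1) continuous_map_image_subset_topspace by blast
    then have "F' y \<in> P" using y(2) by (simp add: P_def)
    then show False using F'(2) y(1) by blast
  qed
  ultimately show ?thesis by blast
qed

end


section \<open>Loose pairs\<close>

text \<open>A chart at \<open>x\<close> is inverted and precomposed with an affine map of the unit
  ball onto a small ball around the image of \<open>x\<close>, chosen inside the image of
  \<open>U \<inter> W\<close>.\<close>

lemma manifold_topology_smooth_manifold:
  fixes \<A> :: "('a set \<times> ('a \<Rightarrow> real^'n)) set"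
  assumes "smooth_manifold N \<A>"
  shows "manifold_topology TYPE(real^'n) N"
proof
  show "Hausdorff_space N" using assms by (simp add: smooth_manifold_def)
  fix W x assume W: "openin N W" "x \<in> W"
  then have "x \<in> topspace N" using openin_subset by blast
  then obtain U \<phi> where U: "(U, \<phi>) \<in> \<A>" "x \<in> U" using assms by (auto simp: smooth_manifold_def)
  then have "is_chart N (U, \<phi>)" using assms by (auto simp: smooth_manifold_def)
  then have opU: "openin N U" "open (\<phi> ` U)" and hom: "homeomorphic_map (subtopology N U) (top_of_set (\<phi> ` U)) \<phi>"
    by (auto simp: is_chart_def)
  obtain g where g: "homeomorphic_maps (subtopology N U) (top_of_set (\<phi> ` U)) \<phi> g"
    using hom unfolding homeomorphic_map_maps by blast
  have topU: "topspace (subtopology N U) = U" using openin_subset[OF opU(1)] by auto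
  have g\<phi>: "g (\<phi> u) = u" if "u \<in> U" for u using g that topU by (simp add: homeomorphic_maps_def)
  have \<phi>g: "\<phi> (g v) = v" if "v \<in> \<phi> ` U" for v using g\<phi> that by auto
  have cont_g: "continuous_map (top_of_set (\<phi> ` U)) N g"
    using g by (simp add: homeomorphic_maps_def continuous_map_in_subtopology)
  have hom_g: "homeomorphic_map (top_of_set (\<phi> ` U)) (subtopology N U) g"
    using g homeomorphic_maps_sym homeomorphic_maps_map by blast
  have "openin (subtopology N U) (U \<inter> W)" using W(1) by (simp add: openin_subtopology_Int2)
  then have "openin (top_of_set (\<phi> ` U)) (\<phi> ` (U \<inter> W))"
    using homeomorphic_imp_open_map[OF hom] unfolding open_map_def by blast
  then have "open (\<phi> ` (U \<inter> W))" using opU(2) openin_open_trans by blast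
  then obtain r where r: "0 < r" "ball (\<phi> x) r \<subseteq> \<phi> ` (U \<inter> W)"
    using U(2) W(2) open_contains_ball by blast
  define a where "a v = \<phi> x + r *\<^sub>R v" for v :: "real^'n"
  have a_in: "a v \<in> \<phi> ` (U \<inter> W)" if "v \<in> ball 0 1" for v
    using r that by (auto simp: a_def dist_norm intro!: subsetD[OF r(2)])
  have aU: "a ` ball 0 1 \<subseteq> \<phi> ` U" using a_in by blast
  have "coord_ball N (g \<circ> a)"
    unfolding coord_ball_def
  proof (intro conjI allI impI)
    have "continuous_map (top_of_set (ball 0 1)) (top_of_set (\<phi> ` U)) a"
      using aU unfolding a_def by (intro continuous_map_into_subtopology) (auto intro!: continuous_intros)
    then show "continuous_map (top_of_set (ball 0 1)) N (g \<circ> a)" by (rule continuous_map_compose[OF _ cont_g])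
    show "inj_on (g \<circ> a) (ball 0 1)"
    proof (rule inj_onI)
      fix v w assume v: "v \<in> ball 0 1" and w: "w \<in> ball 0 1" and eq: "(g \<circ> a) v = (g \<circ> a) w"
      have "a v \<in> \<phi> ` U" "a w \<in> \<phi> ` U" using v w aU by blast+
      then have "a v = a w" using \<phi>g eq by (metis comp_apply)
      then show "v = w" using r(1) by (simp add: a_def)
    qed
    fix V :: "(real^'n) set" assume V: "open V" "V \<subseteq> ball 0 1"
    have "a ` V = (\<lambda>w. \<phi> x + w) ` ((*\<^sub>R) r ` V)" by (simp add: a_def image_image)
    then have "open (a ` V)" using V(1) r(1) by (simp add: open_scaling open_translation)
    moreover have "a ` V \<subseteq> \<phi> ` U" using V(2) aU by blast
    ultimately have "openin (top_of_set (\<phi> ` U)) (a ` V)" using opU(2) by (simp add: openin_open_eq)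
    then have "openin (subtopology N U) (g ` a ` V)"
      using homeomorphic_imp_open_map[OF hom_g] unfolding open_map_def by blast
    then show "openin N ((g \<circ> a) ` V)" using opU(1) by (simp add: openin_open_subtopology image_comp)
  qed
  moreover have "(g \<circ> a) 0 = x" using g\<phi>[OF U(2)] by (simp add: a_def)
  moreover have "(g \<circ> a) ` ball 0 1 \<subseteq> W"
  proof clarify
    fix v :: "real^'n" assume "v \<in> ball 0 1"
    then obtain u where "u \<in> U" "u \<in> W" "a v = \<phi> u" using a_in by blast
    then show "(g \<circ> a) v \<in> W" using g\<phi> by simp
  qed
  ultimately show "\<exists>\<psi> :: real^'n \<Rightarrow> 'a. coord_ball N \<psi> \<and> \<psi> 0 = x \<and> \<psi> ` ball 0 1 \<subseteq> W" by blast
qed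

text \<open>The collapse through the cube only takes values of \<open>f\<close>, so the missed point
  stays missed.\<close>

lemma homotopic_constant_on_lower_hemisphere:
  assumes f: "continuous_map (nsphere m) N f" and y: "y \<notin> f ` topspace (nsphere m)"
  shows "\<exists>g. homot (nsphere m) N f g \<and> y \<notin> g ` topspace (nsphere m) \<and>
           (\<forall>x\<in>topspace (nsphere m). x m \<le> 0 \<longrightarrow> g x = f (south_pole m))"
proof -
  let ?g = "cap m (f \<circ> cube_to_sphere m) (f (south_pole m))"
  have "?g x \<in> f ` topspace (nsphere m)" if x: "x \<in> topspace (nsphere m)" for x
  proof -
    have "cube_to_sphere m (to_cube m x) \<in> topspace (nsphere m)"
      using continuous_map_compose[OF continuous_map_to_cube continuous_map_cube_to_sphere, of m]
        continuous_map_image_subset_topspace x by fastforce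
    then show ?thesis using south_pole_in_nsphere by (auto simp: cap_def)
  qed
  then have "y \<notin> ?g ` topspace (nsphere m)" using y by blast
  moreover have "?g x = f (south_pole m)" if "x \<in> topspace (nsphere m)" "x m \<le> 0" for x
    using that by (rule cap_lower) (simp add: cube_to_sphere_boundary)
  ultimately show ?thesis using homotopic_cap[OF f] by blast
qed

text \<open>Reflection in the last coordinate, applied before and after, exchanges the
  hemispheres.\<close>

lemma homotopic_constant_on_upper_hemisphere:
  assumes f: "continuous_map (nsphere m) N f" and y: "y \<notin> f ` topspace (nsphere m)"
  shows "\<exists>g z. homot (nsphere m) N f g \<and> y \<notin> g ` topspace (nsphere m) \<and> z \<in> f ` topspace (nsphere m) \<and>
           (\<forall>x\<in>topspace (nsphere m). 0 \<le> x m \<longrightarrow> g x = z)"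
proof -
  define \<rho> where "\<rho> = (\<lambda>x i. if i = m then - x i else x i :: real)"
  have \<rho>: "continuous_map (nsphere m) (nsphere m) \<rho>" unfolding \<rho>_def by (rule continuous_map_nsphere_reflection)
  have \<rho>_in: "\<rho> x \<in> topspace (nsphere m)" if "x \<in> topspace (nsphere m)" for x
    using that continuous_map_image_subset_topspace[OF \<rho>] by blast
  have \<rho>\<rho>: "\<rho> \<circ> \<rho> = id" by (auto simp: \<rho>_def fun_eq_iff)
  have "y \<notin> (f \<circ> \<rho>) ` topspace (nsphere m)" using y \<rho>_in by auto
  from homotopic_constant_on_lower_hemisphere[OF continuous_map_compose[OF \<rho> f] this]
  obtain g where g: "homot (nsphere m) N (f \<circ> \<rho>) g" "y \<notin> g ` topspace (nsphere m)"
      "\<forall>x\<in>topspace (nsphere m). x m \<le> 0 \<longrightarrow> g x = (f \<circ> \<rho>) (south_pole m)" by blast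
  have "homot (nsphere m) N ((f \<circ> \<rho>) \<circ> \<rho>) (g \<circ> \<rho>)"
    by (rule homotopic_with_compose_continuous_map_right[OF g(1) \<rho>]) simp
  then have "homot (nsphere m) N f (g \<circ> \<rho>)" by (simp add: comp_assoc \<rho>\<rho>)
  moreover have "y \<notin> (g \<circ> \<rho>) ` topspace (nsphere m)" using g(2) \<rho>_in by auto
  moreover have "(g \<circ> \<rho>) x = (f \<circ> \<rho>) (south_pole m)" if "x \<in> topspace (nsphere m)" "0 \<le> x m" for x
    using g(3) \<rho>_in[OF that(1)] that(2) by (simp add: \<rho>_def)
  moreover have "(f \<circ> \<rho>) (south_pole m) \<in> f ` topspace (nsphere m)"
    using \<rho>_in[OF south_pole_in_nsphere] by simp
  ultimately show ?thesis by blast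
qed

section \<open>From missed points to loose pairs\<close>

context manifold_topology begin

text \<open>Homotopies are free, so pushing the value at \<open>a\<close> prescribes it. This puts
  the value at the south pole at the base point of the cover, or onto the section.\<close>

lemma homotopic_with_value_at_point:
  assumes conn: "connected_space X" and f: "continuous_map Z X f" and a: "a \<in> topspace Z" and b: "b \<in> topspace X"
  shows "\<exists>g. homot Z X f g \<and> g a = b"
proof -
  have "f a \<in> topspace X" using a continuous_map_image_subset_topspace[OF f] by blast
  then have "pushes_to (topspace X) (f a) b"
    using conn b by (intro pushes_to_connected) (auto simp: connectedin_topspace)
  then obtain \<theta> where \<theta>: "homot X X id \<theta>" "\<theta> (f a) = b" unfolding pushes_to_def by blast
  have "homot Z X f (\<theta> \<circ> f)"
    using homotopic_with_compose_continuous_map_right[OF \<theta>(1) f] by simp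
  then show ?thesis using \<theta>(2) by (intro exI[of _ "\<theta> \<circ> f"]) simp
qed

lemma loose_if_maps_miss_points:
  assumes conn: "connected_space X" and dim: "2 \<le> DIM('e)"
    and miss: "\<And>f. continuous_map (nsphere m) X f \<Longrightarrow>
       \<exists>g. homot (nsphere m) X f g \<and> (\<exists>y\<in>topspace X. y \<notin> g ` topspace (nsphere m))"
    and f1: "continuous_map (nsphere m) X f1" and f2: "continuous_map (nsphere m) X f2"
  shows "loose (nsphere m) X f1 f2"
proof -
  let ?S = "nsphere m"
  obtain h1 y1 where h1: "homot ?S X f1 h1" "y1 \<in> topspace X" "y1 \<notin> h1 ` topspace ?S" using miss[OF f1] by blast
  obtain h2 y2 where h2: "homot ?S X f2 h2" "y2 \<in> topspace X" "y2 \<notin> h2 ` topspace ?S" using miss[OF f2] by blast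
  have c1: "continuous_map ?S X h1" and c2: "continuous_map ?S X h2"
    using h1(1) h2(1) homotopic_with_imp_continuous_maps by blast+
  obtain g1 where g1: "homot ?S X h1 g1" "y1 \<notin> g1 ` topspace ?S"
      "\<forall>x\<in>topspace ?S. x m \<le> 0 \<longrightarrow> g1 x = h1 (south_pole m)"
    using homotopic_constant_on_lower_hemisphere[OF c1 h1(3)] by blast
  obtain g2 z2 where g2: "homot ?S X h2 g2" "y2 \<notin> g2 ` topspace ?S" "z2 \<in> h2 ` topspace ?S"
      "\<forall>x\<in>topspace ?S. 0 \<le> x m \<longrightarrow> g2 x = z2"
    using homotopic_constant_on_upper_hemisphere[OF c2 h2(3)] by blast
  define z1 where "z1 = h1 (south_pole m)"
  have z1: "z1 \<in> topspace X" "z1 \<noteq> y1"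
    using h1(3) south_pole_in_nsphere continuous_map_image_subset_topspace[OF c1] unfolding z1_def by blast+
  have z2: "z2 \<in> topspace X" "z2 \<noteq> y2"
    using h2(3) g2(3) continuous_map_image_subset_topspace[OF c2] by blast+
  \<comment> \<open>The first push turns the constant value \<open>z1\<close> on the lower
    hemisphere into the value \<open>y2\<close> that the second map misses.\<close>
  have "pushes_to (topspace X) z1 y2"
    using conn z1(1) h2(2) by (intro pushes_to_connected) (auto simp: connectedin_topspace)
  then obtain \<theta> where \<theta>: "homot X X id \<theta>" "inj_on \<theta> (topspace X)" "\<theta> z1 = y2" unfolding pushes_to_def by blast
  have c\<theta>: "continuous_map X X \<theta>" using \<theta>(1) homotopic_with_imp_continuous_maps by blast
  have "\<theta> y1 \<noteq> y2" using \<theta>(2,3) z1 h1(2) by (metis inj_onD)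
  moreover have "\<theta> y1 \<in> topspace X" using h1(2) continuous_map_image_subset_topspace[OF c\<theta>] by blast
  moreover have cl: "closedin X {y2}" using closedin_Hausdorff_singleton[OF Hausdorff h2(2)] .
  moreover have "connectedin X (topspace X - {y2})"
  proof (rule connectedin_minus_sparse[OF conn dim cl])
    show "\<exists>W. openin X W \<and> x \<in> W \<and> W \<inter> {y2} \<subseteq> {x}" if "x \<in> topspace X" for x
    proof (cases "x = y2")
      case False
      then show ?thesis using cl that by (intro exI[of _ "topspace X - {y2}"]) auto
    qed (use that in \<open>auto intro!: exI[of _ "topspace X"]\<close>)
  qed
  \<comment> \<open>The second push must keep \<open>y2\<close> in place, so it moves points only in
    its complement; injectivity of \<open>\<theta>\<close> gave
    \<open>\<theta> y1 \<noteq> y2\<close>, hence both of its ends lie there.\<close>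
  ultimately have "pushes_to (topspace X - {y2}) (\<theta> y1) z2"
    using z2 by (intro pushes_to_connected) auto
  then obtain \<eta> where \<eta>: "homot X X id \<eta>" "inj_on \<eta> (topspace X)" "\<eta> y2 = y2" "\<eta> (\<theta> y1) = z2"
    unfolding pushes_to_def using h2(2) by blast
  define \<mu> where "\<mu> = \<eta> \<circ> \<theta>"
  have \<mu>: "\<mu> z1 = y2" "\<mu> y1 = z2" using \<theta>(3) \<eta>(3,4) by (auto simp: \<mu>_def)
  have inj: "inj_on \<mu> (topspace X)" unfolding \<mu>_def
    using \<theta>(2) \<eta>(2) continuous_map_image_subset_topspace[OF c\<theta>] by (blast intro: comp_inj_on inj_on_subset)
  have "homot X X \<theta> \<mu>" unfolding \<mu>_def
    using homotopic_with_compose_continuous_map_right[OF \<eta>(1) c\<theta>] by simp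
  then have "homot X X id \<mu>" by (rule homotopic_with_trans[OF \<theta>(1)])
  moreover have cg1: "continuous_map ?S X g1" using g1(1) homotopic_with_imp_continuous_maps by blast
  ultimately have "homot ?S X (id \<circ> g1) (\<mu> \<circ> g1)"
    by (intro homotopic_with_compose_continuous_map_right) auto
  then have "homot ?S X f1 (\<mu> \<circ> g1)"
    using homotopic_with_trans[OF h1(1) homotopic_with_trans[OF g1(1)]] by simp
  moreover have "homot ?S X f2 g2" by (rule homotopic_with_trans[OF h2(1) g2(1)])
  moreover have "(\<mu> \<circ> g1) x \<noteq> g2 x" if x: "x \<in> topspace ?S" for x
  proof (cases "x m \<le> 0")
    case True
    then have "(\<mu> \<circ> g1) x = y2" using g1(3) x \<mu>(1) by (simp add: z1_def)
    then show ?thesis using g2(2) x by auto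
  next
    case False
    then have "g2 x = \<mu> y1" using g2(4) x \<mu>(2) by simp
    moreover have "g1 x \<noteq> y1" using g1(2) x by blast
    moreover have "g1 x \<in> topspace X" using x continuous_map_image_subset_topspace[OF cg1] by blast
    ultimately show ?thesis using inj h1(2) by (metis comp_apply inj_onD)
  qed
  ultimately show ?thesis unfolding loose_def by blast
qed

end

theorem proposition1p3:
  fixes m :: nat
    and N :: "'a topology"
    and \<A> :: "('a set \<times> ('a \<Rightarrow> real^'n)) set"
  assumes "m \<ge> 2" and "CARD('n) \<ge> 2"
    and "smooth_manifold N \<A>" and "connected_space N"
    and "m < CARD('n)
       \<or> \<not> compact_space N
       \<or> (\<exists>x\<in>topspace N. infinite (carrier (fundamental_group N x)))
       \<or> (\<exists>(B :: 'b topology) p s. serre_fibration N B p \<and> retraction_maps N B p s \<and>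
            positive_dimensional B \<and> (\<exists>b\<in>topspace B. positive_dimensional (fibre N p b)))"
  shows "\<forall>f\<^sub>1 f\<^sub>2. continuous_map (nsphere m) N f\<^sub>1 \<and> continuous_map (nsphere m) N f\<^sub>2
           \<longrightarrow> loose (nsphere m) N f\<^sub>1 f\<^sub>2"
proof -
  interpret manifold_topology N "TYPE(real^'n)"
    by (rule manifold_topology_smooth_manifold[OF assms(3)])
  have dim: "2 \<le> DIM(real^'n)" using assms(2) by simp
  have miss: "\<exists>g. homot (nsphere m) N f g \<and> (\<exists>y\<in>topspace N. y \<notin> g ` topspace (nsphere m))"
    if f: "continuous_map (nsphere m) N f" for f
  proof -
    have rebase: "\<exists>g. homot (nsphere m) N f g \<and> continuous_map (nsphere m) N g \<and> g (south_pole m) = b"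
      if "b \<in> topspace N" for b
      using homotopic_with_value_at_point[OF assms(4) f south_pole_in_nsphere that]
        homotopic_with_imp_continuous_maps by blast
    have fS: "f (south_pole m) \<in> topspace N"
      using continuous_map_image_subset_topspace[OF f] south_pole_in_nsphere by blast
    consider (low) "m < CARD('n)" | (noncompact) "\<not> compact_space N"
      | (group) x where "x \<in> topspace N" "infinite (carrier (fundamental_group N x))"
      | (fibration) B :: "'b topology" and p s b where "serre_fibration N B p" "retraction_maps N B p s"
          "positive_dimensional B" "b \<in> topspace B" "positive_dimensional (fibre N p b)"
      using assms(5) by blast
    then show ?thesis
    proof cases
      case low
      obtain \<psi> :: "real^'n \<Rightarrow> 'a" where "coord_ball N \<psi>" using coord_ball_at[OF openin_topspace fS] by blast
      then show ?thesis using low_dimensional_misses_point[OF Hausdorff _ f low] by blast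
    next
      case noncompact
      then show ?thesis using noncompact_misses_point[OF f noncompact] f by (intro exI[of _ f]) simp
    next
      case (group x)
      obtain g where g: "homot (nsphere m) N f g" "continuous_map (nsphere m) N g" "g (south_pole m) = x"
        using rebase[OF group(1)] by blast
      obtain g' where "homot (nsphere m) N g g'" "x \<notin> g' ` topspace (nsphere m)"
        using infinite_fundamental_group_misses_point[OF assms(4) dim group(1,2) g(2) assms(1) g(3)] by blast
      then show ?thesis using homotopic_with_trans[OF g(1)] group(1) by blast
    next
      case (fibration B p s b)
      \<comment> \<open>The point \<open>c\<close>, not \<open>b\<close>, becomes the base value for
        \<open>fibration_homotopic_avoiding\<close>; \<open>y\<close> is taken over
        \<open>b\<close>, so it is not over \<open>c\<close>, and different from \<open>s b\<close>,
        so it is not on the section.\<close>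
      obtain c where c: "c \<in> topspace B" "c \<noteq> b" using fibration(3) by (rule positive_dimensional_two_points)
      obtain y where "y \<in> topspace (fibre N p b)" "y \<noteq> s b" using fibration(5) by (rule positive_dimensional_two_points)
      then have y: "y \<in> topspace N" "p y \<noteq> c" "s (p y) \<noteq> y" using c(2) by (auto simp: fibre_def)
      have "s c \<in> topspace N"
        using fibration(2) c(1) continuous_map_image_subset_topspace unfolding retraction_maps_def by fastforce
      then obtain g where g: "homot (nsphere m) N f g" "continuous_map (nsphere m) N g" "g (south_pole m) = s c"
        using rebase by blast
      have "0 < m" using assms(1) by simp
      then obtain g' where "homot (nsphere m) N g g'" "y \<notin> g' ` topspace (nsphere m)"
        using fibration_homotopic_avoiding[OF fibration(1,2) g(2) _ c(1) g(3) y(2,3)] by blast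
      then show ?thesis using homotopic_with_trans[OF g(1)] y(1) by blast
    qed
  qed
  show ?thesis using loose_if_maps_miss_points[OF assms(4) dim miss] by blast
qed

end
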